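(* Let $k\in\mathbb{Q}^+$ with $k\ge1$, let $m\in\mathbb{Z}^+$ be arbitrarily large, let $d\in\{2,\dots,m\}$ and let $h\in\mathbb{Z}^+$. Suppose that $km,kd\in\mathbb{Z}^+$. Let $X_0,X_1,\dots,X_h$ be sets with $|X_i|=k^im$. For $1\le i\le h$ let $G_i=G_i[X_{i-1},X_i]\sim G(k,k^{i-1}m,d)$ be a random biregular bipartite directed graph on $(X_{i-1},X_i)$. Let $G$ be the graph with vertex set $V(G)=X_0\cup\dots\cup X_h$ and edge set $E(G)=\bigcup_{i=1}^h E(G_i)$. Then: (i) the graph $G$ is not commutative with high probability when $d\le\sqrt{\tfrac13 k^{h-2}m\log(km)}$; (ii) the graph $G$ is commutative with high probability when $d\ge 3\sqrt{k^{h-2}m\log(hk^{h+1}m)}$.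
   Context: Given $k\in\mathbb{Q}^+$ and positive integers $n,d$ with $kn,kd\in\mathbb{Z}^+$ and $1\le d\le n$, and sets $Y,Z$ with $|Y|=n$, $|Z|=kn$, let $\mathcal{G}(k,n,d)$ be the family of biregular bipartite directed labelled graphs on vertex set $(Y,Z)$, with edges directed from $Y$ to $Z$, in which every $y\in Y$ has out-degree $kd$ and every $z\in Z$ has in-degree $d$. $G\sim G(k,n,d)$ means that $G$ is chosen uniformly at random from $\mathcal{G}(k,n,d)$. For a vertex $v$ of a directed graph, $\Gamma(v)$ is its set of out-neighbours and $\Gamma^{-1}(v)$ its set of in-neighbours. A perfect matching between two vertex sets of equal size is a collection of vertex-disjoint edges joining them that covers both sets. A directed layered graph $G$ with vertex set $X_0\cup X_1\cup\dots\cup X_h$ is called commutative if: 1. there are edges only between consecutive layers, so that $E(X_i,X_j)=\emptyset$ unless $j=i+1$, for all $0\le i,j\le h$; 2. (Plünnecke's upward condition) for all $1\le i\le h$ and $uv\in E(X_{i-1},X_i)$ there exists a perfect matching from a subset of $\Gamma(u)$ to $\Gamma(v)$; 3. (Plünnecke's downward condition) for all $1\le i\le h$ and $uv\in E(X_i,X_{i+1})$ there exists a perfect matching from a subset of $\Gamma^{-1}(v)$ to $\Gamma^{-1}(u)$ (there is no layer $X_{h+1}$, so the case $i=h$ is vacuous). A property holds with high probability if the probability that it is satisfied tends to $1$ as the size parameter (here $m$) tends to infinity.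
   Formalization: Part (i) is proved only for h ≥ 2: for h = 1 every such G is commutative (vertices of X_1 have no out-neighbours and the downward condition is vacuous), so (i) fails there, e.g. for k = 1, d = 2 and m large. *)

theory Defs
  imports "HOL-Probability.Probability"
begin

text \<open>
  A finite simple directed graph is represented by its edge relation \<open>E\<close>; the out-neighbours of
  \<open>v\<close> are \<open>E `` {v}\<close> and the in-neighbours are \<open>E\<inverse> `` {v}\<close>.
\<close>

text \<open>
  The family of biregular graphs on \<open>(Y, Z)\<close>, with \<open>n = card Y\<close>. The size condition
  \<open>card Z = k * n\<close> is imposed where the family is used.
\<close>

definition biregular_digraphs :: "rat \<Rightarrow> nat \<Rightarrow> 'v set \<Rightarrow> 'v set \<Rightarrow> ('v \<times> 'v) set set" where
  "biregular_digraphs k d Y Z =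
     {E. E \<subseteq> Y \<times> Z \<and>
         (\<forall>y\<in>Y. rat_of_nat (card (E `` {y})) = k * rat_of_nat d) \<and>
         (\<forall>z\<in>Z. card (E\<inverse> `` {z}) = d)}"

text \<open>
  The orientation of the matching edges is not prescribed: in the upward condition below they
  are directed from \<open>A\<close> to \<open>B\<close>, in the downward condition from \<open>B\<close> to \<open>A\<close>.
\<close>

definition perfect_matching ::
    "('v \<times> 'v) set \<Rightarrow> 'v set \<Rightarrow> 'v set \<Rightarrow> ('v \<times> 'v) set \<Rightarrow> bool" where
  "perfect_matching E A B M \<longleftrightarrow>
     card A = card B \<and>
     M \<subseteq> E \<inter> (A \<times> B \<union> B \<times> A) \<and>
     pairwise (\<lambda>e f. {fst e, snd e} \<inter> {fst f, snd f} = {}) M \<and>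
     Field M = A \<union> B"

definition layered_digraph :: "nat \<Rightarrow> (nat \<Rightarrow> 'v set) \<Rightarrow> ('v \<times> 'v) set \<Rightarrow> bool" where
  "layered_digraph h X E \<longleftrightarrow>
     disjoint_family_on X {..h} \<and> E \<subseteq> (\<Union>i\<le>h. X i) \<times> (\<Union>i\<le>h. X i)"

text \<open>
  In the downward condition the index \<open>i = h\<close> is left out: there is no layer \<open>h + 1\<close>, whereas the
  value of the function \<open>X\<close> at \<open>h + 1\<close> is arbitrary.
  For \<open>i = h\<close> the upward condition is trivial because \<open>E `` {v}\<close> is empty; in particular every
  layered digraph with \<open>h = 1\<close> whose edges all go from \<open>X 0\<close> to \<open>X 1\<close> is commutative.
\<close>

definition commutative_digraph :: "nat \<Rightarrow> (nat \<Rightarrow> 'v set) \<Rightarrow> ('v \<times> 'v) set \<Rightarrow> bool" where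
  "commutative_digraph h X E \<longleftrightarrow>
     layered_digraph h X E \<and>
     (\<forall>i\<le>h. \<forall>j\<le>h. j \<noteq> i + 1 \<longrightarrow> E \<inter> X i \<times> X j = {}) \<and>
     (\<forall>i\<in>{1..h}. \<forall>(u, v) \<in> E \<inter> X (i - 1) \<times> X i.
        \<exists>S \<subseteq> E `` {u}. \<exists>M. perfect_matching E S (E `` {v}) M) \<and>
     (\<forall>i\<in>{1..<h}. \<forall>(u, v) \<in> E \<inter> X i \<times> X (i + 1).
        \<exists>S \<subseteq> E\<inverse> `` {v}. \<exists>M. perfect_matching E S (E\<inverse> `` {u}) M)"

text \<open>The bipartite graphs between consecutive layers are chosen independently.\<close>

definition random_layered_digraph ::
    "rat \<Rightarrow> nat \<Rightarrow> nat \<Rightarrow> (nat \<Rightarrow> 'v set) \<Rightarrow> ('v \<times> 'v) set pmf" where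
  "random_layered_digraph k d h X =
     map_pmf (\<lambda>G. \<Union>i\<in>{1..h}. G i)
       (Pi_pmf {1..h} {} (\<lambda>i. pmf_of_set (biregular_digraphs k d (X (i - 1)) (X i))))"

text \<open>
  Since \<open>k\<close> is rational, the prescribed layer sizes force \<open>k ^ i * m\<close> to be an integer for
  every \<open>i \<le> h\<close>.
\<close>

definition admissible :: "rat \<Rightarrow> nat \<Rightarrow> nat \<Rightarrow> nat \<Rightarrow> (nat \<Rightarrow> 'v set) \<Rightarrow> bool" where
  "admissible k h m d X \<longleftrightarrow>
     d \<in> {2..m} \<and> k * rat_of_nat m \<in> \<int> \<and> k * rat_of_nat d \<in> \<int> \<and>
     disjoint_family_on X {..h} \<and>
     (\<forall>i\<le>h. finite (X i) \<and> rat_of_nat (card (X i)) = k ^ i * rat_of_nat m)"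

end

theory Submission
  imports Defs "HOL-Real_Asymp.Real_Asymp"
begin

text \<open>
  A biregular graph is a family of rows (out-neighbourhoods) of size \<open>D\<close> with column sums \<open>d\<close>. Given
  all other rows, two rows of a uniformly random such family arise by splitting their symmetric
  difference into two uniformly random halves. Hence averaging the weights of two rows can only increase
  the expectation of a product of terms \<open>w y ^ card (g y \<inter> U)\<close>, and the number of edges between sets \<open>S\<close>
  and \<open>U\<close> has generating function at most that of the independent model. This gives the usual bounds for
  its tails and for the probability that there is no edge.

  Dense case: by Hall's theorem, a missing matching between a neighbourhood \<open>A\<close> of the preceding layer and
  the row of \<open>v \<in> A\<close> yields \<open>S \<subseteq> A\<close> and a subset \<open>U\<close> of the row of \<open>v\<close> with \<open>card S + card U = D + 1\<close> and no
  edges in between; a union bound over \<open>S\<close>, \<open>U\<close> and all edges finishes the proof. The downward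
  condition is the upward one for the converse graph.

  Sparse case: the graph is not commutative as soon as two vertices \<open>v\<close>, \<open>x\<close> of layer \<open>h - 1\<close> with a common
  in-neighbour have no common out-neighbour. The next-to-last bipartite graph provides linearly many
  disjoint pairs with a common in-neighbour. Resplitting the row of each \<open>v\<close> with that of a spare vertex
  \<open>a\<close> makes these pairs conditionally independent, and with \<open>l = ln (k m)\<close> nearly all of them
  become disjoint with probability at least \<open>(2 / 5) powr l\<close>, which is much larger than \<open>1 / m\<close>.
\<close>

section \<open>Random halves\<close>

text \<open>The obstacle is that the column sums make the rows dependent, with \<open>d\<close>
  possibly as large as \<open>m\<close>. Resplitting two rows respects every degree and can be
  computed exactly. It favours equal weights for a simple reason: if two rows carry weights
  \<open>p\<close> and \<open>p'\<close>, elements of \<open>U\<close> lying in both rows enter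
  through \<open>p * p'\<close>, and those lying in one of them enter, in pairs, through
  \<open>p + p'\<close> or \<open>p * p'\<close>. Keeping the sum and raising the product therefore
  never lowers the expectation. Once all weights agree, the weighted product depends only on the
  total number of edges into \<open>U\<close>, which the column sums determine.

  The thresholds reflect two comparisons. In the dense case \<open>D * d / n\<close> is at least
  \<open>9 * ln M\<close> for a layer of size \<open>n\<close>, so a missing matching costs about
  \<open>exp (- D * d / (2 * n))\<close>, that is \<open>M powr (- 9 / 2)\<close>, against a factor
  of at most \<open>M ^ 4\<close> from the union bounds. In the sparse case two rows share at most
  \<open>l / 3\<close> elements on average, and \<open>5 / 2 < exp 1\<close> makes
  \<open>(2 / 5) powr l\<close> exceed \<open>1 / (k m)\<close> by a power of \<open>k m\<close>, so
  that linearly many trials suffice.\<close>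

definition halves :: "'a set \<Rightarrow> 'a set set" where
  "halves A = {R. R \<subseteq> A \<and> 2 * card R = card A}"

lemma finite_halves: "finite A \<Longrightarrow> finite (halves A)"
  unfolding halves_def by (rule finite_subset[of _ "Pow A"]) auto

text \<open>
  A uniformly random half of \<open>A\<close> is obtained by choosing a random partner \<open>y\<close> of a fixed element \<open>z\<close>,
  separating the two by a fair coin, and halving the rest at random.
\<close>

lemma sum_halves_pairing:
  fixes f :: "'a set \<Rightarrow> real"
  assumes fin: "finite A" and card: "card A = 2 * d" and z: "z \<in> A"
  shows "real d * (\<Sum>R\<in>halves A. f R) =
    (\<Sum>y\<in>A - {z}. \<Sum>R\<in>halves (A - {z, y}). f (insert z R) + f (insert y R))"
proof -
  have finH: "finite (halves A)"
    by (rule finite_halves[OF fin])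
  have split: "(\<Sum>R\<in>halves A. f R) =
      (\<Sum>R\<in>{R\<in>halves A. z \<in> R}. f R) + (\<Sum>R\<in>{R\<in>halves A. z \<notin> R}. f R)"
    by (subst sum.union_disjoint[symmetric]) (use finH in \<open>auto intro!: sum.cong\<close>)
  \<comment> \<open>A half containing \<open>z\<close> has \<open>d\<close> possible partners
    \<open>y\<close> outside it, which accounts for the factor; deleting \<open>z\<close> leaves a
    half of \<open>A - {z, y}\<close>.\<close>
  have in_part: "real d * (\<Sum>R\<in>{R\<in>halves A. z \<in> R}. f R) =
      (\<Sum>y\<in>A - {z}. \<Sum>R\<in>halves (A - {z, y}). f (insert z R))"
  proof -
    have "real d * (\<Sum>R\<in>{R\<in>halves A. z \<in> R}. f R) = (\<Sum>R\<in>{R\<in>halves A. z \<in> R}. \<Sum>y\<in>A - R. f R)"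
      unfolding sum_distrib_left
    proof (rule sum.cong[OF refl])
      fix R assume "R \<in> {R\<in>halves A. z \<in> R}"
      then have "R \<subseteq> A" "2 * card R = card A" by (auto simp: halves_def)
      then have "card (A - R) = d"
        using card fin by (simp add: card_Diff_subset finite_subset)
      then show "real d * f R = (\<Sum>y\<in>A - R. f R)" by simp
    qed
    also have "\<dots> = (\<Sum>R\<in>{R\<in>halves A. z \<in> R}. \<Sum>y\<in>{y \<in> A - {z}. y \<notin> R}. f R)"
      by (intro sum.cong) auto
    also have "\<dots> = (\<Sum>y\<in>A - {z}. \<Sum>R\<in>{R\<in>{R\<in>halves A. z \<in> R}. y \<notin> R}. f R)"
      by (rule sum.swap_restrict) (use fin finH in auto)
    also have "\<dots> = (\<Sum>y\<in>A - {z}. \<Sum>R\<in>halves (A - {z, y}). f (insert z R))"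
    proof (rule sum.cong[OF refl])
      fix y assume y: "y \<in> A - {z}"
      have c: "card (A - {z, y}) = card A - 2"
        using y z fin by (subst card_Diff_subset) auto
      have c2: "card A \<ge> 2"
        using y z fin card_mono[of A "{z,y}"] by auto
      show "(\<Sum>R\<in>{R\<in>{R\<in>halves A. z \<in> R}. y \<notin> R}. f R) = (\<Sum>R\<in>halves (A - {z, y}). f (insert z R))"
      proof (rule sum.reindex_bij_witness[of _ "insert z" "\<lambda>R. R - {z}"])
        fix R assume R: "R \<in> {R\<in>{R\<in>halves A. z \<in> R}. y \<notin> R}"
        then have "finite R" using fin by (auto simp: halves_def intro: finite_subset)
        then show "R - {z} \<in> halves (A - {z, y})"
          using R c by (auto simp: halves_def card_Diff_singleton)
        show "insert z (R - {z}) = R" using R by auto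
        show "f (insert z (R - {z})) = f R" using R by (auto simp: insert_absorb)
      next
        fix R assume R: "R \<in> halves (A - {z, y})"
        then have "finite R" "z \<notin> R" using fin by (auto simp: halves_def intro: finite_subset)
        then show "insert z R \<in> {R\<in>{R\<in>halves A. z \<in> R}. y \<notin> R}"
          using R c c2 y z by (auto simp: halves_def)
        show "insert z R - {z} = R" using \<open>z \<notin> R\<close> by auto
      qed
    qed
    finally show ?thesis .
  qed
  have out_part: "real d * (\<Sum>R\<in>{R\<in>halves A. z \<notin> R}. f R) =
      (\<Sum>y\<in>A - {z}. \<Sum>R\<in>halves (A - {z, y}). f (insert y R))"
  proof -
    have "real d * (\<Sum>R\<in>{R\<in>halves A. z \<notin> R}. f R) = (\<Sum>R\<in>{R\<in>halves A. z \<notin> R}. \<Sum>y\<in>R. f R)"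
      unfolding sum_distrib_left
      by (rule sum.cong[OF refl]) (use card in \<open>auto simp: halves_def\<close>)
    also have "\<dots> = (\<Sum>R\<in>{R\<in>halves A. z \<notin> R}. \<Sum>y\<in>{y \<in> A - {z}. y \<in> R}. f R)"
      by (intro sum.cong) (auto simp: halves_def)
    also have "\<dots> = (\<Sum>y\<in>A - {z}. \<Sum>R\<in>{R\<in>{R\<in>halves A. z \<notin> R}. y \<in> R}. f R)"
      by (rule sum.swap_restrict) (use fin finH in auto)
    also have "\<dots> = (\<Sum>y\<in>A - {z}. \<Sum>R\<in>halves (A - {z, y}). f (insert y R))"
    proof (rule sum.cong[OF refl])
      fix y assume y: "y \<in> A - {z}"
      have c: "card (A - {z, y}) = card A - 2"
        using y z fin by (subst card_Diff_subset) auto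
      have c2: "card A \<ge> 2"
        using y z fin card_mono[of A "{z,y}"] by auto
      show "(\<Sum>R\<in>{R\<in>{R\<in>halves A. z \<notin> R}. y \<in> R}. f R) = (\<Sum>R\<in>halves (A - {z, y}). f (insert y R))"
      proof (rule sum.reindex_bij_witness[of _ "insert y" "\<lambda>R. R - {y}"])
        fix R assume R: "R \<in> {R\<in>{R\<in>halves A. z \<notin> R}. y \<in> R}"
        then have "finite R" using fin by (auto simp: halves_def intro: finite_subset)
        then show "R - {y} \<in> halves (A - {z, y})"
          using R c by (auto simp: halves_def card_Diff_singleton)
        show "insert y (R - {y}) = R" using R by auto
        show "f (insert y (R - {y})) = f R" using R by (auto simp: insert_absorb)
      next
        fix R assume R: "R \<in> halves (A - {z, y})"
        then have "finite R" "y \<notin> R" using fin by (auto simp: halves_def intro: finite_subset)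
        then show "insert y R \<in> {R\<in>{R\<in>halves A. z \<notin> R}. y \<in> R}"
          using R c c2 y z by (auto simp: halves_def)
        show "insert y R - {y} = R" using \<open>y \<notin> R\<close> by auto
      qed
    qed
    finally show ?thesis .
  qed
  show ?thesis
    unfolding split distrib_left in_part out_part by (simp add: sum.distrib)
qed

text \<open>Iterating the pairing identity writes the sum as a nonnegative combination of products
  with one factor \<open>\<alpha> y * \<beta> z + \<alpha> z * \<beta> y\<close> per pair, so it is
  enough to compare these two-element factors.\<close>

lemma sum_halves_mono:
  fixes \<alpha> \<beta> \<alpha>' \<beta>' :: "'a \<Rightarrow> real"
  assumes "finite A"
    and "\<And>z. z \<in> A \<Longrightarrow> 0 \<le> \<alpha> z" and "\<And>z. z \<in> A \<Longrightarrow> 0 \<le> \<beta> z"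
    and "\<And>y z. y \<in> A \<Longrightarrow> z \<in> A \<Longrightarrow> y \<noteq> z \<Longrightarrow> \<alpha> y * \<beta> z + \<alpha> z * \<beta> y \<le> \<alpha>' y * \<beta>' z + \<alpha>' z * \<beta>' y"
  shows "(\<Sum>R\<in>halves A. prod \<alpha> R * prod \<beta> (A - R)) \<le> (\<Sum>R\<in>halves A. prod \<alpha>' R * prod \<beta>' (A - R))"
proof (cases "even (card A)")
  case False
  then have "halves A = {}" by (auto simp: halves_def) (metis dvd_triv_left)
  then show ?thesis by simp
next
  case True
  then obtain d where "card A = 2 * d" by auto
  then show ?thesis using assms
  proof (induction d arbitrary: A)
    case 0
    then have "A = {}" by simp
    then show ?case by (simp add: halves_def)
  next
    case (Suc d)
    then obtain z where z: "z \<in> A" by fastforce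
    define f where "f \<alpha> \<beta> R = prod \<alpha> R * prod \<beta> (A - R)" for \<alpha> \<beta> :: "'a \<Rightarrow> real" and R
    have expand: "f \<alpha> \<beta> (insert z R) + f \<alpha> \<beta> (insert y R) =
        (\<alpha> z * \<beta> y + \<alpha> y * \<beta> z) * (prod \<alpha> R * prod \<beta> (A - {z, y} - R))"
      if y: "y \<in> A - {z}" and R: "R \<in> halves (A - {z, y})" for y R and \<alpha> \<beta> :: "'a \<Rightarrow> real"
    proof -
      have fR: "finite R" "z \<notin> R" "y \<notin> R" "R \<subseteq> A"
        using R Suc.prems(2) by (auto simp: halves_def intro: finite_subset)
      have 1: "A - insert z R = insert y (A - {z, y} - R)" "A - insert y R = insert z (A - {z, y} - R)"
        using y z fR by auto
      have "finite (A - {z, y} - R)" using Suc.prems(2) by auto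
      then show ?thesis
        unfolding f_def 1 using fR y by (simp add: algebra_simps)
    qed
    have "real (Suc d) * (\<Sum>R\<in>halves A. f \<alpha> \<beta> R) =
        (\<Sum>y\<in>A - {z}. \<Sum>R\<in>halves (A - {z, y}). f \<alpha> \<beta> (insert z R) + f \<alpha> \<beta> (insert y R))"
      by (rule sum_halves_pairing) (use Suc.prems z in auto)
    also have "\<dots> = (\<Sum>y\<in>A - {z}. (\<alpha> z * \<beta> y + \<alpha> y * \<beta> z) *
        (\<Sum>R\<in>halves (A - {z, y}). prod \<alpha> R * prod \<beta> (A - {z, y} - R)))"
      unfolding sum_distrib_left by (intro sum.cong refl expand) auto
    also have "\<dots> \<le> (\<Sum>y\<in>A - {z}. (\<alpha>' z * \<beta>' y + \<alpha>' y * \<beta>' z) *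
        (\<Sum>R\<in>halves (A - {z, y}). prod \<alpha>' R * prod \<beta>' (A - {z, y} - R)))"
    proof (rule sum_mono)
      fix y assume y: "y \<in> A - {z}"
      have cross: "\<alpha> z * \<beta> y + \<alpha> y * \<beta> z \<le> \<alpha>' z * \<beta>' y + \<alpha>' y * \<beta>' z"
        using Suc.prems(5)[of z y] y z by auto
      have cross0: "0 \<le> \<alpha> z * \<beta> y + \<alpha> y * \<beta> z"
        using y z Suc.prems(3,4) by simp
      have "card (A - {z, y}) = 2 * d"
        using y z Suc.prems(1,2) by (subst card_Diff_subset) auto
      then have IH: "(\<Sum>R\<in>halves (A - {z, y}). prod \<alpha> R * prod \<beta> (A - {z, y} - R)) \<le>
          (\<Sum>R\<in>halves (A - {z, y}). prod \<alpha>' R * prod \<beta>' (A - {z, y} - R))"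
        by (rule Suc.IH) (use Suc.prems in auto)
      have "0 \<le> (\<Sum>R\<in>halves (A - {z, y}). prod \<alpha> R * prod \<beta> (A - {z, y} - R))"
        by (intro sum_nonneg mult_nonneg_nonneg prod_nonneg)
           (use Suc.prems(3,4) in \<open>auto simp: halves_def\<close>)
      then show "(\<alpha> z * \<beta> y + \<alpha> y * \<beta> z) *
          (\<Sum>R\<in>halves (A - {z, y}). prod \<alpha> R * prod \<beta> (A - {z, y} - R)) \<le>
        (\<alpha>' z * \<beta>' y + \<alpha>' y * \<beta>' z) *
          (\<Sum>R\<in>halves (A - {z, y}). prod \<alpha>' R * prod \<beta>' (A - {z, y} - R))"
        using cross cross0 IH by (intro mult_mono) auto
    qed
    also have "\<dots> = (\<Sum>y\<in>A - {z}. \<Sum>R\<in>halves (A - {z, y}). f \<alpha>' \<beta>' (insert z R) + f \<alpha>' \<beta>' (insert y R))"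
      unfolding sum_distrib_left by (intro sum.cong refl expand[symmetric]) auto
    also have "\<dots> = real (Suc d) * (\<Sum>R\<in>halves A. f \<alpha>' \<beta>' R)"
      by (rule sum_halves_pairing[symmetric]) (use Suc.prems z in auto)
    finally show ?case
      unfolding f_def by (simp add: mult_le_cancel_left)
  qed
qed

section \<open>Resplitting two rows\<close>

text \<open>Rows are extensional functions, undefined off \<open>Y\<close>, so that they correspond
  one to one to graphs. Both degrees are natural numbers, which makes the notion symmetric: the
  columns of such a graph form a member of \<open>biregular_rows Z Y d D\<close>.\<close>

definition biregular_rows :: "'a set \<Rightarrow> 'b set \<Rightarrow> nat \<Rightarrow> nat \<Rightarrow> ('a \<Rightarrow> 'b set) set" where
  "biregular_rows Y Z D d =
     {g \<in> Y \<rightarrow>\<^sub>E Pow Z. (\<forall>y\<in>Y. card (g y) = D) \<and> (\<forall>z\<in>Z. card {y\<in>Y. z \<in> g y} = d)}"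

lemma finite_biregular_rows: "finite Y \<Longrightarrow> finite Z \<Longrightarrow> finite (biregular_rows Y Z D d)"
  unfolding biregular_rows_def by (rule finite_subset[of _ "Y \<rightarrow>\<^sub>E Pow Z"]) (auto intro: finite_PiE)

lemma biregular_rowsD:
  assumes "g \<in> biregular_rows Y Z D d"
  shows "y \<in> Y \<Longrightarrow> g y \<subseteq> Z" and "y \<in> Y \<Longrightarrow> card (g y) = D"
    and "z \<in> Z \<Longrightarrow> card {y\<in>Y. z \<in> g y} = d"
  using assms by (auto simp: biregular_rows_def)

text \<open>The common part stays in both rows and each element of the symmetric difference goes to
  exactly one of them, so column sums survive for every \<open>R\<close> inside the symmetric
  difference; the row sizes survive exactly when \<open>R\<close> is a half of it.\<close>

definition resplit :: "('a \<Rightarrow> 'b set) \<Rightarrow> 'a \<Rightarrow> 'a \<Rightarrow> 'b set \<Rightarrow> 'a \<Rightarrow> 'b set" where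
  "resplit g x x' R = g(x := g x \<inter> g x' \<union> R, x' := g x \<inter> g x' \<union> (sym_diff (g x) (g x') - R))"

lemma column_card_split:
  assumes "finite Y" "x \<in> Y" "x' \<in> Y" "x \<noteq> x'"
  shows "card {y\<in>Y. z \<in> g y} =
    card {y\<in>Y - {x, x'}. z \<in> g y} + (of_bool (z \<in> g x) + of_bool (z \<in> g x'))"
proof -
  have "card {y\<in>Y. z \<in> g y} = (\<Sum>y\<in>Y. of_bool (z \<in> g y))"
    using assms(1) by (simp add: Int_def)
  also have "\<dots> = (\<Sum>y\<in>Y - {x, x'}. of_bool (z \<in> g y)) + (\<Sum>y\<in>{x, x'}. of_bool (z \<in> g y))"
    using assms by (subst sum.subset_diff[of "{x, x'}"]) auto
  also have "(\<Sum>y\<in>Y - {x, x'}. of_bool (z \<in> g y)) = card {y\<in>Y - {x, x'}. z \<in> g y}"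
    using assms(1) by (simp add: Int_def)
  finally show ?thesis using assms by simp
qed

lemma card_sym_diff_rows:
  assumes "finite A" "finite B" "card A = card B"
  shows "card (sym_diff A B) = 2 * card (A - B)" "card (B - A) = card (A - B)"
proof -
  have "card A = card (A \<inter> B) + card (A - B)" "card B = card (A \<inter> B) + card (B - A)"
    using assms by (metis Int_Diff_Un Int_Diff_disjoint card_Un_disjoint finite_Diff finite_Int,
      metis Int_Diff_Un Int_Diff_disjoint Int_commute card_Un_disjoint finite_Diff finite_Int)
  then show "card (B - A) = card (A - B)" using assms by simp
  then show "card (sym_diff A B) = 2 * card (A - B)"
    using assms by (subst card_Un_disjoint) auto
qed

text \<open>With all other rows fixed, each column sum determines whether the column meets both, one
  or none of the rows \<open>x\<close> and \<open>x'\<close>. Hence the common part and the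
  symmetric difference are determined, and equal row sizes force the private part of row
  \<open>x\<close> to be a half of the latter.\<close>

lemma biregular_rows_fibre:
  assumes fin: "finite Y" "finite Z" and x: "x \<in> Y" "x' \<in> Y" "x \<noteq> x'"
    and g: "g \<in> biregular_rows Y Z D d"
  shows "{g' \<in> biregular_rows Y Z D d. g'(x := {}, x' := {}) = g(x := {}, x' := {})} =
    resplit g x x' ` halves (sym_diff (g x) (g x'))"
proof (intro equalityI subsetI)
  fix g' assume "g' \<in> {g' \<in> biregular_rows Y Z D d. g'(x := {}, x' := {}) = g(x := {}, x' := {})}"
  then have g': "g' \<in> biregular_rows Y Z D d" and eq: "g'(x := {}, x' := {}) = g(x := {}, x' := {})"
    by auto
  have off: "g' y = g y" if "y \<noteq> x" "y \<noteq> x'" for y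
    using fun_cong[OF eq, of y] that by auto
  have sub: "g x \<subseteq> Z" "g x' \<subseteq> Z" "g' x \<subseteq> Z" "g' x' \<subseteq> Z"
    using biregular_rowsD(1)[OF g] biregular_rowsD(1)[OF g'] x by auto
  have finr: "finite (g x)" "finite (g x')" "finite (g' x)" "finite (g' x')"
    using sub fin(2) finite_subset by blast+
  have cols: "(z \<in> g' x \<and> z \<in> g' x' \<longleftrightarrow> z \<in> g x \<and> z \<in> g x') \<and>
      (z \<in> g' x \<or> z \<in> g' x' \<longleftrightarrow> z \<in> g x \<or> z \<in> g x')" for z
  proof (cases "z \<in> Z")
    case True
    have "{y\<in>Y - {x, x'}. z \<in> g' y} = {y\<in>Y - {x, x'}. z \<in> g y}"
      using off by auto
    then have "of_bool (z \<in> g' x) + of_bool (z \<in> g' x') = (of_bool (z \<in> g x) + of_bool (z \<in> g x') :: nat)"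
      using biregular_rowsD(3)[OF g True] biregular_rowsD(3)[OF g' True]
        column_card_split[OF fin(1) x, of z g] column_card_split[OF fin(1) x, of z g'] by simp
    then show ?thesis by (auto simp: of_bool_def split: if_splits)
  next
    case False
    then show ?thesis using sub by auto
  qed
  have C: "g' x \<inter> g' x' = g x \<inter> g x'" and S: "sym_diff (g' x) (g' x') = sym_diff (g x) (g x')"
    using cols by blast+
  have "g' x - g' x' \<in> halves (sym_diff (g' x) (g' x'))"
    unfolding halves_def using card_sym_diff_rows(1)[OF finr(3,4)] biregular_rowsD(2)[OF g'] x by auto
  moreover have "resplit g x x' (g' x - g' x') = g'"
  proof
    fix y show "resplit g x x' (g' x - g' x') y = g' y"
      unfolding resplit_def S[symmetric] C[symmetric] using off x by auto
  qed
  ultimately show "g' \<in> resplit g x x' ` halves (sym_diff (g x) (g x'))"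
    unfolding S by (metis imageI)
next
  fix g' assume "g' \<in> resplit g x x' ` halves (sym_diff (g x) (g x'))"
  then obtain R where R: "R \<in> halves (sym_diff (g x) (g x'))" and g': "g' = resplit g x x' R" by auto
  have sub: "g x \<subseteq> Z" "g x' \<subseteq> Z" "R \<subseteq> sym_diff (g x) (g x')"
    using biregular_rowsD(1)[OF g] x R by (auto simp: halves_def)
  have finr: "finite (g x)" "finite (g x')" "finite R"
    using sub fin(2) finite_subset by (blast, blast, meson fin(2) finite_Diff finite_UnI finite_subset)
  have cD: "card (g x) = D" "card (g x') = D"
    using biregular_rowsD(2)[OF g] x by auto
  have cR: "card R = card (g x - g x')" "card (sym_diff (g x) (g x') - R) = card (g x - g x')"
    using R card_sym_diff_rows(1)[OF finr(1,2)] cD sub(3) finr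
    by (auto simp: halves_def card_Diff_subset)
  have cA: "card (g x) = card (g x \<inter> g x') + card (g x - g x')"
    using finr by (metis Int_Diff_Un Int_Diff_disjoint card_Un_disjoint finite_Diff finite_Int)
  have row: "card (g' x) = D" "card (g' x') = D"
  proof -
    have "card (g x \<inter> g x' \<union> R) = card (g x \<inter> g x') + card R"
      by (rule card_Un_disjoint) (use finr sub in auto)
    then show "card (g' x) = D" using cR cA cD x by (simp add: g' resplit_def)
    have "card (g x \<inter> g x' \<union> (sym_diff (g x) (g x') - R)) =
        card (g x \<inter> g x') + card (sym_diff (g x) (g x') - R)"
      by (rule card_Un_disjoint) (use finr sub in auto)
    then show "card (g' x') = D" using cR cA cD x by (simp add: g' resplit_def)
  qed
  have off: "g' y = g y" if "y \<noteq> x" "y \<noteq> x'" for y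
    using that by (simp add: g' resplit_def)
  have col: "card {y\<in>Y. z \<in> g' y} = d" if z: "z \<in> Z" for z
  proof -
    have "{y\<in>Y - {x, x'}. z \<in> g' y} = {y\<in>Y - {x, x'}. z \<in> g y}"
      using off by auto
    moreover have "of_bool (z \<in> g' x) + of_bool (z \<in> g' x') = (of_bool (z \<in> g x) + of_bool (z \<in> g x') :: nat)"
      using sub x by (auto simp: g' resplit_def of_bool_def)
    ultimately show ?thesis
      using biregular_rowsD(3)[OF g z] column_card_split[OF fin(1) x, of z g]
        column_card_split[OF fin(1) x, of z g'] by simp
  qed
  have "g' y \<subseteq> Z" if "y \<in> Y" for y
    using sub biregular_rowsD(1)[OF g that] by (auto simp: g' resplit_def)
  moreover have "g' y = undefined" if "y \<notin> Y" for y
    using g off[of y] that x by (auto simp: biregular_rows_def PiE_def extensional_def)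
  moreover have "card (g' y) = D" if "y \<in> Y" for y
    using row off biregular_rowsD(2)[OF g that] by metis
  ultimately have "g' \<in> biregular_rows Y Z D d"
    using col by (auto simp: biregular_rows_def PiE_def extensional_def)
  then show "g' \<in> {g' \<in> biregular_rows Y Z D d. g'(x := {}, x' := {}) = g(x := {}, x' := {})}"
    using x by (auto simp: g' resplit_def fun_eq_iff)
qed

lemma inj_on_resplit:
  assumes "x \<noteq> x'"
  shows "inj_on (resplit g x x') (halves (sym_diff (g x) (g x')))"
proof (rule inj_onI)
  fix R R' assume R: "R \<in> halves (sym_diff (g x) (g x'))" "R' \<in> halves (sym_diff (g x) (g x'))"
    and eq: "resplit g x x' R = resplit g x x' R'"
  have "g x \<inter> g x' \<union> R = g x \<inter> g x' \<union> R'"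
    using fun_cong[OF eq, of x] assms by (simp add: resplit_def)
  then show "R = R'" using R by (auto simp: halves_def)
qed

text \<open>
  Given all other rows, the two rows \<open>x\<close> and \<open>x'\<close> of a uniformly random biregular graph arise from
  their common part by distributing the symmetric difference evenly and uniformly at random.
\<close>

lemma sum_resplit_mono:
  fixes f f' :: "('a \<Rightarrow> 'b set) \<Rightarrow> real"
  assumes fin: "finite Y" "finite Z" and x: "x \<in> Y" "x' \<in> Y" "x \<noteq> x'"
    and le: "\<And>g. g \<in> biregular_rows Y Z D d \<Longrightarrow>
      (\<Sum>R\<in>halves (sym_diff (g x) (g x')). f (resplit g x x' R)) \<le>
      (\<Sum>R\<in>halves (sym_diff (g x) (g x')). f' (resplit g x x' R))"
  shows "sum f (biregular_rows Y Z D d) \<le> sum f' (biregular_rows Y Z D d)"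
proof -
  let ?B = "biregular_rows Y Z D d"
  let ?k = "\<lambda>g. g(x := {}, x' := {})"
  have finB: "finite ?B" by (rule finite_biregular_rows[OF fin])
  have "sum f ?B = (\<Sum>u\<in>?k ` ?B. sum f {g\<in>?B. ?k g = u})"
    by (rule sum.group[symmetric]) (use finB in auto)
  also have "\<dots> \<le> (\<Sum>u\<in>?k ` ?B. sum f' {g\<in>?B. ?k g = u})"
  proof (rule sum_mono)
    fix u assume "u \<in> ?k ` ?B"
    then obtain g where g: "g \<in> ?B" "u = ?k g" by auto
    show "sum f {g\<in>?B. ?k g = u} \<le> sum f' {g\<in>?B. ?k g = u}"
      unfolding g(2) biregular_rows_fibre[OF fin x g(1)]
      using le[OF g(1)] by (simp add: sum.reindex[OF inj_on_resplit[OF x(3)]])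
  qed
  also have "\<dots> = sum f' ?B"
    by (rule sum.group) (use finB in auto)
  finally show ?thesis .
qed

section \<open>Smoothing the row weights\<close>

lemma prod_if_const:
  fixes c :: real
  assumes "finite R"
  shows "(\<Prod>z\<in>R. if z \<in> U then c else 1) = c ^ card (R \<inter> U)"
  using assms by (simp add: prod.inter_restrict[symmetric])

text \<open>The rows in \<open>Y0\<close> stay random, the others are prescribed by \<rho>. Freezing
  a row turns it into a fixed target set, so that its intersections with random rows become edge
  counts into a set.\<close>

definition frozen_rows ::
    "'a set \<Rightarrow> 'b set \<Rightarrow> nat \<Rightarrow> nat \<Rightarrow> 'a set \<Rightarrow> ('a \<Rightarrow> 'b set) \<Rightarrow> ('a \<Rightarrow> 'b set) set" where
  "frozen_rows Y Z D d Y0 \<rho> = {g \<in> biregular_rows Y Z D d. \<forall>y\<in>Y - Y0. g y = \<rho> y}"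

text \<open>For two elements of the symmetric difference the factor in
  \<open>sum_halves_mono\<close> is \<open>2 * w x * w x'\<close>, \<open>w x + w x'\<close> or
  \<open>2\<close>, depending on how many of them lie in \<open>U\<close>, and a common element in
  \<open>U\<close> contributes \<open>w x * w x'\<close>. Each of these is kept or raised when the
  sum is preserved and the product does not decrease.\<close>

lemma sum_smooth_two_rows:
  fixes w :: "'a \<Rightarrow> real"
  assumes fin: "finite Y" "finite Z" and Y0: "Y0 \<subseteq> Y" and x: "x \<in> Y0" "x' \<in> Y0" "x \<noteq> x'"
    and w: "\<And>y. y \<in> Y0 \<Longrightarrow> 0 \<le> w y"
    and p: "p + p' = w x + w x'" "w x * w x' \<le> p * p'"
  shows "(\<Sum>g\<in>frozen_rows Y Z D d Y0 \<rho>. \<Prod>y\<in>Y0. w y ^ card (g y \<inter> U)) \<le>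
    (\<Sum>g\<in>frozen_rows Y Z D d Y0 \<rho>. \<Prod>y\<in>Y0. (w(x := p, x' := p')) y ^ card (g y \<inter> U))"
proof -
  \<comment> \<open>The freezing condition is kept as an indicator because resplitting is formulated
    over the whole family; it does not see a change of two rows in \<open>Y0\<close>.\<close>
  define F where "F w g = (if \<forall>y\<in>Y - Y0. g y = \<rho> y then \<Prod>y\<in>Y0. w y ^ card (g y \<inter> U) else 0)"
    for w :: "'a \<Rightarrow> real" and g
  have finB: "finite (biregular_rows Y Z D d)" by (rule finite_biregular_rows[OF fin])
  have finY0: "finite Y0" using Y0 fin finite_subset by blast
  have F: "(\<Sum>g\<in>frozen_rows Y Z D d Y0 \<rho>. \<Prod>y\<in>Y0. w y ^ card (g y \<inter> U)) = sum (F w) (biregular_rows Y Z D d)"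
    for w :: "'a \<Rightarrow> real"
    unfolding frozen_rows_def F_def using finB by (rule sum.inter_filter)
  have "sum (F w) (biregular_rows Y Z D d) \<le> sum (F (w(x := p, x' := p'))) (biregular_rows Y Z D d)"
  proof (rule sum_resplit_mono[OF fin])
    show "x \<in> Y" "x' \<in> Y" "x \<noteq> x'" using x Y0 by auto
    fix g assume g: "g \<in> biregular_rows Y Z D d"
    let ?S = "sym_diff (g x) (g x')" and ?C = "g x \<inter> g x'"
    define K where "K = (if \<forall>y\<in>Y - Y0. g y = \<rho> y then \<Prod>y\<in>Y0 - {x, x'}. w y ^ card (g y \<inter> U) else 0)"
    have K0: "0 \<le> K"
      unfolding K_def using w by (auto intro!: prod_nonneg)
    have sub: "g x \<subseteq> Z" "g x' \<subseteq> Z"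
      using biregular_rowsD(1)[OF g] x Y0 by auto
    then have finr: "finite (g x)" "finite (g x')"
      using fin(2) finite_subset by blast+
    have eval: "F v (resplit g x x' R) = K * (v x * v x') ^ card (?C \<inter> U) *
        ((\<Prod>z\<in>R. if z \<in> U then v x else 1) * (\<Prod>z\<in>?S - R. if z \<in> U then v x' else 1))"
      if R: "R \<in> halves ?S" and v: "\<And>y. y \<noteq> x \<Longrightarrow> y \<noteq> x' \<Longrightarrow> v y = w y"
      for R and v :: "'a \<Rightarrow> real"
    proof -
      have Rsub: "R \<subseteq> ?S" using R by (simp add: halves_def)
      then have finR: "finite R" using finr by (meson finite_Diff finite_UnI finite_subset)
      have cond: "(\<forall>y\<in>Y - Y0. resplit g x x' R y = \<rho> y) \<longleftrightarrow> (\<forall>y\<in>Y - Y0. g y = \<rho> y)"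
        using x by (auto simp: resplit_def)
      have "(\<Prod>y\<in>Y0. v y ^ card (resplit g x x' R y \<inter> U)) =
          (\<Prod>y\<in>Y0 - {x, x'}. v y ^ card (resplit g x x' R y \<inter> U)) *
          (\<Prod>y\<in>{x, x'}. v y ^ card (resplit g x x' R y \<inter> U))"
        by (rule prod.subset_diff) (use x finY0 in auto)
      also have "(\<Prod>y\<in>Y0 - {x, x'}. v y ^ card (resplit g x x' R y \<inter> U)) =
          (\<Prod>y\<in>Y0 - {x, x'}. w y ^ card (g y \<inter> U))"
        by (rule prod.cong) (use v in \<open>auto simp: resplit_def\<close>)
      also have "(\<Prod>y\<in>{x, x'}. v y ^ card (resplit g x x' R y \<inter> U)) =
          v x ^ card ((?C \<union> R) \<inter> U) * v x' ^ card ((?C \<union> (?S - R)) \<inter> U)"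
        using x by (simp add: resplit_def)
      also have "card ((?C \<union> R) \<inter> U) = card (?C \<inter> U) + card (R \<inter> U)"
        unfolding Int_Un_distrib2 by (rule card_Un_disjoint) (use finr finR Rsub in auto)
      also have "card ((?C \<union> (?S - R)) \<inter> U) = card (?C \<inter> U) + card ((?S - R) \<inter> U)"
        unfolding Int_Un_distrib2 by (rule card_Un_disjoint) (use finr finR Rsub in auto)
      finally show ?thesis
        unfolding F_def cond K_def using finr finR
        by (simp add: prod_if_const power_add power_mult_distrib)
    qed
    have main: "(\<Sum>R\<in>halves ?S. (\<Prod>z\<in>R. if z \<in> U then w x else 1) * (\<Prod>z\<in>?S - R. if z \<in> U then w x' else 1))
      \<le> (\<Sum>R\<in>halves ?S. (\<Prod>z\<in>R. if z \<in> U then p else 1) * (\<Prod>z\<in>?S - R. if z \<in> U then p' else 1))"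
    proof (rule sum_halves_mono)
      fix y z
      show "(if y \<in> U then w x else 1) * (if z \<in> U then w x' else 1) +
          (if z \<in> U then w x else 1) * (if y \<in> U then w x' else 1) \<le>
        (if y \<in> U then p else 1) * (if z \<in> U then p' else 1) +
          (if z \<in> U then p else 1) * (if y \<in> U then p' else 1)"
        using p by (simp split: if_split)
    qed (use finr w[OF x(1)] w[OF x(2)] in auto)
    have main0: "0 \<le> (\<Sum>R\<in>halves ?S. (\<Prod>z\<in>R. if z \<in> U then w x else 1) * (\<Prod>z\<in>?S - R. if z \<in> U then w x' else 1))"
      using w x by (intro sum_nonneg mult_nonneg_nonneg prod_nonneg) auto
    have "(\<Sum>R\<in>halves ?S. F w (resplit g x x' R)) = K * (w x * w x') ^ card (?C \<inter> U) *
        (\<Sum>R\<in>halves ?S. (\<Prod>z\<in>R. if z \<in> U then w x else 1) * (\<Prod>z\<in>?S - R. if z \<in> U then w x' else 1))"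
      unfolding sum_distrib_left by (intro sum.cong refl eval) auto
    also have "\<dots> \<le> K * (p * p') ^ card (?C \<inter> U) *
        (\<Sum>R\<in>halves ?S. (\<Prod>z\<in>R. if z \<in> U then p else 1) * (\<Prod>z\<in>?S - R. if z \<in> U then p' else 1))"
    proof (rule mult_mono[OF mult_left_mono[OF _ K0] main _ main0])
      have "0 \<le> w x * w x'" using w x by simp
      then show "(w x * w x') ^ card (?C \<inter> U) \<le> (p * p') ^ card (?C \<inter> U)"
        using p(2) by (rule power_mono[rotated])
      show "0 \<le> K * (p * p') ^ card (?C \<inter> U)"
        using K0 \<open>0 \<le> w x * w x'\<close> p(2) by simp
    qed
    also have "\<dots> = (\<Sum>R\<in>halves ?S. F (w(x := p, x' := p')) (resplit g x x' R))"
      unfolding sum_distrib_left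
    proof (rule sum.cong[OF refl])
      have upd: "(w(x := p, x' := p')) x = p" "(w(x := p, x' := p')) x' = p'" using x(3) by auto
      fix R assume "R \<in> halves ?S"
      then have "F (w(x := p, x' := p')) (resplit g x x' R) =
          K * ((w(x := p, x' := p')) x * (w(x := p, x' := p')) x') ^ card (?C \<inter> U) *
          ((\<Prod>z\<in>R. if z \<in> U then (w(x := p, x' := p')) x else 1) *
           (\<Prod>z\<in>?S - R. if z \<in> U then (w(x := p, x' := p')) x' else 1))"
        by (rule eval) simp
      then show "K * (p * p') ^ card (?C \<inter> U) *
          ((\<Prod>z\<in>R. if z \<in> U then p else 1) * (\<Prod>z\<in>?S - R. if z \<in> U then p' else 1)) =
          F (w(x := p, x' := p')) (resplit g x x' R)"
        unfolding upd by (rule sym)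
    qed
    finally show "(\<Sum>R\<in>halves ?S. F w (resplit g x x' R)) \<le>
      (\<Sum>R\<in>halves ?S. F (w(x := p, x' := p')) (resplit g x x' R))" .
  qed
  then show ?thesis unfolding F .
qed

text \<open>
  Smoothing, as in the proof of the inequality of arithmetic and geometric means: one row weight after
  the other is moved to the mean.
\<close>

lemma sum_rows_le_mean:
  fixes w :: "'a \<Rightarrow> real" and A :: real
  assumes fin: "finite Y" "finite Z" and Y0: "Y0 \<subseteq> Y"
    and w: "\<And>y. y \<in> Y0 \<Longrightarrow> 0 \<le> w y" and A: "sum w Y0 = A * real (card Y0)"
  shows "(\<Sum>g\<in>frozen_rows Y Z D d Y0 \<rho>. \<Prod>y\<in>Y0. w y ^ card (g y \<inter> U)) \<le>
    (\<Sum>g\<in>frozen_rows Y Z D d Y0 \<rho>. A ^ (\<Sum>y\<in>Y0. card (g y \<inter> U)))"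
  using w A
proof (induction "card {y\<in>Y0. w y \<noteq> A}" arbitrary: w rule: less_induct)
  case less
  have finY0: "finite Y0" using Y0 fin finite_subset by blast
  show ?case
  proof (cases "\<forall>y\<in>Y0. w y = A")
    case True
    have "(\<Prod>y\<in>Y0. w y ^ card (g y \<inter> U)) = A ^ (\<Sum>y\<in>Y0. card (g y \<inter> U))" for g :: "'a \<Rightarrow> 'b set"
      unfolding power_sum by (rule prod.cong) (use True in auto)
    then show ?thesis by simp
  next
    case False
    then obtain y0 where y0: "y0 \<in> Y0" "w y0 \<noteq> A" by auto
    have tot: "(\<Sum>y\<in>Y0. w y - A) = 0"
      by (simp add: sum_subtractf less.prems(2))
    have "\<exists>x\<in>Y0. w x < A"
    proof (rule ccontr)
      assume "\<not> (\<exists>x\<in>Y0. w x < A)"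
      then have "\<And>y. y \<in> Y0 \<Longrightarrow> 0 \<le> w y - A" by (auto simp: not_less)
      with tot have "\<forall>y\<in>Y0. w y - A = 0" by (subst (asm) sum_nonneg_eq_0_iff[OF finY0]) auto
      then show False using y0 by simp
    qed
    then obtain x where x: "x \<in> Y0" "w x < A" by blast
    have "\<exists>x\<in>Y0. A < w x"
    proof (rule ccontr)
      assume "\<not> (\<exists>x\<in>Y0. A < w x)"
      then have "\<And>y. y \<in> Y0 \<Longrightarrow> 0 \<le> A - w y" by (auto simp: not_less)
      moreover have "(\<Sum>y\<in>Y0. A - w y) = 0" using tot by (simp add: sum_subtractf)
      ultimately have "\<forall>y\<in>Y0. A - w y = 0" by (subst (asm) sum_nonneg_eq_0_iff[OF finY0]) auto
      then show False using y0 by simp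
    qed
    then obtain x' where x': "x' \<in> Y0" "A < w x'" by blast
    define w' where "w' = w(x := A, x' := w x + w x' - A)"
    have "x \<noteq> x'" using x x' by auto
    have "(\<Sum>g\<in>frozen_rows Y Z D d Y0 \<rho>. \<Prod>y\<in>Y0. w y ^ card (g y \<inter> U)) \<le>
      (\<Sum>g\<in>frozen_rows Y Z D d Y0 \<rho>. \<Prod>y\<in>Y0. w' y ^ card (g y \<inter> U))"
      unfolding w'_def
    proof (rule sum_smooth_two_rows[OF fin Y0 x(1) x'(1) \<open>x \<noteq> x'\<close>])
      \<comment> \<open>The mean lies between the two weights, and this product is exactly the gain
        in the product of the weights.\<close>
      have "0 \<le> (A - w x) * (w x' - A)" using x x' by simp
      then show "w x * w x' \<le> A * (w x + w x' - A)" by (simp add: algebra_simps)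
    qed (use less.prems in auto)
    also have "\<dots> \<le> (\<Sum>g\<in>frozen_rows Y Z D d Y0 \<rho>. A ^ (\<Sum>y\<in>Y0. card (g y \<inter> U)))"
    proof (rule less.hyps)
      have "{y\<in>Y0. w' y \<noteq> A} \<subseteq> {y\<in>Y0. w y \<noteq> A}"
      proof
        fix y assume "y \<in> {y\<in>Y0. w' y \<noteq> A}"
        then show "y \<in> {y\<in>Y0. w y \<noteq> A}"
          using x x' by (cases "y = x'") (auto simp: w'_def split: if_splits)
      qed
      moreover have "x \<in> {y\<in>Y0. w y \<noteq> A}" "x \<notin> {y\<in>Y0. w' y \<noteq> A}"
        using x \<open>x \<noteq> x'\<close> by (simp_all add: w'_def)
      ultimately have "{y\<in>Y0. w' y \<noteq> A} \<subset> {y\<in>Y0. w y \<noteq> A}" by blast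
      then show "card {y\<in>Y0. w' y \<noteq> A} < card {y\<in>Y0. w y \<noteq> A}"
        by (rule psubset_card_mono[rotated]) (use finY0 in auto)
      show "0 \<le> w' y" if "y \<in> Y0" for y
        using less.prems(1)[OF that] less.prems(1)[OF x(1)] x x' unfolding w'_def fun_upd_def
        by (cases "y = x'"; cases "y = x") simp_all
      have "sum w' Y0 = sum w' (Y0 - {x, x'}) + sum w' {x, x'}"
        by (rule sum.subset_diff) (use x x' finY0 in auto)
      also have "sum w' (Y0 - {x, x'}) = sum w (Y0 - {x, x'})"
        by (rule sum.cong) (auto simp: w'_def)
      also have "sum w' {x, x'} = sum w {x, x'}"
        using \<open>x \<noteq> x'\<close> by (simp add: w'_def)
      also have "sum w (Y0 - {x, x'}) + sum w {x, x'} = sum w Y0"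
        by (rule sum.subset_diff[symmetric]) (use x x' finY0 in auto)
      finally show "sum w' Y0 = A * real (card Y0)" using less.prems(2) by simp
    qed
    finally show ?thesis .
  qed
qed

section \<open>Tail and avoidance bounds for the edges between two vertex sets\<close>

lemma finite_frozen_rows: "finite Y \<Longrightarrow> finite Z \<Longrightarrow> finite (frozen_rows Y Z D d Y0 \<rho>)"
  unfolding frozen_rows_def by (simp add: finite_biregular_rows)

lemma frozen_rows_total:
  assumes fin: "finite Y" "finite Z" and Y0: "Y0 \<subseteq> Y" and U: "U \<subseteq> Z"
    and g: "g \<in> frozen_rows Y Z D d Y0 \<rho>"
  shows "(\<Sum>y\<in>Y0. card (g y \<inter> U)) = (\<Sum>z\<in>U. d - card {y\<in>Y - Y0. z \<in> \<rho> y})"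
proof -
  have finY0: "finite Y0" and finU: "finite U" using Y0 U fin finite_subset by blast+
  have "(\<Sum>y\<in>Y0. card (g y \<inter> U)) = (\<Sum>y\<in>Y0. \<Sum>z\<in>U. of_bool (z \<in> g y))"
    using finU by (simp add: Int_def conj_commute)
  also have "\<dots> = (\<Sum>z\<in>U. \<Sum>y\<in>Y0. of_bool (z \<in> g y))"
    by (rule sum.swap)
  also have "\<dots> = (\<Sum>z\<in>U. d - card {y\<in>Y - Y0. z \<in> \<rho> y})"
  proof (rule sum.cong[OF refl])
    fix z assume "z \<in> U"
    then have "d = card {y\<in>Y. z \<in> g y}"
      using g U biregular_rowsD(3)[of g Y Z D d z] by (auto simp: frozen_rows_def)
    also have "{y\<in>Y. z \<in> g y} = {y\<in>Y0. z \<in> g y} \<union> {y\<in>Y - Y0. z \<in> \<rho> y}"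
      using g Y0 by (auto simp: frozen_rows_def)
    also have "card \<dots> = card {y\<in>Y0. z \<in> g y} + card {y\<in>Y - Y0. z \<in> \<rho> y}"
      by (rule card_Un_disjoint) (use fin finY0 in auto)
    finally show "(\<Sum>y\<in>Y0. of_bool (z \<in> g y)) = d - card {y\<in>Y - Y0. z \<in> \<rho> y}"
      using finY0 by (simp add: Int_def)
  qed
  finally show ?thesis .
qed

text \<open>Weight \<open>0\<close> on \<open>S\<close> and \<open>1\<close> elsewhere makes the
  product, with \<open>0 ^ 0 = 1\<close>, the indicator of having no edge from \<open>S\<close> to
  \<open>U\<close>. The mean weight is \<open>1 - card S / card Y0\<close>, and
  \<open>1 - t \<le> exp (- t)\<close> gives the exponential.\<close>

lemma card_frozen_avoid_le:
  fixes Y :: "'a set" and Z :: "'b set" and d :: nat and \<rho> :: "'a \<Rightarrow> 'b set"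
  assumes fin: "finite Y" "finite Z" and Y0: "Y0 \<subseteq> Y" "Y0 \<noteq> {}" and U: "U \<subseteq> Z" and S: "S \<subseteq> Y0"
  defines "L \<equiv> \<Sum>z\<in>U. d - card {y\<in>Y - Y0. z \<in> \<rho> y}"
  shows "card {g\<in>frozen_rows Y Z D d Y0 \<rho>. \<forall>y\<in>S. g y \<inter> U = {}} \<le>
    exp (- (real (card S) * real L / real (card Y0))) * card (frozen_rows Y Z D d Y0 \<rho>)"
proof -
  let ?B = "frozen_rows Y Z D d Y0 \<rho>"
  have finY0: "finite Y0" and finU: "finite U" using Y0 U fin finite_subset by blast+
  have finS: "finite S" using S finY0 finite_subset by blast
  have finB: "finite ?B" by (rule finite_frozen_rows[OF fin])
  have c0: "card Y0 > 0" using Y0 finY0 by (simp add: card_gt_0_iff)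
  have cS: "card S \<le> card Y0" using S finY0 by (simp add: card_mono)
  define w where "w y = (if y \<in> S then 0 else 1 :: real)" for y
  define A where "A = 1 - real (card S) / real (card Y0)"
  have "sum w Y0 = real (card Y0) - real (card S)"
  proof -
    have "sum w Y0 = (\<Sum>y\<in>Y0. 1 - of_bool (y \<in> S))" by (auto simp: w_def intro!: sum.cong)
    also have "\<dots> = real (card Y0) - real (card S)"
      using S finY0 by (simp add: sum_subtractf Int_absorb1)
    finally show ?thesis .
  qed
  then have A: "sum w Y0 = A * card Y0"
    using c0 by (simp add: A_def ring_distribs)
  have A0: "0 \<le> A" using cS c0 by (simp add: A_def)
  have "real (card {g\<in>?B. \<forall>y\<in>S. g y \<inter> U = {}}) = (\<Sum>g\<in>?B. of_bool (\<forall>y\<in>S. g y \<inter> U = {}))"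
    using finB by (simp add: Int_def)
  also have "\<dots> \<le> (\<Sum>g\<in>?B. \<Prod>y\<in>Y0. w y ^ card (g y \<inter> U))"
  proof (rule sum_mono)
    fix g
    have "(\<Prod>y\<in>Y0. w y ^ card (g y \<inter> U)) = 1" if "\<forall>y\<in>S. g y \<inter> U = {}"
      using that by (intro prod.neutral) (auto simp: w_def)
    moreover have "0 \<le> (\<Prod>y\<in>Y0. w y ^ card (g y \<inter> U))"
      by (intro prod_nonneg) (auto simp: w_def)
    ultimately show "of_bool (\<forall>y\<in>S. g y \<inter> U = {}) \<le> (\<Prod>y\<in>Y0. w y ^ card (g y \<inter> U))"
      by (auto simp: of_bool_def)
  qed
  also have "\<dots> \<le> (\<Sum>g\<in>?B. A ^ (\<Sum>y\<in>Y0. card (g y \<inter> U)))"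
    by (rule sum_rows_le_mean[OF fin Y0(1) _ A]) (simp add: w_def)
  also have "\<dots> = (\<Sum>g\<in>?B. A ^ L)"
    using frozen_rows_total[OF fin Y0(1) U] by (intro sum.cong) (auto simp: L_def)
  also have "\<dots> = A ^ L * card ?B" by simp
  also have "A ^ L \<le> exp (- (real (card S) / real (card Y0))) ^ L"
    using A0 exp_ge_add_one_self[of "- (real (card S) / real (card Y0))"]
    by (intro power_mono) (auto simp: A_def)
  also have "exp (- (real (card S) / real (card Y0))) ^ L = exp (- (real (card S) * real L / real (card Y0)))"
    by (simp add: exp_of_nat_mult[symmetric] field_simps)
  finally show ?thesis by (simp add: mult_right_mono)
qed

text \<open>The Chernoff argument: weight \<theta> on \<open>S\<close> and \<open>1\<close>
  elsewhere gives the generating function of the edge count, whose mean weight is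
  \<open>1 + (\<theta> - 1) * card S / card Y0\<close>. The parameter is left free since it is
  chosen differently in the applications.\<close>

lemma card_frozen_tail_le:
  fixes Y :: "'a set" and Z :: "'b set" and d :: nat and \<rho> :: "'a \<Rightarrow> 'b set"
  assumes fin: "finite Y" "finite Z" and Y0: "Y0 \<subseteq> Y" "Y0 \<noteq> {}" and U: "U \<subseteq> Z" and S: "S \<subseteq> Y0"
    and \<theta>: "1 \<le> (\<theta>::real)"
  defines "L \<equiv> \<Sum>z\<in>U. d - card {y\<in>Y - Y0. z \<in> \<rho> y}"
  shows "card {g\<in>frozen_rows Y Z D d Y0 \<rho>. t \<le> real (\<Sum>y\<in>S. card (g y \<inter> U))} \<le>
    \<theta> powr (- t) * exp ((\<theta> - 1) * real (card S) * real L / real (card Y0)) * card (frozen_rows Y Z D d Y0 \<rho>)"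
proof -
  let ?B = "frozen_rows Y Z D d Y0 \<rho>"
  have finY0: "finite Y0" and finU: "finite U" using Y0 U fin finite_subset by blast+
  have finS: "finite S" using S finY0 finite_subset by blast
  have finB: "finite ?B" by (rule finite_frozen_rows[OF fin])
  have c0: "card Y0 > 0" using Y0 finY0 by (simp add: card_gt_0_iff)
  define w where "w y = (if y \<in> S then \<theta> else 1)" for y
  define A where "A = 1 + (\<theta> - 1) * real (card S) / real (card Y0)"
  have "sum w Y0 = real (card Y0) + (\<theta> - 1) * real (card S)"
  proof -
    have "sum w Y0 = (\<Sum>y\<in>Y0. 1 + (\<theta> - 1) * of_bool (y \<in> S))" by (auto simp: w_def intro!: sum.cong)
    also have "\<dots> = real (card Y0) + (\<theta> - 1) * real (card S)"
      using S finY0 by (simp add: sum.distrib sum_distrib_left[symmetric] Int_absorb1)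
    finally show ?thesis .
  qed
  then have A: "sum w Y0 = A * card Y0"
    using c0 by (simp add: A_def distrib_right)
  have A0: "0 \<le> A" using \<theta> by (simp add: A_def)
  have "real (card {g\<in>?B. t \<le> real (\<Sum>y\<in>S. card (g y \<inter> U))}) =
      (\<Sum>g\<in>?B. of_bool (t \<le> real (\<Sum>y\<in>S. card (g y \<inter> U))))"
    using finB by (simp add: Int_def)
  also have "\<dots> \<le> (\<Sum>g\<in>?B. \<theta> powr (- t) * (\<Prod>y\<in>Y0. w y ^ card (g y \<inter> U)))"
  proof (rule sum_mono)
    fix g
    have "(\<Prod>y\<in>Y0. w y ^ card (g y \<inter> U)) = (\<Prod>y\<in>S. \<theta> ^ card (g y \<inter> U))"
      using S finY0 by (intro prod.mono_neutral_cong_right) (auto simp: w_def)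
    also have "\<dots> = \<theta> powr real (\<Sum>y\<in>S. card (g y \<inter> U))"
      unfolding power_sum[symmetric] by (rule powr_realpow[symmetric]) (use \<theta> in simp)
    finally have "\<theta> powr (- t) * (\<Prod>y\<in>Y0. w y ^ card (g y \<inter> U)) =
        \<theta> powr (real (\<Sum>y\<in>S. card (g y \<inter> U)) - t)"
      by (simp add: powr_add[symmetric])
    then show "of_bool (t \<le> real (\<Sum>y\<in>S. card (g y \<inter> U))) \<le> \<theta> powr (- t) * (\<Prod>y\<in>Y0. w y ^ card (g y \<inter> U))"
      using \<theta> by (auto simp: of_bool_def ge_one_powr_ge_zero)
  qed
  also have "\<dots> = \<theta> powr (- t) * (\<Sum>g\<in>?B. \<Prod>y\<in>Y0. w y ^ card (g y \<inter> U))"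
    by (simp add: sum_distrib_left)
  also have "\<dots> \<le> \<theta> powr (- t) * (\<Sum>g\<in>?B. A ^ (\<Sum>y\<in>Y0. card (g y \<inter> U)))"
    using \<theta> by (intro mult_left_mono sum_rows_le_mean[OF fin Y0(1) _ A]) (simp_all add: w_def)
  also have "(\<Sum>g\<in>?B. A ^ (\<Sum>y\<in>Y0. card (g y \<inter> U))) = (\<Sum>g\<in>?B. A ^ L)"
    using frozen_rows_total[OF fin Y0(1) U] by (intro sum.cong) (auto simp: L_def)
  also have "(\<Sum>g\<in>?B. A ^ L) = A ^ L * card ?B" by simp
  finally have 1: "real (card {g\<in>?B. t \<le> real (\<Sum>y\<in>S. card (g y \<inter> U))}) \<le> \<theta> powr (- t) * (A ^ L * card ?B)" .
  have "A ^ L \<le> exp ((\<theta> - 1) * real (card S) / real (card Y0)) ^ L"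
    using A0 exp_ge_add_one_self[of "(\<theta> - 1) * real (card S) / real (card Y0)"]
    by (intro power_mono) (auto simp: A_def)
  also have "\<dots> = exp ((\<theta> - 1) * real (card S) * real L / real (card Y0))"
    by (simp add: exp_of_nat_mult[symmetric] field_simps)
  finally have "\<theta> powr (- t) * (A ^ L * card ?B) \<le>
      \<theta> powr (- t) * (exp ((\<theta> - 1) * real (card S) * real L / real (card Y0)) * card ?B)"
    by (intro mult_left_mono mult_right_mono) auto
  then show ?thesis using 1 by simp
qed

section \<open>Matchings into a row\<close>

text \<open>The Halmos-Vaughan induction. If a nonempty proper subset is tight, it is matched within
  its neighbourhood and the remaining elements outside it, where Hall's condition persists by
  counting the union. If none is tight, every proper subset has a spare neighbour, so one element
  may be matched arbitrarily.\<close>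

lemma hall_marriage:
  fixes N :: "'a \<Rightarrow> 'b set"
  assumes "finite A" and "\<And>a. a \<in> A \<Longrightarrow> finite (N a)"
    and "\<And>S. S \<subseteq> A \<Longrightarrow> card S \<le> card (\<Union>a\<in>S. N a)"
  shows "\<exists>f. inj_on f A \<and> (\<forall>a\<in>A. f a \<in> N a)"
  using assms
proof (induction "card A" arbitrary: A N rule: less_induct)
  case less
  note finA = less.prems(1) and finN = less.prems(2) and hall = less.prems(3)
  show ?case
  proof (cases "A = {}")
    case True
    then show ?thesis by simp
  next
    case nonempty: False
    show ?thesis
    proof (cases "\<exists>S. S \<subset> A \<and> S \<noteq> {} \<and> card S = card (\<Union>a\<in>S. N a)")
      case True
      then obtain S where S: "S \<subset> A" "S \<noteq> {}" "card S = card (\<Union>a\<in>S. N a)" by auto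
      let ?M = "\<Union>a\<in>S. N a"
      have finS: "finite S"
        using S finA by (auto intro: finite_subset)
      have finM: "finite ?M"
        using finS S finN by auto
      have "card S < card A" using psubset_card_mono[OF finA S(1)] .
      then obtain f where f: "inj_on f S" "\<And>a. a \<in> S \<Longrightarrow> f a \<in> N a"
        using less.hyps[of S N] finS S(1) finN hall by (metis psubset_imp_subset subset_trans subsetD)
      have "card (A - S) < card A"
        using S finA by (intro psubset_card_mono) auto
      moreover have "card T \<le> card (\<Union>a\<in>T. N a - ?M)" if T: "T \<subseteq> A - S" for T
      proof -
        have finT: "finite T" using T finA finite_subset by blast
        have "card T + card S = card (T \<union> S)"
          by (rule card_Un_disjoint[symmetric]) (use T finT finS in auto)
        also have "\<dots> \<le> card (\<Union>a\<in>T \<union> S. N a)"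
          using T S by (intro hall) auto
        also have "(\<Union>a\<in>T \<union> S. N a) = (\<Union>a\<in>T. N a - ?M) \<union> ?M" by auto
        also have "card \<dots> \<le> card (\<Union>a\<in>T. N a - ?M) + card ?M" by (rule card_Un_le)
        finally show ?thesis using S(3) by simp
      qed
      ultimately obtain f' where f': "inj_on f' (A - S)" "\<And>a. a \<in> A - S \<Longrightarrow> f' a \<in> N a - ?M"
        using less.hyps[of "A - S" "\<lambda>a. N a - ?M"] finA finN by (metis Diff_iff finite_Diff)
      define h where "h a = (if a \<in> S then f a else f' a)" for a
      have "inj_on h A"
      proof (rule inj_onI)
        fix a b assume ab: "a \<in> A" "b \<in> A" "h a = h b"
        have in_M: "f c \<in> ?M" if "c \<in> S" for c using f(2)[OF that] that by blast
        have notin_M: "f' c \<notin> ?M" if "c \<in> A" "c \<notin> S" for c using f'(2)[of c] that by blast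
        show "a = b"
        proof (cases "a \<in> S"; cases "b \<in> S")
          assume "a \<in> S" "b \<in> S"
          then show ?thesis using ab f(1) by (simp add: h_def inj_on_eq_iff)
        next
          assume "a \<in> S" "b \<notin> S"
          then show ?thesis using ab in_M[of a] notin_M[of b] by (simp add: h_def)
        next
          assume "a \<notin> S" "b \<in> S"
          then show ?thesis using ab in_M[of b] notin_M[of a] by (simp add: h_def)
        next
          assume "a \<notin> S" "b \<notin> S"
          then show ?thesis using ab f'(1) by (simp add: h_def inj_on_eq_iff)
        qed
      qed
      moreover have "\<forall>a\<in>A. h a \<in> N a" using f f' by (auto simp: h_def)
      ultimately show ?thesis by blast
    next
      case False
      obtain a where a: "a \<in> A" using nonempty by auto
      have "N a \<noteq> {}" using hall[of "{a}"] a by auto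
      then obtain b where b: "b \<in> N a" by auto
      have "card (A - {a}) < card A" using card_Diff1_less[OF finA a] .
      moreover have "card T \<le> card (\<Union>x\<in>T. N x - {b})" if T: "T \<subseteq> A - {a}" for T
      proof (cases "T = {}")
        case True
        then show ?thesis by simp
      next
        case nonT: False
        have "T \<subset> A" using T a by auto
        then have "card T \<noteq> card (\<Union>x\<in>T. N x)" "card T \<le> card (\<Union>x\<in>T. N x)"
          using False nonT hall[of T] by auto
        moreover have "(\<Union>x\<in>T. N x - {b}) = (\<Union>x\<in>T. N x) - {b}" by auto
        moreover have "card ((\<Union>x\<in>T. N x) - {b}) \<ge> card (\<Union>x\<in>T. N x) - 1"
          using diff_card_le_card_Diff[of "{b}" "\<Union>x\<in>T. N x"] by simp
        ultimately show ?thesis by simp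
      qed
      ultimately obtain f where f: "inj_on f (A - {a})" "\<And>x. x \<in> A - {a} \<Longrightarrow> f x \<in> N x - {b}"
        using less.hyps[of "A - {a}" "\<lambda>x. N x - {b}"] finA finN by (metis Diff_iff finite_Diff)
      have "inj_on (f(a := b)) A"
      proof (rule inj_onI)
        fix x y assume xy: "x \<in> A" "y \<in> A" "(f(a := b)) x = (f(a := b)) y"
        show "x = y"
        proof (cases "x = a"; cases "y = a")
          assume "x = a" "y \<noteq> a"
          then show ?thesis using xy f(2)[of y] by auto
        next
          assume "x \<noteq> a" "y = a"
          then show ?thesis using xy f(2)[of x] by auto
        next
          assume "x \<noteq> a" "y \<noteq> a"
          then show ?thesis using xy f(1) by (auto simp: inj_on_def)
        qed auto
      qed
      moreover have "\<forall>x\<in>A. (f(a := b)) x \<in> N x" using f b by auto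
      ultimately show ?thesis by blast
    qed
  qed
qed

section \<open>Union bound over the violations of Hall's condition\<close>

lemma choose_le_power: "n choose r \<le> n ^ r"
  by (cases "r \<le> n") (auto simp: binomial_le_pow binomial_eq_0)

text \<open>The binomials count the choices of \<open>S\<close> and \<open>U\<close> in
  \<open>no_matching_witness\<close>, and the last factor \<open>D\<close> pays for summing over
  \<open>s\<close>. Symmetry of the binomials replaces the larger of \<open>s\<close> and
  \<open>D + 1 - s\<close> by the smaller one, so that the count has the same exponent
  \<open>min s (D + 1 - s)\<close> as the probability it is compared with.\<close>

lemma binomial_product_le:
  assumes "1 \<le> s" "s \<le> D - 1"
  shows "((D - 1) choose s) * (D choose (D + 1 - s)) * D \<le> (D\<^sup>2) ^ min s (D + 1 - s)"
proof (cases "s \<le> D + 1 - s")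
  case True
  have "D choose (D + 1 - s) = D choose (s - 1)"
    using assms binomial_symmetric[of "s - 1" D] by (simp add: Suc_diff_le)
  then have "((D - 1) choose s) * (D choose (D + 1 - s)) * D \<le> (D - 1) ^ s * D ^ (s - 1) * D"
    by (intro mult_mono) (auto simp: choose_le_power)
  also have "\<dots> \<le> D ^ s * D ^ (s - 1) * D"
    by (intro mult_mono power_mono) auto
  also have "\<dots> = D ^ s * D ^ s"
    using assms by (cases s) simp_all
  also have "\<dots> = (D\<^sup>2) ^ min s (D + 1 - s)"
    using True by (simp add: power_mult[symmetric] power_add[symmetric] mult_2)
  finally show ?thesis .
next
  case False
  define u where "u = D + 1 - s"
  have u: "u \<ge> 2" "D - 1 - s = u - 2" "u - 2 + 2 = u" using assms by (auto simp: u_def)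
  have "(D - 1) choose s = (D - 1) choose (u - 2)"
    using assms binomial_symmetric[of s "D - 1"] u by simp
  then have "((D - 1) choose s) * (D choose u) * D \<le> (D - 1) ^ (u - 2) * D ^ u * D"
    by (intro mult_mono) (auto simp: choose_le_power)
  also have "\<dots> \<le> D ^ (u - 2) * D ^ u * (D * D)"
    using assms by (intro mult_mono power_mono) auto
  also have "\<dots> = D ^ (u - 2 + 2) * D ^ u"
    unfolding power_add by (simp add: power2_eq_square)
  also have "\<dots> = D ^ u * D ^ u"
    unfolding u(3) ..
  also have "\<dots> = (D\<^sup>2) ^ min s (D + 1 - s)"
    using False by (simp add: u_def power_mult[symmetric] power_add[symmetric] mult_2)
  finally show ?thesis unfolding u_def .
qed

text \<open>A violator \<open>S\<close> of Hall's condition cannot contain \<open>v\<close>, whose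
  row is all of \<open>B\<close> and hence as large as \<open>A\<close>. At most
  \<open>card S - 1\<close> elements of \<open>B\<close> are reached from \<open>S\<close>, which
  leaves \<open>D + 1 - card S\<close> for \<open>U\<close>.\<close>

lemma no_matching_witness:
  assumes fin: "finite A" "finite B" and v: "v \<in> A" "g v = B" and cards: "card A = D" "card B = D"
    and no: "\<not> (\<exists>f. inj_on f A \<and> (\<forall>a\<in>A. f a \<in> g a \<inter> B))"
  shows "\<exists>S U. S \<subseteq> A - {v} \<and> 1 \<le> card S \<and> card S \<le> D - 1 \<and> U \<subseteq> B \<and> card U = D + 1 - card S \<and>
    (\<forall>y\<in>S. g y \<inter> U = {})"
proof -
  have "\<exists>S. S \<subseteq> A \<and> card (\<Union>a\<in>S. g a \<inter> B) < card S"
  proof (rule ccontr)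
    assume "\<not> (\<exists>S. S \<subseteq> A \<and> card (\<Union>a\<in>S. g a \<inter> B) < card S)"
    then have "\<And>S. S \<subseteq> A \<Longrightarrow> card S \<le> card (\<Union>a\<in>S. g a \<inter> B)" by (meson not_less)
    then have "\<exists>f. inj_on f A \<and> (\<forall>a\<in>A. f a \<in> g a \<inter> B)"
      using fin by (intro hall_marriage) auto
    then show False using no by simp
  qed
  then obtain S where S: "S \<subseteq> A" "card (\<Union>a\<in>S. g a \<inter> B) < card S" by auto
  have finS: "finite S" using S fin finite_subset by blast
  have "v \<notin> S"
  proof
    assume "v \<in> S"
    then have "(\<Union>a\<in>S. g a \<inter> B) = B" using v by auto
    then show False using S cards card_mono[OF fin(1) S(1)] by simp
  qed
  then have Sv: "S \<subseteq> A - {v}" using S by auto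
  have "card S \<le> card (A - {v})" by (rule card_mono) (use fin Sv in auto)
  then have cS: "1 \<le> card S" "card S \<le> D - 1" using S cards v fin by auto
  have "card (B - (\<Union>a\<in>S. g a \<inter> B)) = D - card (\<Union>a\<in>S. g a \<inter> B)"
    using cards by (subst card_Diff_subset) (use fin in \<open>auto intro: finite_subset[of _ B]\<close>)
  then have "D + 1 - card S \<le> card (B - (\<Union>a\<in>S. g a \<inter> B))" using S by simp
  then obtain U where "U \<subseteq> B - (\<Union>a\<in>S. g a \<inter> B)" "card U = D + 1 - card S"
    by (meson obtain_subset_with_card_n)
  then show ?thesis using Sv cS by (intro exI[of _ S] exI[of _ U]) auto
qed

text \<open>Fixing the row of \<open>v\<close> makes the target of the matching a fixed set; the
  possible witnesses \<open>S\<close> and \<open>U\<close> are then deterministic and a union bound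
  applies to the other rows.\<close>

lemma card_no_matching_le:
  fixes Y :: "'a set" and Z :: "'b set"
  assumes fin: "finite Y" "finite Z" and A: "A \<subseteq> Y" "card A = D" and v: "v \<in> A"
    and n: "card Y \<ge> 2"
  shows "real (card {g\<in>biregular_rows Y Z D d. \<not> (\<exists>f. inj_on f A \<and> (\<forall>a\<in>A. f a \<in> g a \<inter> g v))}) \<le>
    real D ^ 2 * exp (- (real (D + 1) * real (d - 1) / (2 * (real (card Y) - 1)))) *
      card (biregular_rows Y Z D d)"
proof -
  let ?B = "biregular_rows Y Z D d"
  let ?bad = "\<lambda>g. \<not> (\<exists>f. inj_on f A \<and> (\<forall>a\<in>A. f a \<in> g a \<inter> g v))"
  define \<kappa> where "\<kappa> = real (D + 1) * real (d - 1) / (2 * (real (card Y) - 1))"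
  define \<rho> where "\<rho> = real D ^ 2 * exp (- \<kappa>)"
  have finB: "finite ?B" by (rule finite_biregular_rows[OF fin])
  have finA: "finite A" using A fin finite_subset by blast
  have D1: "D \<ge> 1" using A v finA by (cases D) auto
  have \<kappa>0: "0 \<le> \<kappa>" using n by (simp add: \<kappa>_def)
  have vY: "v \<in> Y" using v A by auto
  \<comment> \<open>The claim is trivial for \<open>\<rho> > 1\<close>. Otherwise powers of \<rho>
    are at most \<rho>, so the smallest witnesses dominate the union bound.\<close>
  show ?thesis
  proof (cases "\<rho> \<le> 1")
    case False
    have "real (card {g\<in>?B. ?bad g}) \<le> 1 * real (card ?B)"
      using card_mono[OF finB, of "{g\<in>?B. ?bad g}"] by simp
    also have "\<dots> \<le> \<rho> * card ?B"
      using False by (intro mult_right_mono) auto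
    finally show ?thesis by (simp add: \<rho>_def \<kappa>_def)
  next
    case True
    have \<rho>0: "0 \<le> \<rho>" by (simp add: \<rho>_def)
    have one: "real (card {g\<in>?B. g v = W \<and> ?bad g}) \<le> \<rho> * card {g\<in>?B. g v = W}"
      if W: "W \<subseteq> Z" "card W = D" for W
    proof -
      let ?F = "frozen_rows Y Z D d (Y - {v}) (\<lambda>_. W)"
      have F: "?F = {g\<in>?B. g v = W}" using vY by (auto simp: frozen_rows_def)
      have finF: "finite ?F" by (rule finite_frozen_rows[OF fin])
      have finW: "finite W" using W fin finite_subset by blast
      let ?SS = "\<lambda>s. {S. S \<subseteq> A - {v} \<and> card S = s}" and ?UU = "\<lambda>s. {U. U \<subseteq> W \<and> card U = D + 1 - s}"
      let ?E = "\<lambda>S U. {g\<in>?F. \<forall>y\<in>S. g y \<inter> U = {}}"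
      have finSS: "finite (?SS s)" and finUU: "finite (?UU s)" for s
        using finA finW by auto
      have "{g\<in>?B. g v = W \<and> ?bad g} \<subseteq> (\<Union>s\<in>{1..D - 1}. \<Union>S\<in>?SS s. \<Union>U\<in>?UU s. ?E S U)"
      proof
        fix g assume "g \<in> {g\<in>?B. g v = W \<and> ?bad g}"
        then have g: "g \<in> ?F" "g v = W" and bad: "?bad g" using F by auto
        from no_matching_witness[OF finA finW v, where g = g, OF g(2) A(2) W(2)] bad g(2)
        obtain S U where "S \<subseteq> A - {v}" "1 \<le> card S" "card S \<le> D - 1" "U \<subseteq> W"
          "card U = D + 1 - card S" "\<forall>y\<in>S. g y \<inter> U = {}" by blast
        then show "g \<in> (\<Union>s\<in>{1..D - 1}. \<Union>S\<in>?SS s. \<Union>U\<in>?UU s. ?E S U)"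
          using g by (intro UN_I[of "card S"] UN_I[of S] UN_I[of U]) auto
      qed
      then have "card {g\<in>?B. g v = W \<and> ?bad g} \<le> card (\<Union>s\<in>{1..D - 1}. \<Union>S\<in>?SS s. \<Union>U\<in>?UU s. ?E S U)"
        by (rule card_mono[rotated]) (use finSS finUU finF in auto)
      also have "\<dots> \<le> (\<Sum>s\<in>{1..D - 1}. card (\<Union>S\<in>?SS s. \<Union>U\<in>?UU s. ?E S U))"
        by (rule card_UN_le) simp
      also have "\<dots> \<le> (\<Sum>s\<in>{1..D - 1}. \<Sum>S\<in>?SS s. card (\<Union>U\<in>?UU s. ?E S U))"
        by (intro sum_mono card_UN_le finSS)
      also have "\<dots> \<le> (\<Sum>s\<in>{1..D - 1}. \<Sum>S\<in>?SS s. \<Sum>U\<in>?UU s. card (?E S U))"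
        by (intro sum_mono card_UN_le finUU)
      finally have "real (card {g\<in>?B. g v = W \<and> ?bad g}) \<le>
          (\<Sum>s\<in>{1..D - 1}. \<Sum>S\<in>?SS s. \<Sum>U\<in>?UU s. real (card (?E S U)))"
        by (simp flip: of_nat_sum add: of_nat_le_iff del: of_nat_sum)
      also have "\<dots> \<le> (\<Sum>s\<in>{1..D - 1}. \<Sum>S\<in>?SS s. \<Sum>U\<in>?UU s. exp (- (real (min s (D + 1 - s)) * \<kappa>)) * card ?F)"
      proof (intro sum_mono)
        fix s S U assume s: "s \<in> {1..D - 1}" and S: "S \<in> ?SS s" and U: "U \<in> ?UU s"
        have c: "card (Y - {v}) = card Y - 1" using vY fin by simp
        then have ne: "Y - {v} \<noteq> {}" using n by (intro notI) simp
        \<comment> \<open>Every column of \<open>U\<close> already contains \<open>v\<close>, so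
          only \<open>d - 1\<close> of its entries are left for the free rows.\<close>
        have "Y - (Y - {v}) = {v}" using vY by auto
        then have L: "(\<Sum>z\<in>U. d - card {y\<in>Y - (Y - {v}). z \<in> W}) = (D + 1 - s) * (d - 1)"
          using U by (auto simp: subset_iff)
        have "real (card (?E S U)) \<le> exp (- (real (card S) * real (\<Sum>z\<in>U. d - card {y\<in>Y - (Y - {v}). z \<in> W}) /
            real (card (Y - {v})))) * card ?F"
          by (rule card_frozen_avoid_le[OF fin]) (use S U W A ne in auto)
        also have "\<dots> = exp (- (real s * (real (D + 1 - s) * real (d - 1)) / (real (card Y) - 1))) * card ?F"
          using S n unfolding L c by (simp add: of_nat_diff)
        also have "\<dots> \<le> exp (- (real (min s (D + 1 - s)) * \<kappa>)) * card ?F"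
        proof -
          have "real (min s (D + 1 - s)) * real (D + 1) \<le> 2 * (real s * real (D + 1 - s))"
          proof -
            \<comment> \<open>The sizes of \<open>S\<close> and \<open>U\<close> add up to
              \<open>D + 1\<close>, so the larger is at least half of it; this is the origin of the
              \<open>2\<close> in the exponent.\<close>
            have "D + 1 \<le> 2 * max s (D + 1 - s)" by linarith
            then have "min s (D + 1 - s) * (D + 1) \<le> min s (D + 1 - s) * (2 * max s (D + 1 - s))"
              by (rule mult_left_mono) simp
            also have "\<dots> = 2 * (s * (D + 1 - s))"
              by (cases "s \<le> D + 1 - s") (auto simp: min_def max_def)
            finally show ?thesis by (metis of_nat_le_iff of_nat_mult of_nat_numeral)
          qed
          then have "real (min s (D + 1 - s)) * real (D + 1) * (real (d - 1) / (2 * (real (card Y) - 1)))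
            \<le> 2 * (real s * real (D + 1 - s)) * (real (d - 1) / (2 * (real (card Y) - 1)))"
            using n by (intro mult_right_mono) auto
          also have "\<dots> = real s * (real (D + 1 - s) * real (d - 1)) / (real (card Y) - 1)"
          proof -
            have "2 * (a * b) * (c / (2 * q)) = a * (b * c) / q" for a b c q :: real by simp
            then show ?thesis .
          qed
          finally have "real (min s (D + 1 - s)) * \<kappa> \<le> real s * (real (D + 1 - s) * real (d - 1)) / (real (card Y) - 1)"
            by (simp only: \<kappa>_def times_divide_eq_right mult.assoc)
          then show ?thesis by (intro mult_right_mono) auto
        qed
        finally show "real (card (?E S U)) \<le> exp (- (real (min s (D + 1 - s)) * \<kappa>)) * card ?F" .
      qed
      also have "\<dots> = (\<Sum>s\<in>{1..D - 1}. real (((D - 1) choose s) * (D choose (D + 1 - s))) *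
          exp (- (real (min s (D + 1 - s)) * \<kappa>)) * card ?F)"
        using n_subsets[of "A - {v}"] n_subsets[OF finW] finA v A W by (simp add: mult.assoc)
      \<comment> \<open>Each size \<open>s\<close> receives the share \<open>\<rho> / D\<close>; as
        there are only \<open>D - 1\<close> sizes, the total stays below \<rho>.\<close>
      also have "\<dots> \<le> (\<Sum>s\<in>{1..D - 1}. \<rho> / real D * card ?F)"
      proof (intro sum_mono mult_right_mono)
        fix s assume s: "s \<in> {1..D - 1}"
        let ?r = "min s (D + 1 - s)"
        have "real (((D - 1) choose s) * (D choose (D + 1 - s))) * real D \<le> (real D ^ 2) ^ ?r"
          using binomial_product_le[of s D] s by (metis atLeastAtMost_iff of_nat_le_iff of_nat_mult of_nat_power)
        then have "real (((D - 1) choose s) * (D choose (D + 1 - s))) * exp (- (real ?r * \<kappa>)) * real D \<le>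
            (real D ^ 2) ^ ?r * exp (- (real ?r * \<kappa>))"
          using mult_right_mono[of _ _ "exp (- (real ?r * \<kappa>))"] by (simp add: mult_ac)
        also have "\<dots> = \<rho> ^ ?r"
          by (simp add: \<rho>_def power_mult_distrib exp_of_nat_mult[symmetric])
        also have "\<dots> \<le> \<rho> ^ 1"
          using True \<rho>0 s by (intro power_decreasing) auto
        finally show "real (((D - 1) choose s) * (D choose (D + 1 - s))) * exp (- (real ?r * \<kappa>)) \<le> \<rho> / real D"
          using D1 by (simp add: pos_le_divide_eq)
      qed auto
      also have "\<dots> = real (D - 1) / real D * (\<rho> * card ?F)" by simp
      also have "\<dots> \<le> 1 * (\<rho> * card ?F)"
        using \<rho>0 D1 by (intro mult_right_mono) auto
      finally show ?thesis unfolding F by simp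
    qed
    let ?WW = "{W. W \<subseteq> Z \<and> card W = D}"
    have finWW: "finite ?WW" using fin by auto
    have grp: "card {g\<in>?B. P g} = (\<Sum>W\<in>?WW. card {g\<in>?B. g v = W \<and> P g})" for P
    proof -
      have "{g\<in>?B. P g} = (\<Union>W\<in>?WW. {g\<in>?B. g v = W \<and> P g})"
        using biregular_rowsD(1,2)[of _ Y Z D d v] vY by auto
      also have "card \<dots> = (\<Sum>W\<in>?WW. card {g\<in>?B. g v = W \<and> P g})"
        by (rule card_UN_disjoint) (use finWW finB in auto)
      finally show ?thesis .
    qed
    have "real (card {g\<in>?B. ?bad g}) = (\<Sum>W\<in>?WW. real (card {g\<in>?B. g v = W \<and> ?bad g}))"
      unfolding grp[of ?bad] by simp
    also have "\<dots> \<le> (\<Sum>W\<in>?WW. \<rho> * card {g\<in>?B. g v = W})"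
      by (intro sum_mono one) auto
    also have "\<dots> = \<rho> * card ?B"
      using grp[of "\<lambda>_. True"] by (simp add: sum_distrib_left)
    finally show ?thesis by (simp add: \<rho>_def \<kappa>_def)
  qed
qed

section \<open>Disjoint rows\<close>

lemma card_le_by_freezing:
  fixes c :: real
  assumes fin: "finite Y" "finite Z"
    and le: "\<And>g0. g0 \<in> biregular_rows Y Z D d \<Longrightarrow>
      card {g\<in>frozen_rows Y Z D d Y0 g0. P g} \<le> c * card (frozen_rows Y Z D d Y0 g0)"
  shows "card {g\<in>biregular_rows Y Z D d. P g} \<le> c * card (biregular_rows Y Z D d)"
proof -
  let ?B = "biregular_rows Y Z D d"
  let ?k = "\<lambda>g. restrict g (Y - Y0)"
  have finB: "finite ?B" by (rule finite_biregular_rows[OF fin])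
  have fibre: "{g\<in>?B. ?k g = ?k g0} = frozen_rows Y Z D d Y0 g0" for g0
    by (auto simp: frozen_rows_def restrict_def fun_eq_iff)
  have "real (card {g\<in>?B. P g}) = (\<Sum>g\<in>?B. of_bool (P g))"
    using finB by (simp add: Int_def)
  also have "\<dots> = (\<Sum>u\<in>?k ` ?B. \<Sum>g\<in>{g\<in>?B. ?k g = u}. of_bool (P g))"
    by (rule sum.group[symmetric]) (use finB in auto)
  also have "\<dots> \<le> (\<Sum>u\<in>?k ` ?B. \<Sum>g\<in>{g\<in>?B. ?k g = u}. c)"
  proof (rule sum_mono)
    fix u assume "u \<in> ?k ` ?B"
    then obtain g0 where g0: "g0 \<in> ?B" "u = ?k g0" by auto
    show "(\<Sum>g\<in>{g\<in>?B. ?k g = u}. of_bool (P g)) \<le> (\<Sum>g\<in>{g\<in>?B. ?k g = u}. c)"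
      unfolding g0(2) fibre using le[OF g0(1)] finite_frozen_rows[OF fin]
      by (simp add: Int_def mult.commute)
  qed
  also have "\<dots> = (\<Sum>g\<in>?B. c)"
    by (rule sum.group) (use finB in auto)
  finally show ?thesis by (simp add: mult.commute)
qed

text \<open>Freezing \<open>i\<close> rows lowers both the remaining entries of a column and the
  number of free rows by \<open>i\<close>; since \<open>d \<le> n\<close> the density can only drop,
  so bounds may be stated with \<open>d / n\<close>.\<close>

lemma shifted_ratio_le:
  assumes "d \<le> n" "i < n"
  shows "real (d - i) / (real n - real i) \<le> real d / real n"
proof (cases "i \<le> d")
  case True
  have "(real d - real i) * real n \<le> real d * (real n - real i)"
    using mult_left_mono[of "real d" "real n" "real i"] assms by (simp add: algebra_simps)
  then show ?thesis using True assms by (simp add: of_nat_diff frac_le_eq divide_le_eq field_simps)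
next
  case False
  then show ?thesis using assms by simp
qed

text \<open>Row \<open>x\<close> is frozen and serves as target set. Its columns have
  \<open>d - 1\<close> entries left each, so a free row meets it in at most
  \<open>D * d / card Y\<close> elements on average.\<close>

lemma card_common_tail_le:
  fixes Y :: "'a set" and Z :: "'b set"
  assumes fin: "finite Y" "finite Z" and x: "x \<in> Y" and S: "S \<subseteq> Y - {x}" "S \<noteq> {}"
    and d: "d \<le> card Y" and \<theta>: "1 \<le> (\<theta>::real)"
  shows "card {g\<in>biregular_rows Y Z D d. t \<le> real (\<Sum>y\<in>S. card (g y \<inter> g x))} \<le>
    \<theta> powr (- t) * exp ((\<theta> - 1) * real (card S) * (real D * real d / real (card Y))) *
      card (biregular_rows Y Z D d)"
proof (rule card_le_by_freezing[OF fin, where ?Y0.0 = "Y - {x}"])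
  fix g0 assume g0: "g0 \<in> biregular_rows Y Z D d"
  let ?F = "frozen_rows Y Z D d (Y - {x}) g0"
  have ne: "Y - {x} \<noteq> {}" using S by auto
  have "card (Y - {x}) > 0" using ne fin by (simp add: card_gt_0_iff del: card_Diff_singleton)
  then have n: "card (Y - {x}) = card Y - 1" "card Y > 1" using x by auto
  have "{g\<in>?F. t \<le> real (\<Sum>y\<in>S. card (g y \<inter> g x))} = {g\<in>?F. t \<le> real (\<Sum>y\<in>S. card (g y \<inter> g0 x))}"
    using x by (auto simp: frozen_rows_def)
  also have "real (card \<dots>) \<le> \<theta> powr (- t) * exp ((\<theta> - 1) * real (card S) *
      real (\<Sum>z\<in>g0 x. d - card {y\<in>Y - (Y - {x}). z \<in> g0 y}) / real (card (Y - {x}))) * card ?F"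
    by (rule card_frozen_tail_le[OF fin _ ne _ S(1) \<theta>]) (use biregular_rowsD(1)[OF g0 x] in auto)
  also have "(\<Sum>z\<in>g0 x. d - card {y\<in>Y - (Y - {x}). z \<in> g0 y}) = D * (d - 1)"
  proof -
    have "card {y\<in>Y - (Y - {x}). z \<in> g0 y} = 1" if "z \<in> g0 x" for z
    proof -
      have "{y\<in>Y - (Y - {x}). z \<in> g0 y} = {x}" using x that by auto
      then show ?thesis by simp
    qed
    then show ?thesis using biregular_rowsD(2)[OF g0 x] by simp
  qed
  also have "\<theta> powr (- t) * exp ((\<theta> - 1) * real (card S) * real (D * (d - 1)) / real (card (Y - {x}))) * card ?F
    \<le> \<theta> powr (- t) * exp ((\<theta> - 1) * real (card S) * (real D * real d / real (card Y))) * card ?F"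
  proof -
    have "real (d - 1) / (real (card Y) - 1) \<le> real d / real (card Y)"
      using shifted_ratio_le[of d "card Y" 1] d n by simp
    then have "((\<theta> - 1) * real (card S) * real D) * (real (d - 1) / (real (card Y) - 1)) \<le>
        ((\<theta> - 1) * real (card S) * real D) * (real d / real (card Y))"
      using \<theta> by (intro mult_left_mono) auto
    then have "(\<theta> - 1) * real (card S) * real (D * (d - 1)) / real (card (Y - {x})) \<le>
        (\<theta> - 1) * real (card S) * (real D * real d / real (card Y))"
      using n by (simp add: of_nat_diff mult.assoc)
    then show ?thesis by (intro mult_right_mono mult_left_mono) auto
  qed
  finally show "real (card {g\<in>?F. t \<le> real (\<Sum>y\<in>S. card (g y \<inter> g x))}) \<le>
    \<theta> powr (- t) * exp ((\<theta> - 1) * real (card S) * (real D * real d / real (card Y))) * card ?F" .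
qed

text \<open>The case \<open>t = 1\<close> of the tail bounds, optimised over \<open>\<theta>\<close>.\<close>

lemma markov_from_tail:
  fixes c :: real
  assumes tail: "\<And>\<theta>. 1 \<le> \<theta> \<Longrightarrow> p \<le> \<theta> powr (- 1) * exp ((\<theta> - 1) * m) * c"
    and m: "0 \<le> m" and p: "p \<le> c" and c: "0 \<le> c"
  shows "p \<le> 3 * m * c"
proof (cases "m \<le> 1 / 3")
  case False
  then have "1 * c \<le> 3 * m * c" using c by (intro mult_right_mono) auto
  then show ?thesis using p by simp
next
  case le: True
  show ?thesis
  proof (cases "m = 0")
    case True
    have "p \<le> 0"
    proof (rule ccontr)
      assume "\<not> p \<le> 0"
      \<comment> \<open>For \<open>m = 0\<close> the tail bound reads
        \<open>p \<le> c / \<theta>\<close>; this \<theta> makes the right-hand side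
        \<open>p / 2\<close>.\<close>
      define \<theta> where "\<theta> = 2 * (c / p)"
      have "1 \<le> c / p" using \<open>\<not> p \<le> 0\<close> p by simp
      then have "1 \<le> \<theta>" by (simp add: \<theta>_def)
      then have "p \<le> c / \<theta>"
        using tail[of \<theta>] True by (simp add: powr_minus field_simps)
      also have "c / \<theta> = p / 2"
        using \<open>1 \<le> c / p\<close> \<open>\<not> p \<le> 0\<close> by (auto simp: \<theta>_def)
      finally show False using \<open>\<not> p \<le> 0\<close> by simp
    qed
    then show ?thesis using True by simp
  next
    case False
    \<comment> \<open>The minimiser \<open>\<theta> = 1 / m\<close> is admissible because
      \<open>m \<le> 1 / 3\<close>; it leaves the factor \<open>exp (1 - m) \<le> 3\<close>.\<close>
    then have "p \<le> (1 / m) powr (- 1) * exp ((1 / m - 1) * m) * c"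
      using m le by (intro tail) (simp add: field_simps)
    also have "\<dots> = m * exp (1 - m) * c"
      using False m by (simp add: powr_minus field_simps)
    also have "\<dots> \<le> m * 3 * c"
      using m c exp_le order_trans[of "exp (1 - m)" "exp 1" 3]
      by (intro mult_right_mono mult_left_mono) auto
    finally show ?thesis by simp
  qed
qed

text \<open>With \<open>P\<close> and \<open>Q\<close> the rows of \<open>v\<close> and of its spare
  vertex, and \<open>X\<close> the row to be avoided: a random resplit makes the row of
  \<open>v\<close> disjoint from \<open>X\<close> with conditional probability at least
  \<open>q\<close>. The condition involves \<open>P\<close> and \<open>Q\<close> only through their
  intersection and symmetric difference, hence is itself invariant under the resplit.\<close>

definition likely_disjoint :: "real \<Rightarrow> 'b set \<Rightarrow> 'b set \<Rightarrow> 'b set \<Rightarrow> bool" where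
  "likely_disjoint q P Q X \<longleftrightarrow> q * real (card (halves (sym_diff P Q))) \<le>
     real (card {R\<in>halves (sym_diff P Q). (P \<inter> Q \<union> R) \<inter> X = {}})"

text \<open>Raising \<open>s\<close> by one multiplies the binomial by
  \<open>(k - s) / (2 * k - s)\<close>, which is at least \<open>2 / 5\<close> exactly when
  \<open>3 * s \<le> k\<close>.\<close>

lemma binomial_shift_ge:
  assumes "3 * s \<le> (k::nat)"
  shows "(2 / 5) ^ s * real (2 * k choose k) \<le> real ((2 * k - s) choose k)"
  using assms
proof (induction s)
  case 0
  then show ?case by simp
next
  case (Suc s)
  let ?M = "2 * k - s"
  have "(?M - k) * (?M choose k) = ?M * ((?M - 1) choose k)"
    by (rule binomial_absorb_comp)
  then have eq: "real (?M - k) * real (?M choose k) = real ?M * real ((?M - 1) choose k)"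
    by (metis of_nat_mult)
  have "2 / 5 * real ?M \<le> real (?M - k)"
    using Suc.prems by (simp add: of_nat_diff)
  then have "2 / 5 * real ?M * real (?M choose k) \<le> real ?M * real ((?M - 1) choose k)"
    unfolding eq[symmetric] by (rule mult_right_mono) simp
  then have "real ?M * (2 / 5 * real (?M choose k)) \<le> real ?M * real ((?M - 1) choose k)"
    by (simp add: mult_ac)
  moreover have "0 < real ?M" using Suc.prems by simp
  ultimately have "2 / 5 * real (?M choose k) \<le> real ((?M - 1) choose k)"
    by (simp only: mult_le_cancel_left_pos)
  moreover have "(2 / 5) ^ s * real (2 * k choose k) \<le> real (?M choose k)"
    using Suc by simp
  ultimately have "2 / 5 * ((2 / 5) ^ s * real (2 * k choose k)) \<le> real ((?M - 1) choose k)"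
    by linarith
  then show ?case by simp
qed

text \<open>The common part of \<open>P\<close> and \<open>Q\<close> cannot be moved, hence the
  condition on the triple intersection. A suitable \<open>R\<close> is any half of the symmetric
  difference avoiding its elements in \<open>X\<close>, so the conditional probability is a quotient
  of the two binomials compared in \<open>binomial_shift_ge\<close>.\<close>

lemma likely_disjointI:
  assumes fin: "finite P" "finite Q" and eq: "card P = card Q" and triple: "P \<inter> Q \<inter> X = {}"
    and s: "3 * card (sym_diff P Q \<inter> X) \<le> card (P - Q)"
    and q: "q \<le> (2 / 5) ^ card (sym_diff P Q \<inter> X)"
  shows "likely_disjoint q P Q X"
proof -
  let ?S = "sym_diff P Q"
  have cS: "card ?S = 2 * card (P - Q)" by (rule card_sym_diff_rows(1)[OF fin eq])
  have "halves ?S = {R. R \<subseteq> ?S \<and> card R = card (P - Q)}"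
    unfolding halves_def cS by auto
  then have h: "card (halves ?S) = 2 * card (P - Q) choose card (P - Q)"
    using n_subsets[of ?S "card (P - Q)"] fin cS by simp
  have "{R\<in>halves ?S. (P \<inter> Q \<union> R) \<inter> X = {}} = {R. R \<subseteq> ?S - X \<and> card R = card (P - Q)}"
    unfolding halves_def cS using triple by auto
  moreover have "card (?S - X) = 2 * card (P - Q) - card (?S \<inter> X)"
    using fin cS by (simp add: card_Diff_subset_Int)
  ultimately have "card {R\<in>halves ?S. (P \<inter> Q \<union> R) \<inter> X = {}} =
      (2 * card (P - Q) - card (?S \<inter> X)) choose card (P - Q)"
    using n_subsets[of "?S - X" "card (P - Q)"] fin by simp
  moreover have "q * real (card (halves ?S)) \<le>
      (2 / 5) ^ card (?S \<inter> X) * real (2 * card (P - Q) choose card (P - Q))"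
    unfolding h using q by (rule mult_right_mono) simp
  ultimately show ?thesis
    unfolding likely_disjoint_def using binomial_shift_ge[OF s] by linarith
qed

text \<open>With rows \<open>a\<close> and \<open>x\<close> frozen, their intersection is a target
  of fewer than \<open>l\<close> columns, each with \<open>d - 2\<close> entries left, and row
  \<open>v\<close> meets it with probability at most a constant times
  \<open>l * d / card Y\<close>.\<close>

lemma card_triple_common_le:
  fixes Y :: "'a set" and Z :: "'b set" and l :: real
  assumes fin: "finite Y" "finite Z" and Y: "v \<in> Y" "a \<in> Y" "x \<in> Y"
    and ne: "v \<noteq> a" "v \<noteq> x" "a \<noteq> x" and d: "d \<le> card Y" and l: "0 \<le> l"
  shows "card {g\<in>biregular_rows Y Z D d. card (g a \<inter> g x) < l \<and> g v \<inter> g a \<inter> g x \<noteq> {}} \<le>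
    3 * (l * (real d / real (card Y))) * card (biregular_rows Y Z D d)"
proof (rule card_le_by_freezing[OF fin, where ?Y0.0 = "Y - {a, x}"])
  fix g0 assume g0: "g0 \<in> biregular_rows Y Z D d"
  let ?Y0 = "Y - {a, x}"
  let ?F = "frozen_rows Y Z D d ?Y0 g0"
  let ?U = "g0 a \<inter> g0 x"
  have vY0: "{v} \<subseteq> ?Y0" "?Y0 \<noteq> {}" using Y ne by auto
  have c: "card ?Y0 = card Y - 2" using Y ne fin by (subst card_Diff_subset) auto
  have "card {v, a, x} \<le> card Y" using Y fin by (intro card_mono) auto
  then have n: "card Y \<ge> 3" using ne by simp
  have U: "?U \<subseteq> Z" using biregular_rowsD(1)[OF g0] Y by auto
  have finF: "finite ?F" by (rule finite_frozen_rows[OF fin])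
  have eq: "{g\<in>?F. card (g a \<inter> g x) < l \<and> g v \<inter> g a \<inter> g x \<noteq> {}} =
      {g\<in>?F. card ?U < l \<and> g v \<inter> ?U \<noteq> {}}"
    using Y by (auto simp: frozen_rows_def)
  show "real (card {g\<in>?F. card (g a \<inter> g x) < l \<and> g v \<inter> g a \<inter> g x \<noteq> {}}) \<le>
      3 * (l * (real d / real (card Y))) * card ?F"
  proof (cases "card ?U < l")
    case False
    then show ?thesis unfolding eq using l by simp
  next
    case True
    have finU: "finite ?U" using U fin finite_subset by blast
    have "real (card {g\<in>?F. g v \<inter> ?U \<noteq> {}}) \<le> 3 * (l * (real d / real (card Y))) * card ?F"
    proof (rule markov_from_tail)
      fix \<theta> :: real assume \<theta>: "1 \<le> \<theta>"
      have "{g\<in>?F. g v \<inter> ?U \<noteq> {}} = {g\<in>?F. 1 \<le> real (\<Sum>y\<in>{v}. card (g y \<inter> ?U))}"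
        using finU by (auto simp: Suc_le_eq card_gt_0_iff)
      also have "real (card \<dots>) \<le> \<theta> powr (- 1) * exp ((\<theta> - 1) * real (card {v}) *
          real (\<Sum>z\<in>?U. d - card {y\<in>Y - ?Y0. z \<in> g0 y}) / real (card ?Y0)) * card ?F"
        by (rule card_frozen_tail_le[OF fin _ vY0(2) U vY0(1) \<theta>]) auto
      also have "(\<Sum>z\<in>?U. d - card {y\<in>Y - ?Y0. z \<in> g0 y}) = card ?U * (d - 2)"
      proof -
        have "card {y\<in>Y - ?Y0. z \<in> g0 y} = 2" if "z \<in> ?U" for z
        proof -
          have "{y\<in>Y - ?Y0. z \<in> g0 y} = {a, x}" using Y that by auto
          then show ?thesis using ne by simp
        qed
        then show ?thesis by simp
      qed
      also have "\<theta> powr (- 1) * exp ((\<theta> - 1) * real (card {v}) * real (card ?U * (d - 2)) / real (card ?Y0)) * card ?F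
        \<le> \<theta> powr (- 1) * exp ((\<theta> - 1) * (l * (real d / real (card Y)))) * card ?F"
      proof -
        have "real (d - 2) / (real (card Y) - 2) \<le> real d / real (card Y)"
          using shifted_ratio_le[of d "card Y" 2] d n by simp
        then have "real (card ?U) * (real (d - 2) / (real (card Y) - 2)) \<le> l * (real d / real (card Y))"
          using True n by (intro mult_mono) auto
        then have "(\<theta> - 1) * (real (card ?U) * (real (d - 2) / (real (card Y) - 2))) \<le>
            (\<theta> - 1) * (l * (real d / real (card Y)))"
          using \<theta> by (intro mult_left_mono) auto
        then have "(\<theta> - 1) * real (card {v}) * real (card ?U * (d - 2)) / real (card ?Y0) \<le>
            (\<theta> - 1) * (l * (real d / real (card Y)))"
          using n unfolding c by (simp add: of_nat_diff mult.assoc)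
        then show ?thesis by (intro mult_right_mono mult_left_mono) auto
      qed
      finally show "real (card {g\<in>?F. g v \<inter> ?U \<noteq> {}}) \<le>
        \<theta> powr (- 1) * exp ((\<theta> - 1) * (l * (real d / real (card Y)))) * card ?F" .
    next
      show "real (card {g\<in>?F. g v \<inter> ?U \<noteq> {}}) \<le> real (card ?F)"
        using finF by (auto intro: card_mono)
    qed (use l in auto)
    then show ?thesis unfolding eq using True by simp
  qed
qed

text \<open>Used for the tail bound with \<open>\<theta> = 3 / 2\<close> at threshold
  \<open>l\<close>. The mean contributes at most \<open>l / 3\<close> to the exponent, and the
  surplus \<open>2 / 5 - 1 / 3 = 1 / 15\<close> is the rate \<open>l / 15\<close> that appears
  later.\<close>

lemma ln_three_halves_ge: "ln (3 / 2 :: real) \<ge> 2 / 5"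
proof -
  have "exp (2 :: real) = exp 1 ^ 2"
    by (simp add: power2_eq_square exp_add[symmetric])
  also have "\<dots> \<le> (272 / 100) ^ 2"
    using e_less_272 by (intro power_mono) auto
  also have "\<dots> \<le> (3 / 2) ^ 5"
    by (simp add: power_def)
  finally have "ln (exp (2 :: real)) \<le> ln ((3 / 2) ^ 5)"
    by (subst ln_le_cancel_iff) auto
  then show ?thesis by (simp add: ln_realpow)
qed

text \<open>Two regimes. For \<open>D \<ge> 10 * l\<close> the rows are long: unless intersections
  reach \<open>l\<close> or the three rows share an element, fewer than \<open>l\<close> elements
  must be avoided while the private part of a row exceeds \<open>9 * l\<close>, so
  \<open>likely_disjointI\<close> applies. For shorter rows, both \<open>g v\<close> and
  \<open>g a\<close> typically miss \<open>g x\<close> altogether, and a first-moment bound is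
  enough.\<close>

lemma card_unlikely_disjoint_le:
  fixes Y :: "'a set" and Z :: "'b set" and l :: real
  assumes fin: "finite Y" "finite Z" and Y: "v \<in> Y" "a \<in> Y" "x \<in> Y"
    and ne: "v \<noteq> a" "v \<noteq> x" "a \<noteq> x" and d: "d \<le> card Y"
    and edges: "card Y * D = card Z * d" and Z: "Z \<noteq> {}"
    and l: "0 \<le> l" and mean: "real D * real d / real (card Y) \<le> l / 3"
  shows "card {g\<in>biregular_rows Y Z D d. \<not> likely_disjoint ((2 / 5) powr l) (g v) (g a) (g x)} \<le>
    (2 * exp (- (l / 15)) + 3 * (l * (real d / real (card Y))) + 600 * l\<^sup>2 / real (card Z)) *
      card (biregular_rows Y Z D d)"
    (is "real (card ?bad) \<le> _ * real (card ?B)")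
proof -
  let ?q = "(2 / 5) powr l :: real"
  let ?\<mu> = "real D * real d / real (card Y)"
  have finB: "finite ?B" by (rule finite_biregular_rows[OF fin])
  have finr: "finite (g y)" if "g \<in> ?B" "y \<in> Y" for g y
    using biregular_rowsD(1)[OF that] fin finite_subset by blast
  have cardr: "card (g y) = D" if "g \<in> ?B" "y \<in> Y" for g y
    using biregular_rowsD(2)[OF that] .
  have sym_le: "card (sym_diff (g v) (g a) \<inter> g x) \<le> card (g v \<inter> g x) + card (g a \<inter> g x)"
    if "g \<in> ?B" for g
  proof -
    have "card (sym_diff (g v) (g a) \<inter> g x) \<le> card (g v \<inter> g x \<union> g a \<inter> g x)"
      using finr[OF that] Y by (intro card_mono) auto
    also have "\<dots> \<le> card (g v \<inter> g x) + card (g a \<inter> g x)" by (rule card_Un_le)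
    finally show ?thesis .
  qed
  have nY: "card Y > 0" using Y fin by (auto simp: card_gt_0_iff)
  have nZ: "card Z > 0" using Z fin by (auto simp: card_gt_0_iff)
  have tail: "(3 / 2 :: real) powr (- l) * exp ((3 / 2 - 1) * c * ?\<mu>) \<le> exp (- (l / 15))" if "c \<le> 2" for c
  proof -
    have "(3 / 2 :: real) powr (- l) * exp ((3 / 2 - 1) * c * ?\<mu>) = exp (c / 2 * ?\<mu> - l * ln (3 / 2))"
      by (simp add: powr_def exp_add[symmetric])
    also have "\<dots> \<le> exp (- (l / 15))"
    proof -
      have "c / 2 * ?\<mu> \<le> 1 * ?\<mu>" using that by (intro mult_right_mono) auto
      moreover have "l * (2 / 5) \<le> l * ln (3 / 2)"
        using ln_three_halves_ge l by (intro mult_left_mono)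
      ultimately show ?thesis using mean by simp
    qed
    finally show ?thesis .
  qed
  show ?thesis
  proof (cases "10 * l \<le> real D")
    case True
    let ?E1 = "{g\<in>?B. l \<le> real (\<Sum>y\<in>{v, a}. card (g y \<inter> g x))}"
    let ?E2 = "{g\<in>?B. l \<le> real (\<Sum>y\<in>{v}. card (g y \<inter> g a))}"
    let ?E3 = "{g\<in>?B. card (g a \<inter> g x) < l \<and> g v \<inter> g a \<inter> g x \<noteq> {}}"
    have "?bad \<subseteq> ?E1 \<union> ?E2 \<union> ?E3"
    proof (rule subsetI, rule ccontr)
      fix g assume g: "g \<in> ?bad" "g \<notin> ?E1 \<union> ?E2 \<union> ?E3"
      then have gB: "g \<in> ?B" by simp
      have 1: "real (card (g v \<inter> g x)) + real (card (g a \<inter> g x)) < l"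
        and 2: "real (card (g v \<inter> g a)) < l" and 3: "g v \<inter> g a \<inter> g x = {}"
        using g ne by auto
      have s: "real (card (sym_diff (g v) (g a) \<inter> g x)) < l"
        using sym_le[OF gB] 1 by linarith
      have "card (g v - g a) = D - card (g v \<inter> g a)"
        using finr[OF gB] Y cardr[OF gB] by (simp add: card_Diff_subset_Int)
      then have "real D - l \<le> real (card (g v - g a))"
        using 2 by linarith
      then have "3 * card (sym_diff (g v) (g a) \<inter> g x) \<le> card (g v - g a)"
        using s True by linarith
      moreover have "?q \<le> (2 / 5) ^ card (sym_diff (g v) (g a) \<inter> g x)"
        using s powr_mono'[of "real (card (sym_diff (g v) (g a) \<inter> g x))" l "2 / 5 :: real"]
        by (simp add: powr_realpow)
      ultimately have "likely_disjoint ?q (g v) (g a) (g x)"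
        using finr[OF gB] Y cardr[OF gB] 3 by (intro likely_disjointI) auto
      then show False using g by simp
    qed
    then have "card ?bad \<le> card (?E1 \<union> ?E2 \<union> ?E3)"
      using finB by (intro card_mono) auto
    also have "\<dots> \<le> card ?E1 + card ?E2 + card ?E3"
      using card_Un_le[of "?E1 \<union> ?E2" ?E3] card_Un_le[of ?E1 ?E2] by linarith
    finally have "real (card ?bad) \<le> real (card ?E1) + real (card ?E2) + real (card ?E3)"
      by linarith
    also have "real (card ?E1) \<le> exp (- (l / 15)) * card ?B"
    proof -
      have "real (card ?E1) \<le> (3 / 2) powr (- l) * exp ((3 / 2 - 1) * real (card {v, a}) * ?\<mu>) * card ?B"
        by (rule card_common_tail_le[OF fin Y(3)]) (use Y ne d in auto)
      also have "\<dots> \<le> exp (- (l / 15)) * card ?B"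
        by (intro mult_right_mono tail) (use ne in auto)
      finally show ?thesis .
    qed
    also have "real (card ?E2) \<le> exp (- (l / 15)) * card ?B"
    proof -
      have "real (card ?E2) \<le> (3 / 2) powr (- l) * exp ((3 / 2 - 1) * real (card {v}) * ?\<mu>) * card ?B"
        by (rule card_common_tail_le[OF fin Y(2)]) (use Y ne d in auto)
      also have "\<dots> \<le> exp (- (l / 15)) * card ?B"
        by (intro mult_right_mono tail) (use ne in auto)
      finally show ?thesis .
    qed
    also have "real (card ?E3) \<le> 3 * (l * (real d / real (card Y))) * card ?B"
      by (rule card_triple_common_le[OF fin Y ne d l])
    finally have "real (card ?bad) \<le> (2 * exp (- (l / 15)) + 3 * (l * (real d / real (card Y)))) * card ?B"
      by (simp add: algebra_simps)
    also have "\<dots> \<le> (2 * exp (- (l / 15)) + 3 * (l * (real d / real (card Y))) + 600 * l\<^sup>2 / real (card Z)) * card ?B"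
      by (intro mult_right_mono) auto
    finally show ?thesis .
  next
    case False
    have "?bad \<subseteq> {g\<in>?B. 1 \<le> real (\<Sum>y\<in>{v, a}. card (g y \<inter> g x))}"
    proof (rule subsetI, rule ccontr)
      fix g assume g: "g \<in> ?bad" "g \<notin> {g\<in>?B. 1 \<le> real (\<Sum>y\<in>{v, a}. card (g y \<inter> g x))}"
      then have gB: "g \<in> ?B" by simp
      have "card (g v \<inter> g x) = 0" "card (g a \<inter> g x) = 0"
        using g ne by auto
      then have 0: "g v \<inter> g x = {}" "g a \<inter> g x = {}"
        using finr[OF gB] Y by auto
      then have 1: "sym_diff (g v) (g a) \<inter> g x = {}" by auto
      have "?q \<le> 1" using l powr_mono'[of 0 l "2 / 5 :: real"] by simp
      then have "likely_disjoint ?q (g v) (g a) (g x)"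
        using finr[OF gB] Y cardr[OF gB] 0 by (intro likely_disjointI) (auto simp: 1)
      then show False using g by simp
    qed
    then have "real (card ?bad) \<le> real (card {g\<in>?B. 1 \<le> real (\<Sum>y\<in>{v, a}. card (g y \<inter> g x))})"
      using finB by (auto intro!: card_mono)
    also have "\<dots> \<le> 3 * (2 * ?\<mu>) * card ?B"
    proof (rule markov_from_tail)
      fix \<theta> :: real assume \<theta>: "1 \<le> \<theta>"
      have "real (card {g\<in>?B. 1 \<le> real (\<Sum>y\<in>{v, a}. card (g y \<inter> g x))}) \<le>
          \<theta> powr (- 1) * exp ((\<theta> - 1) * real (card {v, a}) * ?\<mu>) * card ?B"
        by (rule card_common_tail_le[OF fin Y(3)]) (use Y ne d \<theta> in auto)
      moreover have "(\<theta> - 1) * real (card {v, a}) * ?\<mu> = (\<theta> - 1) * (2 * ?\<mu>)"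
        using ne by simp
      ultimately show "real (card {g\<in>?B. 1 \<le> real (\<Sum>y\<in>{v, a}. card (g y \<inter> g x))}) \<le>
          \<theta> powr (- 1) * exp ((\<theta> - 1) * (2 * ?\<mu>)) * card ?B"
        by (simp only:)
    next
      show "real (card {g\<in>?B. 1 \<le> real (\<Sum>y\<in>{v, a}. card (g y \<inter> g x))}) \<le> real (card ?B)"
        using finB by (auto intro: card_mono)
    qed auto
    \<comment> \<open>Edge counting rewrites the mean as \<open>D * D / card Z\<close>; with
      \<open>D < 10 * l\<close> the constant is \<open>3 * 2 * 10 * 10\<close>.\<close>
    also have "3 * (2 * ?\<mu>) \<le> 600 * l\<^sup>2 / real (card Z)"
    proof -
      have "real (card Y) * real D = real (card Z) * real d"
        using edges by (metis of_nat_mult)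
      then have "?\<mu> = real D * real D / real (card Z)"
        using nY nZ by (simp add: field_simps)
      also have "\<dots> \<le> (10 * l) * (10 * l) / real (card Z)"
        using False nZ by (intro divide_right_mono mult_mono) auto
      finally show ?thesis by (simp add: power2_eq_square)
    qed
    finally have "real (card ?bad) \<le> 600 * l\<^sup>2 / real (card Z) * card ?B"
      by (simp add: mult_right_mono)
    also have "\<dots> \<le> (2 * exp (- (l / 15)) + 3 * (l * (real d / real (card Y))) + 600 * l\<^sup>2 / real (card Z)) * card ?B"
      using l by (intro mult_right_mono) auto
    finally show ?thesis .
  qed
qed

text \<open>A hybrid argument: the indicators that \<open>v j\<close> and \<open>x j\<close> meet
  are replaced one at a time by their conditional bounds. Resplitting \<open>v t\<close> with
  \<open>a t\<close> changes no other factor, as these two vertices occur in no other triple; this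
  is what stands in for independence.\<close>

lemma card_all_meet_le_sum:
  fixes Y :: "'a set" and Z :: "'b set" and v a x :: "nat \<Rightarrow> 'a" and q :: real
  assumes fin: "finite Y" "finite Z"
    and Y: "\<And>j. j < T \<Longrightarrow> v j \<in> Y \<and> a j \<in> Y \<and> x j \<in> Y"
    and ne: "\<And>j. j < T \<Longrightarrow> v j \<noteq> a j \<and> v j \<noteq> x j \<and> a j \<noteq> x j"
    and disj: "\<And>i j. i < T \<Longrightarrow> j < T \<Longrightarrow> i \<noteq> j \<Longrightarrow> {v i, a i} \<inter> {v j, a j, x j} = {}"
    and q: "q \<le> 1"
  shows "card {g\<in>biregular_rows Y Z D d. \<forall>j<T. g (v j) \<inter> g (x j) \<noteq> {}} \<le>
    (\<Sum>g\<in>biregular_rows Y Z D d. \<Prod>j<T. if likely_disjoint q (g (v j)) (g (a j)) (g (x j)) then 1 - q else 1)"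
proof -
  let ?B = "biregular_rows Y Z D d"
  have finB: "finite ?B" by (rule finite_biregular_rows[OF fin])
  define meet where "meet j g = (of_bool (g (v j) \<inter> g (x j) \<noteq> {}) :: real)" for j and g :: "'a \<Rightarrow> 'b set"
  define bound where "bound j g = (if likely_disjoint q (g (v j)) (g (a j)) (g (x j)) then 1 - q else 1)"
    for j and g :: "'a \<Rightarrow> 'b set"
  define mix where "mix t g = (\<Prod>j<T. if j < t then bound j g else meet j g)" for t g
  have step: "sum (mix t) ?B \<le> sum (mix (Suc t)) ?B" if t: "t < T" for t
  proof (rule sum_resplit_mono[OF fin])
    show "v t \<in> Y" "a t \<in> Y" "v t \<noteq> a t" using Y ne t by auto
    fix g assume g: "g \<in> ?B"
    let ?S = "sym_diff (g (v t)) (g (a t))" and ?C = "g (v t) \<inter> g (a t)"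
    let ?r = "resplit g (v t) (a t)"
    define K where "K = (\<Prod>j\<in>{..<T} - {t}. if j < t then bound j g else meet j g)"
    have K0: "0 \<le> K" unfolding K_def using q by (intro prod_nonneg) (auto simp: bound_def meet_def)
    have finS: "finite (halves ?S)"
      using biregular_rowsD(1)[OF g] Y[OF t] fin by (intro finite_halves) (auto intro: finite_subset)
    have fixed: "?r R (v j) = g (v j) \<and> ?r R (a j) = g (a j) \<and> ?r R (x j) = g (x j)"
      if "j < T" "j \<noteq> t" for j R
      using disj[OF t that(1)] that(2) by (auto simp: resplit_def)
    have others: "(\<Prod>j\<in>{..<T} - {t}. if j < t' then bound j (?r R) else meet j (?r R)) = K"
      if "t' \<in> {t, Suc t}" for t' R
      unfolding K_def by (rule prod.cong) (use fixed that in \<open>auto simp: bound_def meet_def\<close>)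
    have split: "mix t' (?r R) = (if t < t' then bound t (?r R) else meet t (?r R)) * K"
      if "t' \<in> {t, Suc t}" for t' R
    proof -
      have "mix t' (?r R) = (if t < t' then bound t (?r R) else meet t (?r R)) *
          (\<Prod>j\<in>{..<T} - {t}. if j < t' then bound j (?r R) else meet j (?r R))"
        unfolding mix_def by (rule prod.remove) (use t in auto)
      then show ?thesis unfolding others[OF that] .
    qed
    have r: "?r R (v t) = ?C \<union> R" "?r R (a t) = ?C \<union> (?S - R)" "?r R (x t) = g (x t)" for R
      using ne[OF t] by (auto simp: resplit_def)
    \<comment> \<open>The resplit keeps the common part, the symmetric difference and the row of
      \<open>x t\<close>, so the new factor is constant on the fibre and can be compared with the
      average of the old one.\<close>
    have bound_r: "bound t (?r R) = bound t g" if "R \<in> halves ?S" for R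
    proof -
      have "R \<subseteq> ?S" using that by (simp add: halves_def)
      then have "sym_diff (?C \<union> R) (?C \<union> (?S - R)) = ?S" "(?C \<union> R) \<inter> (?C \<union> (?S - R)) = ?C"
        by blast+
      then show ?thesis unfolding bound_def r likely_disjoint_def by simp
    qed
    have "(\<Sum>R\<in>halves ?S. meet t (?r R)) \<le> (\<Sum>R\<in>halves ?S. bound t (?r R))"
    proof -
      let ?dis = "{R\<in>halves ?S. (?C \<union> R) \<inter> g (x t) = {}}"
      have "(\<Sum>R\<in>halves ?S. meet t (?r R)) = (\<Sum>R\<in>halves ?S. 1 - of_bool ((?C \<union> R) \<inter> g (x t) = {}))"
        unfolding meet_def r by (rule sum.cong) auto
      also have "\<dots> = real (card (halves ?S)) - real (card ?dis)"
        using finS by (simp add: sum_subtractf Int_def)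
      also have "\<dots> \<le> real (card (halves ?S)) * bound t g"
        by (auto simp: bound_def likely_disjoint_def algebra_simps)
      also have "\<dots> = (\<Sum>R\<in>halves ?S. bound t (?r R))"
        using bound_r by simp
      finally show ?thesis .
    qed
    then have "(\<Sum>R\<in>halves ?S. meet t (?r R)) * K \<le> (\<Sum>R\<in>halves ?S. bound t (?r R)) * K"
      using K0 by (rule mult_right_mono)
    then show "(\<Sum>R\<in>halves ?S. mix t (?r R)) \<le> (\<Sum>R\<in>halves ?S. mix (Suc t) (?r R))"
      by (simp add: split sum_distrib_right)
  qed
  have "sum (mix 0) ?B \<le> sum (mix t) ?B" if "t \<le> T" for t
    using that
  proof (induction t)
    case (Suc t)
    then show ?case using step[of t] by simp
  qed simp
  from this[of T] have "sum (mix 0) ?B \<le> sum (mix T) ?B" by simp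
  moreover have "sum (mix 0) ?B = card {g\<in>?B. \<forall>j<T. g (v j) \<inter> g (x j) \<noteq> {}}"
  proof -
    have "mix 0 g = of_bool (\<forall>j<T. g (v j) \<inter> g (x j) \<noteq> {})" for g
      by (auto simp: mix_def meet_def)
    then show ?thesis using finB by (simp add: Int_def)
  qed
  moreover have "sum (mix T) ?B = (\<Sum>g\<in>?B. \<Prod>j<T. bound j g)"
    by (simp add: mix_def)
  ultimately show ?thesis by (simp add: bound_def)
qed

text \<open>If at least half of the triples are likely to split disjointly, the product is at most
  \<open>exp (- q * T / 2)\<close>. Otherwise at least \<open>T / 2\<close> triples fail, which by
  Markov's inequality has probability at most \<open>2 * \<delta>\<close>.\<close>

lemma card_all_meet_le:
  fixes Y :: "'a set" and Z :: "'b set" and v a x :: "nat \<Rightarrow> 'a" and q \<delta> :: real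
  assumes fin: "finite Y" "finite Z" and T: "0 < T"
    and Y: "\<And>j. j < T \<Longrightarrow> v j \<in> Y \<and> a j \<in> Y \<and> x j \<in> Y"
    and ne: "\<And>j. j < T \<Longrightarrow> v j \<noteq> a j \<and> v j \<noteq> x j \<and> a j \<noteq> x j"
    and disj: "\<And>i j. i < T \<Longrightarrow> j < T \<Longrightarrow> i \<noteq> j \<Longrightarrow> {v i, a i} \<inter> {v j, a j, x j} = {}"
    and q: "0 \<le> q" "q \<le> 1"
    and \<delta>: "\<And>j. j < T \<Longrightarrow> card {g\<in>biregular_rows Y Z D d. \<not> likely_disjoint q (g (v j)) (g (a j)) (g (x j))} \<le>
      \<delta> * card (biregular_rows Y Z D d)"
  shows "card {g\<in>biregular_rows Y Z D d. \<forall>j<T. g (v j) \<inter> g (x j) \<noteq> {}} \<le>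
    (2 * \<delta> + exp (- (q * real T / 2))) * card (biregular_rows Y Z D d)"
proof -
  let ?B = "biregular_rows Y Z D d"
  let ?L = "\<lambda>g j. likely_disjoint q (g (v j)) (g (a j)) (g (x j))"
  have finB: "finite ?B" by (rule finite_biregular_rows[OF fin])
  have pointwise: "(\<Prod>j<T. if ?L g j then 1 - q else 1) \<le>
      exp (- (q * real T / 2)) + 2 / real T * (\<Sum>j<T. of_bool (\<not> ?L g j))" for g
  proof -
    let ?G = "{j. j < T \<and> ?L g j}"
    have "real (card ?G) = (\<Sum>j<T. of_bool (?L g j))"
      by (simp add: Int_def lessThan_def)
    moreover have "(\<Sum>j<T. of_bool (\<not> ?L g j)) + (\<Sum>j<T. of_bool (?L g j)) = (\<Sum>j<T. 1 :: real)"
      unfolding sum.distrib[symmetric] by (rule sum.cong) auto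
    ultimately have cG: "(\<Sum>j<T. of_bool (\<not> ?L g j)) = real T - real (card ?G)" by simp
    have "(\<Prod>j<T. if ?L g j then 1 - q else 1) = (1 - q) ^ card ?G"
      by (simp add: prod.If_cases Int_def lessThan_def)
    also have "\<dots> \<le> exp (- q) ^ card ?G"
      using q exp_ge_add_one_self[of "- q"] by (intro power_mono) auto
    also have "\<dots> = exp (- (q * real (card ?G)))"
      by (simp add: exp_of_nat_mult[symmetric] mult.commute)
    finally have 1: "(\<Prod>j<T. if ?L g j then 1 - q else 1) \<le> exp (- (q * real (card ?G)))" .
    show ?thesis
    proof (cases "real T / 2 \<le> real (card ?G)")
      case True
      then have "q * (real T / 2) \<le> q * real (card ?G)" using q by (intro mult_left_mono)
      then have "exp (- (q * real (card ?G))) \<le> exp (- (q * real T / 2))" by simp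
      moreover have "0 \<le> 2 / real T * (\<Sum>j<T. of_bool (\<not> ?L g j))"
        by (intro mult_nonneg_nonneg sum_nonneg) auto
      ultimately show ?thesis using 1 by linarith
    next
      case False
      then have "1 \<le> 2 / real T * (\<Sum>j<T. of_bool (\<not> ?L g j))"
        unfolding cG using T by (simp add: field_simps)
      moreover have "exp (- (q * real (card ?G))) \<le> 1" using q by simp
      moreover have "0 \<le> exp (- (q * real T / 2))" by simp
      ultimately show ?thesis using 1 by linarith
    qed
  qed
  have "real (card {g\<in>?B. \<forall>j<T. g (v j) \<inter> g (x j) \<noteq> {}}) \<le> (\<Sum>g\<in>?B. \<Prod>j<T. if ?L g j then 1 - q else 1)"
    by (rule card_all_meet_le_sum[OF fin Y ne disj q(2)])
  also have "\<dots> \<le> (\<Sum>g\<in>?B. exp (- (q * real T / 2)) + 2 / real T * (\<Sum>j<T. of_bool (\<not> ?L g j)))"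
    by (intro sum_mono pointwise)
  also have "\<dots> = exp (- (q * real T / 2)) * card ?B + 2 / real T * (\<Sum>g\<in>?B. \<Sum>j<T. of_bool (\<not> ?L g j))"
    by (simp add: sum.distrib sum_distrib_left)
  also have "(\<Sum>g\<in>?B. \<Sum>j<T. of_bool (\<not> ?L g j)) = (\<Sum>j<T. real (card {g\<in>?B. \<not> ?L g j}))"
    using finB by (subst sum.swap) (simp add: Int_def)
  also have "2 / real T * (\<Sum>j<T. real (card {g\<in>?B. \<not> ?L g j})) \<le> 2 / real T * (\<Sum>j<T. \<delta> * card ?B)"
    using \<delta> by (intro mult_left_mono sum_mono) auto
  also have "\<dots> = 2 * \<delta> * card ?B" using T by simp
  finally show ?thesis by (simp add: algebra_simps)
qed

section \<open>Families of biregular graphs\<close>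

lemma inj_on_add_mod: "D \<le> N \<Longrightarrow> inj_on (\<lambda>t. (a + t) mod N) {..<D::nat}"
proof (rule linorder_inj_onI)
  fix s t assume st: "D \<le> N" "s < t" "t \<in> {..<D}"
  then have "\<not> N dvd (a + t) - (a + s)" by (auto dest!: dvd_imp_le)
  then show "(a + s) mod N \<noteq> (a + t) mod N"
    using mod_eq_dvd_iff_nat[of "a + s" "a + t" N] st by auto
qed auto

text \<open>The \<open>n D = N d\<close> edge slots are dealt out cyclically to the columns.\<close>

lemma card_cyclic_column:
  fixes n D N d c :: nat
  assumes edges: "n * D = N * d" and DN: "D \<le> N" and c: "c < N"
  shows "card {i\<in>{..<n}. \<exists>t<D. (i * D + t) mod N = c} = d"
proof (cases "D = 0")
  case True
  then show ?thesis using edges c by simp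
next
  case False
  \<comment> \<open>Slot \<open>c + s * N\<close> is number \<open>s\<close> among those dealt to
    column \<open>c\<close>; dividing by \<open>D\<close> yields the row that owns it.\<close>
  let ?f = "\<lambda>s. (c + s * N) div D"
  have "{i\<in>{..<n}. \<exists>t<D. (i * D + t) mod N = c} = ?f ` {..<d}"
  proof (intro equalityI subsetI)
    fix i assume "i \<in> {i\<in>{..<n}. \<exists>t<D. (i * D + t) mod N = c}"
    then obtain t where t: "i < n" "t < D" "(i * D + t) mod N = c" by auto
    let ?s = "(i * D + t) div N"
    have "i * D + t < Suc i * D" using t by simp
    also have "\<dots> \<le> n * D" using t by (intro mult_le_mono1) auto
    finally have "?s < d" using edges c by (simp add: less_mult_imp_div_less mult.commute)
    moreover have "c + ?s * N = i * D + t"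
      using t(3) by (metis mod_div_mult_eq)
    then have "?f ?s = i" using t by simp
    ultimately show "i \<in> ?f ` {..<d}" by force
  next
    fix i assume "i \<in> ?f ` {..<d}"
    then obtain s where s: "s < d" "i = (c + s * N) div D" by auto
    have "c + s * N < Suc s * N" using c by simp
    also have "\<dots> \<le> d * N" using s by (intro mult_le_mono1) auto
    also have "\<dots> = n * D" using edges by (simp add: mult.commute)
    finally have "i < n" using s by (simp add: less_mult_imp_div_less)
    moreover have "i * D + (c + s * N) mod D = c + s * N"
      using s by (metis div_mult_mod_eq)
    ultimately show "i \<in> {i\<in>{..<n}. \<exists>t<D. (i * D + t) mod N = c}"
      using False c by (auto intro!: exI[of _ "(c + s * N) mod D"])
  qed
  moreover have "inj_on ?f {..<d}"
  proof (rule linorder_inj_onI)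
    fix s s' :: nat assume "s < s'"
    \<comment> \<open>Slots of one column are at least \<open>N \<ge> D\<close> apart and therefore
      belong to different rows.\<close>
    then have "Suc s * N \<le> s' * N" by (intro mult_le_mono1) simp
    then have "c + s * N + D \<le> c + s' * N" using DN by simp
    then have "(c + s * N + D) div D \<le> ?f s'" by (rule div_le_mono)
    then show "?f s \<noteq> ?f s'" using False by simp
  qed auto
  ultimately show ?thesis by (simp add: card_image)
qed

text \<open>Without a member of the family \<open>pmf_of_set\<close> would not denote the uniform
  distribution.\<close>

lemma biregular_rows_nonempty:
  fixes Y :: "'a set" and Z :: "'b set"
  assumes fin: "finite Y" "finite Z" and edges: "card Y * D = card Z * d" and D: "D \<le> card Z"
  shows "biregular_rows Y Z D d \<noteq> {}"
proof -
  let ?n = "card Y" and ?N = "card Z"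
  obtain e where e: "bij_betw e Y {..<?n}"
    using ex_bij_betw_finite_nat[OF fin(1)] by (auto simp: atLeast0LessThan)
  obtain f where f: "bij_betw f {..<?N} Z"
    using ex_bij_betw_nat_finite[OF fin(2)] by (auto simp: atLeast0LessThan)
  define slot where "slot i t = (i * D + t) mod ?N" for i t
  define g where "g = (\<lambda>y\<in>Y. f ` slot (e y) ` {..<D})"
  have slot: "slot i t < ?N" if "t < D" for i t
    unfolding slot_def using that D by (intro mod_less_divisor) simp
  have injf: "inj_on f {..<?N}" and imf: "f ` {..<?N} = Z"
    using f by (auto simp: bij_betw_def)
  have "g \<in> Y \<rightarrow>\<^sub>E Pow Z"
    using slot imf by (auto simp: g_def)
  moreover have "card (g y) = D" if "y \<in> Y" for y
  proof -
    have "inj_on (slot (e y)) {..<D}" unfolding slot_def by (rule inj_on_add_mod[OF D])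
    moreover have "inj_on f (slot (e y) ` {..<D})"
      by (rule inj_on_subset[OF injf]) (use slot in auto)
    ultimately show ?thesis using that by (simp add: g_def card_image)
  qed
  moreover have "card {y\<in>Y. z \<in> g y} = d" if z: "z \<in> Z" for z
  proof -
    obtain c where c: "c < ?N" "z = f c" using z imf by auto
    have "{y\<in>Y. z \<in> g y} = {y\<in>Y. \<exists>t<D. slot (e y) t = c}"
      using c slot injf by (auto simp: g_def inj_on_eq_iff)
    also have "card \<dots> = card {i\<in>{..<?n}. \<exists>t<D. slot i t = c}"
    proof (rule bij_betw_same_card[of e])
      show "bij_betw e {y\<in>Y. \<exists>t<D. slot (e y) t = c} {i\<in>{..<?n}. \<exists>t<D. slot i t = c}"
      proof (rule bij_betw_subset[OF e])
        have "e ` Y = {..<?n}" using e by (simp add: bij_betw_def)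
        moreover have "e ` {y\<in>Y. P (e y)} = {i\<in>e ` Y. P i}" for P by auto
        ultimately show "e ` {y\<in>Y. \<exists>t<D. slot (e y) t = c} = {i\<in>{..<?n}. \<exists>t<D. slot i t = c}"
          by simp
      qed auto
    qed
    also have "\<dots> = d"
      unfolding slot_def by (rule card_cyclic_column[OF edges D c(1)])
    finally show ?thesis .
  qed
  ultimately have "g \<in> biregular_rows Y Z D d" by (auto simp: biregular_rows_def)
  then show ?thesis by blast
qed

lemma bij_betw_rows:
  assumes D: "rat_of_nat D = k * rat_of_nat d"
  shows "bij_betw (\<lambda>E. \<lambda>y\<in>Y. E `` {y}) (biregular_digraphs k d Y Z) (biregular_rows Y Z D d)"
proof (rule bij_betw_byWitness[where f' = "\<lambda>g. Sigma Y g"])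
  show "\<forall>E\<in>biregular_digraphs k d Y Z. Sigma Y (\<lambda>y\<in>Y. E `` {y}) = E"
    by (auto simp: biregular_digraphs_def)
  show "\<forall>g\<in>biregular_rows Y Z D d. (\<lambda>y\<in>Y. Sigma Y g `` {y}) = g"
    by (auto simp: biregular_rows_def PiE_def extensional_def fun_eq_iff)
  show "(\<lambda>E. \<lambda>y\<in>Y. E `` {y}) ` biregular_digraphs k d Y Z \<subseteq> biregular_rows Y Z D d"
  proof
    fix g assume "g \<in> (\<lambda>E. \<lambda>y\<in>Y. E `` {y}) ` biregular_digraphs k d Y Z"
    then obtain E where E: "E \<in> biregular_digraphs k d Y Z" and g: "g = (\<lambda>y\<in>Y. E `` {y})" by auto
    have sub: "E \<subseteq> Y \<times> Z" using E by (simp add: biregular_digraphs_def)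
    have "card {y\<in>Y. z \<in> g y} = d" if "z \<in> Z" for z
    proof -
      have "{y\<in>Y. z \<in> g y} = E\<inverse> `` {z}" using sub by (auto simp: g)
      then show ?thesis using E that by (auto simp: biregular_digraphs_def)
    qed
    moreover have "card (g y) = D" if "y \<in> Y" for y
      using E that D by (auto simp: biregular_digraphs_def g dest!: bspec)
    ultimately show "g \<in> biregular_rows Y Z D d"
      using sub by (auto simp: biregular_rows_def g)
  qed
  show "Sigma Y ` biregular_rows Y Z D d \<subseteq> biregular_digraphs k d Y Z"
  proof
    fix E assume "E \<in> Sigma Y ` biregular_rows Y Z D d"
    then obtain g where g: "g \<in> biregular_rows Y Z D d" and E: "E = Sigma Y g" by auto
    have sub: "E \<subseteq> Y \<times> Z" using biregular_rowsD(1)[OF g] by (auto simp: E)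
    have "E `` {y} = g y" if "y \<in> Y" for y using that by (auto simp: E)
    moreover have "E\<inverse> `` {z} = {y\<in>Y. z \<in> g y}" for z by (auto simp: E)
    ultimately show "E \<in> biregular_digraphs k d Y Z"
      using sub biregular_rowsD(2,3)[OF g] D by (auto simp: biregular_digraphs_def)
  qed
qed

text \<open>Reading the graph by columns exchanges \<open>D\<close> and \<open>d\<close>. This is
  how the downward condition becomes an instance of the counting done for rows.\<close>

lemma bij_betw_columns:
  assumes D: "rat_of_nat D = k * rat_of_nat d"
  shows "bij_betw (\<lambda>E. \<lambda>z\<in>Z. E\<inverse> `` {z}) (biregular_digraphs k d Y Z) (biregular_rows Z Y d D)"
proof (rule bij_betw_byWitness[where f' = "\<lambda>g. (Sigma Z g)\<inverse>"])
  show "\<forall>E\<in>biregular_digraphs k d Y Z. (Sigma Z (\<lambda>z\<in>Z. E\<inverse> `` {z}))\<inverse> = E"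
    by (auto simp: biregular_digraphs_def)
  show "\<forall>g\<in>biregular_rows Z Y d D. (\<lambda>z\<in>Z. ((Sigma Z g)\<inverse>)\<inverse> `` {z}) = g"
    by (auto simp: biregular_rows_def PiE_def extensional_def fun_eq_iff)
  show "(\<lambda>E. \<lambda>z\<in>Z. E\<inverse> `` {z}) ` biregular_digraphs k d Y Z \<subseteq> biregular_rows Z Y d D"
  proof
    fix g assume "g \<in> (\<lambda>E. \<lambda>z\<in>Z. E\<inverse> `` {z}) ` biregular_digraphs k d Y Z"
    then obtain E where E: "E \<in> biregular_digraphs k d Y Z" and g: "g = (\<lambda>z\<in>Z. E\<inverse> `` {z})" by auto
    have sub: "E \<subseteq> Y \<times> Z" using E by (simp add: biregular_digraphs_def)
    have "card {z\<in>Z. y \<in> g z} = D" if "y \<in> Y" for y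
    proof -
      have "{z\<in>Z. y \<in> g z} = E `` {y}" using sub by (auto simp: g)
      then show ?thesis using E that D by (auto simp: biregular_digraphs_def dest!: bspec)
    qed
    moreover have "card (g z) = d" if "z \<in> Z" for z
      using E that by (auto simp: biregular_digraphs_def g)
    ultimately show "g \<in> biregular_rows Z Y d D"
      using sub by (auto simp: biregular_rows_def g)
  qed
  show "(\<lambda>g. (Sigma Z g)\<inverse>) ` biregular_rows Z Y d D \<subseteq> biregular_digraphs k d Y Z"
  proof
    fix E assume "E \<in> (\<lambda>g. (Sigma Z g)\<inverse>) ` biregular_rows Z Y d D"
    then obtain g where g: "g \<in> biregular_rows Z Y d D" and E: "E = (Sigma Z g)\<inverse>" by auto
    have sub: "E \<subseteq> Y \<times> Z" using biregular_rowsD(1)[OF g] by (auto simp: E)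
    have "E\<inverse> `` {z} = g z" if "z \<in> Z" for z using that by (auto simp: E)
    moreover have "E `` {y} = {z\<in>Z. y \<in> g z}" for y by (auto simp: E)
    ultimately show "E \<in> biregular_digraphs k d Y Z"
      using sub biregular_rowsD(2,3)[OF g] D by (auto simp: biregular_digraphs_def)
  qed
qed

section \<open>From counting to probabilities, and disjoint pairs with a common in-neighbour\<close>

lemma prob_pmf_of_set_le_bij:
  fixes c :: real
  assumes bij: "bij_betw \<phi> \<E> \<F>" and fin: "finite \<F>" "\<F> \<noteq> {}"
    and imp: "\<And>E. E \<in> \<E> \<Longrightarrow> Q E \<Longrightarrow> P (\<phi> E)"
    and le: "real (card {g\<in>\<F>. P g}) \<le> c * card \<F>"
  shows "measure_pmf.prob (pmf_of_set \<E>) {E. Q E} \<le> c"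
proof -
  have cE: "card \<E> = card \<F>" by (rule bij_betw_same_card[OF bij])
  have finE: "finite \<E>" "\<E> \<noteq> {}" using bij fin bij_betw_finite[OF bij] by (auto simp: bij_betw_def)
  have inj: "inj_on \<phi> \<E>" using bij by (simp add: bij_betw_def)
  have "card (\<E> \<inter> {E. Q E}) \<le> card {g\<in>\<F>. P g}"
  proof (rule card_inj_on_le[of \<phi>])
    show "inj_on \<phi> (\<E> \<inter> {E. Q E})" by (rule inj_on_subset[OF inj]) auto
    show "\<phi> ` (\<E> \<inter> {E. Q E}) \<subseteq> {g\<in>\<F>. P g}" using imp bij by (auto simp: bij_betw_def)
  qed (use fin in auto)
  then have "real (card (\<E> \<inter> {E. Q E})) \<le> c * card \<F>" using le by linarith
  moreover have "card \<F> > 0" using fin by (simp add: card_gt_0_iff)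
  ultimately show ?thesis using finE cE by (simp add: measure_pmf_of_set pos_divide_le_eq)
qed

text \<open>Fubini for one coordinate of the product: it suffices to bound the probability over
  \<open>p j\<close> for every choice of the others in their supports.\<close>

lemma prob_Pi_pmf_le:
  assumes fin: "finite I" and j: "j \<in> I" and c: "0 \<le> c"
    and le: "\<And>f. (\<And>i. i \<in> I \<Longrightarrow> i \<noteq> j \<Longrightarrow> f i \<in> set_pmf (p i)) \<Longrightarrow>
      measure_pmf.prob (p j) {e. P (f(j := e))} \<le> c"
  shows "measure_pmf.prob (Pi_pmf I dflt p) {f. P f} \<le> c"
proof -
  let ?I = "I - {j}"
  have I: "I = insert j ?I" using j by auto
  have "Pi_pmf I dflt p = do {y \<leftarrow> p j; f \<leftarrow> Pi_pmf ?I dflt p; return_pmf (f(j := y))}"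
    using fin by (subst I, subst Pi_pmf_insert') auto
  also have "\<dots> = do {f \<leftarrow> Pi_pmf ?I dflt p; y \<leftarrow> p j; return_pmf (f(j := y))}"
    by (rule bind_commute_pmf)
  also have "\<dots> = do {f \<leftarrow> Pi_pmf ?I dflt p; map_pmf (\<lambda>y. f(j := y)) (p j)}"
    by (simp add: map_pmf_def)
  finally have "emeasure (Pi_pmf I dflt p) {f. P f} =
      (\<integral>\<^sup>+f. emeasure (map_pmf (\<lambda>y. f(j := y)) (p j)) {f. P f} \<partial>Pi_pmf ?I dflt p)"
    by simp
  also have "\<dots> \<le> (\<integral>\<^sup>+f. ennreal c \<partial>Pi_pmf ?I dflt p)"
  proof (rule nn_integral_mono_AE, unfold AE_measure_pmf_iff, intro ballI)
    fix f assume "f \<in> set_pmf (Pi_pmf ?I dflt p)"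
    then have "f i \<in> set_pmf (p i)" if "i \<in> I" "i \<noteq> j" for i
      using fin that by (auto simp: set_Pi_pmf PiE_dflt_def)
    then have "measure_pmf.prob (p j) {e. P (f(j := e))} \<le> c" by (rule le)
    then show "emeasure (map_pmf (\<lambda>y. f(j := y)) (p j)) {f. P f} \<le> ennreal c"
      by (simp add: measure_pmf.emeasure_eq_measure vimage_def ennreal_leI)
  qed
  also have "\<dots> = ennreal c" by simp
  finally show ?thesis
    using c by (simp add: measure_pmf.emeasure_eq_measure)
qed

text \<open>Greedy choice. After \<open>t\<close> pairs more than half of \<open>Y\<close> is left,
  because \<open>4 * t + 4 \<le> card Y\<close>. The remaining set \<open>W\<close> receives at
  least \<open>2 * card W > card V\<close> edges, so some \<open>u\<close> has two out-neighbours in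
  it.\<close>

lemma exists_disjoint_pairs:
  assumes fin: "finite V" "finite Y" and VY: "card V \<le> card Y"
    and deg: "\<And>y. y \<in> Y \<Longrightarrow> 2 \<le> card {u\<in>V. (u, y) \<in> E}" and t: "4 * t \<le> card Y"
  shows "\<exists>v x. inj_on v {..<t} \<and> inj_on x {..<t} \<and> v ` {..<t} \<inter> x ` {..<t} = {} \<and>
    (\<forall>j<t. v j \<in> Y \<and> x j \<in> Y \<and> (\<exists>u\<in>V. (u, v j) \<in> E \<and> (u, x j) \<in> E))"
  using t
proof (induction t)
  case 0
  then show ?case by simp
next
  case (Suc t)
  then obtain v x where IH: "inj_on v {..<t}" "inj_on x {..<t}" "v ` {..<t} \<inter> x ` {..<t} = {}"
    "\<And>j. j < t \<Longrightarrow> v j \<in> Y \<and> x j \<in> Y \<and> (\<exists>u\<in>V. (u, v j) \<in> E \<and> (u, x j) \<in> E)"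
    by (metis (no_types, lifting) Suc_leD mult_Suc_right add_leD2)
  define W where "W = Y - (v ` {..<t} \<union> x ` {..<t})"
  have sub: "v ` {..<t} \<union> x ` {..<t} \<subseteq> Y" using IH(4) by auto
  have finW: "finite W" using fin by (simp add: W_def)
  have "card (v ` {..<t} \<union> x ` {..<t}) \<le> t + t"
    by (rule order_trans[OF card_Un_le add_mono]) (use card_image_le[of "{..<t}"] in auto)
  then have "card W \<ge> card Y - 2 * t"
    unfolding W_def using sub by (subst card_Diff_subset) auto
  moreover have "4 * t + 4 \<le> card Y" using Suc.prems by simp
  ultimately have W: "card V < 2 * card W" using VY by linarith
  have "\<exists>u\<in>V. 2 \<le> card {w\<in>W. (u, w) \<in> E}"
  proof (rule ccontr)
    assume "\<not> (\<exists>u\<in>V. 2 \<le> card {w\<in>W. (u, w) \<in> E})"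
    then have "card {w\<in>W. (u, w) \<in> E} \<le> 1" if "u \<in> V" for u using that by force
    then have "(\<Sum>u\<in>V. card {w\<in>W. (u, w) \<in> E}) \<le> (\<Sum>u\<in>V. 1)" by (rule sum_mono)
    moreover have "(\<Sum>u\<in>V. card {w\<in>W. (u, w) \<in> E}) = (\<Sum>w\<in>W. card {u\<in>V. (u, w) \<in> E})"
      using fin(1) finW by (rule sum_multicount_gen[of V W "\<lambda>u w. (u, w) \<in> E" "\<lambda>w. card {u\<in>V. (u, w) \<in> E}"]) auto
    moreover have "(\<Sum>w\<in>W. 2) \<le> (\<Sum>w\<in>W. card {u\<in>V. (u, w) \<in> E})"
      using deg by (intro sum_mono) (auto simp: W_def)
    ultimately show False using W by simp
  qed
  then obtain u where u: "u \<in> V" "2 \<le> card {w\<in>W. (u, w) \<in> E}" by auto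
  then obtain P where P: "P \<subseteq> {w\<in>W. (u, w) \<in> E}" "card P = 2"
    by (meson obtain_subset_with_card_n)
  then obtain w w' where "P = {w, w'}" "w \<noteq> w'" by (auto simp: card_2_iff)
  then have w: "w \<in> W" "w' \<in> W" "(u, w) \<in> E" "(u, w') \<in> E" "w \<noteq> w'"
    using P(1) by auto
  have eqs: "(v(t := w)) ` {..<t} = v ` {..<t}" "(x(t := w')) ` {..<t} = x ` {..<t}"
    by auto
  show ?case
  proof (rule exI[of _ "v(t := w)"], rule exI[of _ "x(t := w')"], intro conjI allI impI)
    show "inj_on (v(t := w)) {..<Suc t}" "inj_on (x(t := w')) {..<Suc t}"
      using IH(1,2) w unfolding lessThan_Suc by (auto simp: W_def inj_on_def)
    show "(v(t := w)) ` {..<Suc t} \<inter> (x(t := w')) ` {..<Suc t} = {}"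
      unfolding lessThan_Suc image_insert eqs using IH(3) w by (auto simp: W_def)
    fix j assume "j < Suc t"
    then show "(v(t := w)) j \<in> Y" "(x(t := w')) j \<in> Y"
      "\<exists>u\<in>V. (u, (v(t := w)) j) \<in> E \<and> (u, (x(t := w')) j) \<in> E"
      using IH(4)[of j] w u by (auto simp: W_def less_Suc_eq)
  qed
qed

section \<open>Layered digraphs\<close>

lemma perfect_matching_graph:
  assumes inj: "inj_on f A" and img: "f ` A = B" and disj: "A \<inter> B = {}" and E: "\<And>a. a \<in> A \<Longrightarrow> (a, f a) \<in> E"
  shows "perfect_matching E A B ((\<lambda>a. (a, f a)) ` A)"
  unfolding perfect_matching_def
proof (intro conjI)
  show "card A = card B" using inj img card_image by force
  show "(\<lambda>a. (a, f a)) ` A \<subseteq> E \<inter> (A \<times> B \<union> B \<times> A)" using img E by auto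
  show "pairwise (\<lambda>e f. {fst e, snd e} \<inter> {fst f, snd f} = {}) ((\<lambda>a. (a, f a)) ` A)"
    unfolding pairwise_def using inj img disj by (auto simp: inj_on_eq_iff)
  show "Field ((\<lambda>a. (a, f a)) ` A) = A \<union> B"
    unfolding Field_def using img by auto
qed

text \<open>Reversal is harmless because \<open>perfect_matching\<close> accepts edges in either
  direction between the two sides.\<close>

lemma perfect_matching_converse:
  assumes "perfect_matching (E\<inverse>) A B M"
  shows "perfect_matching E A B (M\<inverse>)"
proof -
  have "pairwise (\<lambda>e f. {fst e, snd e} \<inter> {fst f, snd f} = {}) (M\<inverse>)"
    unfolding pairwise_def
  proof (intro ballI impI)
    fix e f assume "e \<in> M\<inverse>" "f \<in> M\<inverse>" "e \<noteq> f"
    then have "prod.swap e \<in> M" "prod.swap f \<in> M" "prod.swap e \<noteq> prod.swap f"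
      by (auto simp: prod_eq_iff)
    then have "{fst (prod.swap e), snd (prod.swap e)} \<inter> {fst (prod.swap f), snd (prod.swap f)} = {}"
      using assms unfolding perfect_matching_def pairwise_def by blast
    then show "{fst e, snd e} \<inter> {fst f, snd f} = {}" by auto
  qed
  then show ?thesis
    using assms unfolding perfect_matching_def by auto
qed

locale layered_setup =
  fixes k :: rat and h m d D :: nat and X :: "nat \<Rightarrow> 'v set"
  assumes k: "1 \<le> k" and adm: "admissible k h m d X" and D: "rat_of_nat D = k * rat_of_nat d"
begin

abbreviation "\<kappa> \<equiv> real_of_rat k"

abbreviation "layer_graphs i \<equiv> biregular_digraphs k d (X (i - 1)) (X i)"

definition graph_family :: "(nat \<Rightarrow> ('v \<times> 'v) set) \<Rightarrow> bool" where
  "graph_family G \<longleftrightarrow> (\<forall>i\<in>{1..h}. G i \<in> layer_graphs i)"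

abbreviation union :: "(nat \<Rightarrow> ('v \<times> 'v) set) \<Rightarrow> ('v \<times> 'v) set" where
  "union G \<equiv> \<Union>i\<in>{1..h}. G i"

lemma d_bounds: "2 \<le> d" "d \<le> m"
  using adm by (auto simp: admissible_def)

lemma finite_layer: "i \<le> h \<Longrightarrow> finite (X i)"
  using adm by (auto simp: admissible_def)

lemma layer_unique: "i \<le> h \<Longrightarrow> j \<le> h \<Longrightarrow> x \<in> X i \<Longrightarrow> x \<in> X j \<Longrightarrow> i = j"
  using adm by (auto simp: admissible_def disjoint_family_on_def)

lemma layer_disjoint:
  assumes "A \<subseteq> X i" "B \<subseteq> X j" "i \<le> h" "j \<le> h" "i \<noteq> j"
  shows "A \<inter> B = {}"
proof (rule equals0I)
  fix x assume "x \<in> A \<inter> B"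
  then have "x \<in> X i" "x \<in> X j" using assms(1,2) by auto
  then have "i = j" by (rule layer_unique[OF assms(3,4)])
  then show False using assms(5) by simp
qed

lemma \<kappa>: "1 \<le> \<kappa>"
  using k by simp

lemma card_layer: "i \<le> h \<Longrightarrow> real (card (X i)) = \<kappa> ^ i * real m"
proof -
  assume "i \<le> h"
  then have "rat_of_nat (card (X i)) = k ^ i * rat_of_nat m"
    using adm by (simp add: admissible_def)
  then have "real_of_rat (rat_of_nat (card (X i))) = real_of_rat (k ^ i * rat_of_nat m)" by simp
  then show ?thesis by (simp add: of_rat_mult of_rat_power)
qed

lemma D_real: "real D = \<kappa> * real d"
proof -
  have "real_of_rat (rat_of_nat D) = real_of_rat (k * rat_of_nat d)" using D by simp
  then show ?thesis by (simp add: of_rat_mult)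
qed

lemma d_le_D: "d \<le> D"
proof -
  have "1 * real d \<le> \<kappa> * real d" using \<kappa> by (intro mult_right_mono) auto
  then show ?thesis using D_real by simp
qed

lemma D_le: "real D \<le> \<kappa> * real m"
  unfolding D_real using \<kappa> d_bounds by (intro mult_left_mono) auto

lemma layer_ge: "i \<le> h \<Longrightarrow> m \<le> card (X i)"
proof -
  assume i: "i \<le> h"
  have "1 * real m \<le> \<kappa> ^ i * real m" using \<kappa> by (intro mult_right_mono) auto
  then show ?thesis using card_layer[OF i] by simp
qed

lemma edge_count:
  assumes "1 \<le> i" "i \<le> h"
  shows "card (X (i - 1)) * D = card (X i) * d"
proof -
  have "\<kappa> ^ i = \<kappa> ^ (i - 1) * \<kappa>" using assms by (cases i) auto
  then have "real (card (X (i - 1))) * real D = real (card (X i)) * real d"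
    using card_layer[of i] card_layer[of "i - 1"] assms D_real by simp
  then show ?thesis by (metis of_nat_eq_iff of_nat_mult)
qed

lemma D_le_layer:
  assumes "1 \<le> i" "i \<le> h"
  shows "D \<le> card (X i)"
proof -
  have "\<kappa> ^ 1 * real m \<le> \<kappa> ^ i * real m"
    using \<kappa> assms by (intro mult_right_mono power_increasing) auto
  then have "real D \<le> real (card (X i))"
    using D_le card_layer[of i] assms by simp
  then show ?thesis by simp
qed

lemma rows:
  assumes "1 \<le> i" "i \<le> h"
  shows "bij_betw (\<lambda>E. \<lambda>y\<in>X (i - 1). E `` {y}) (layer_graphs i) (biregular_rows (X (i - 1)) (X i) D d)"
    and "finite (biregular_rows (X (i - 1)) (X i) D d)" and "biregular_rows (X (i - 1)) (X i) D d \<noteq> {}"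
proof -
  show "bij_betw (\<lambda>E. \<lambda>y\<in>X (i - 1). E `` {y}) (layer_graphs i) (biregular_rows (X (i - 1)) (X i) D d)"
    by (rule bij_betw_rows[OF D])
  show "finite (biregular_rows (X (i - 1)) (X i) D d)"
    using assms finite_layer by (intro finite_biregular_rows) auto
  show "biregular_rows (X (i - 1)) (X i) D d \<noteq> {}"
    using assms finite_layer edge_count D_le_layer by (intro biregular_rows_nonempty) auto
qed

lemma layer_graphs_finite:
  assumes "1 \<le> i" "i \<le> h"
  shows "finite (layer_graphs i)" "layer_graphs i \<noteq> {}"
proof -
  show "finite (layer_graphs i)"
    using bij_betw_finite[OF rows(1)[OF assms]] rows(2)[OF assms] by simp
  show "layer_graphs i \<noteq> {}"
    using bij_betw_imp_surj_on[OF rows(1)[OF assms]] rows(3)[OF assms] by blast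
qed

lemma columns:
  assumes "1 \<le> i" "i \<le> h"
  shows "bij_betw (\<lambda>E. \<lambda>z\<in>X i. E\<inverse> `` {z}) (layer_graphs i) (biregular_rows (X i) (X (i - 1)) d D)"
    and "finite (biregular_rows (X i) (X (i - 1)) d D)" and "biregular_rows (X i) (X (i - 1)) d D \<noteq> {}"
proof -
  show bij: "bij_betw (\<lambda>E. \<lambda>z\<in>X i. E\<inverse> `` {z}) (layer_graphs i) (biregular_rows (X i) (X (i - 1)) d D)"
    by (rule bij_betw_columns[OF D])
  show "finite (biregular_rows (X i) (X (i - 1)) d D)"
    using assms finite_layer by (intro finite_biregular_rows) auto
  show "biregular_rows (X i) (X (i - 1)) d D \<noteq> {}"
    using layer_graphs_finite(2)[OF assms] bij by (auto simp: bij_betw_def)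
qed

lemma layer_graphsD:
  assumes "E \<in> layer_graphs i"
  shows "E \<subseteq> X (i - 1) \<times> X i" and "y \<in> X (i - 1) \<Longrightarrow> card (E `` {y}) = D"
    and "z \<in> X i \<Longrightarrow> card (E\<inverse> `` {z}) = d"
proof -
  show "E \<subseteq> X (i - 1) \<times> X i" using assms by (simp add: biregular_digraphs_def)
  show "card (E\<inverse> `` {z}) = d" if "z \<in> X i" using assms that by (simp add: biregular_digraphs_def)
  show "card (E `` {y}) = D" if "y \<in> X (i - 1)"
  proof -
    have "rat_of_nat (card (E `` {y})) = rat_of_nat D"
      using assms that D by (simp add: biregular_digraphs_def)
    then show ?thesis by simp
  qed
qed

lemma finite_layer_graph:
  assumes "i \<le> h" "E \<in> layer_graphs i"
  shows "finite E"
proof (rule finite_subset[OF layer_graphsD(1)[OF assms(2)]])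
  show "finite (X (i - 1) \<times> X i)" using assms(1) finite_layer by simp
qed

lemma card_layer_graph:
  assumes i: "1 \<le> i" "i \<le> h" and E: "E \<in> layer_graphs i"
  shows "card E = card (X i) * d"
proof -
  have "E = (SIGMA z:X i. E\<inverse> `` {z})\<inverse>" using layer_graphsD(1)[OF E] by auto
  then have "card E = card (SIGMA z:X i. E\<inverse> `` {z})" by (metis card_inverse)
  also have "\<dots> = (\<Sum>z\<in>X i. card (E\<inverse> `` {z}))"
    using finite_layer[OF i(2)] finite_layer_graph[OF i(2) E] by (intro card_SigmaI) auto
  also have "\<dots> = card (X i) * d" using layer_graphsD(3)[OF E] by simp
  finally show ?thesis .
qed

lemma union_edge:
  assumes "graph_family G" "(y, z) \<in> union G"
  obtains i where "1 \<le> i" "i \<le> h" "(y, z) \<in> G i" "y \<in> X (i - 1)" "z \<in> X i"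
proof -
  obtain i where i: "i \<in> {1..h}" "(y, z) \<in> G i" using assms(2) by auto
  then have "G i \<subseteq> X (i - 1) \<times> X i"
    using assms(1) layer_graphsD(1) by (simp add: graph_family_def)
  then show thesis using i by (intro that[of i]) auto
qed

lemma union_out:
  assumes G: "graph_family G" and y: "y \<in> X i" and i: "i < h"
  shows "union G `` {y} = G (i + 1) `` {y}"
proof (intro equalityI subsetI)
  fix z assume "z \<in> union G `` {y}"
  then have "(y, z) \<in> union G" by simp
  then obtain j where "1 \<le> j" "j \<le> h" "(y, z) \<in> G j" "y \<in> X (j - 1)"
    using union_edge[OF G] by metis
  moreover from this have "j - 1 = i" using y i by (intro layer_unique) auto
  ultimately show "z \<in> G (i + 1) `` {y}" by (cases j) auto
qed (use i in auto)

lemma union_in: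
  assumes G: "graph_family G" and z: "z \<in> X i" and i: "1 \<le> i" "i \<le> h"
  shows "(union G)\<inverse> `` {z} = (G i)\<inverse> `` {z}"
proof (intro equalityI subsetI)
  fix y assume "y \<in> (union G)\<inverse> `` {z}"
  then have "(y, z) \<in> union G" by auto
  then obtain j where j: "1 \<le> j" "j \<le> h" "(y, z) \<in> G j" "z \<in> X j"
    using union_edge[OF G] by metis
  then have "j = i" using z i by (intro layer_unique) auto
  then show "y \<in> (G i)\<inverse> `` {z}" using j by auto
qed (use i in auto)

lemma union_between:
  assumes G: "graph_family G" and i: "1 \<le> i" "i \<le> h"
  shows "union G \<inter> X (i - 1) \<times> X i = G i"
proof (intro equalityI subsetI)
  fix e assume "e \<in> union G \<inter> X (i - 1) \<times> X i"
  then obtain y z where e: "e = (y, z)" "(y, z) \<in> union G" "z \<in> X i" by auto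
  then have "y \<in> (union G)\<inverse> `` {z}" by auto
  then show "e \<in> G i" unfolding union_in[OF G e(3) i] using e by simp
next
  fix e assume "e \<in> G i"
  moreover have "G i \<subseteq> X (i - 1) \<times> X i"
    using G i by (intro layer_graphsD) (simp add: graph_family_def)
  ultimately show "e \<in> union G \<inter> X (i - 1) \<times> X i" using i by auto
qed

lemma union_last:
  assumes G: "graph_family G" and y: "y \<in> X h"
  shows "union G `` {y} = {}"
proof (rule ccontr)
  assume "union G `` {y} \<noteq> {}"
  then obtain z where "(y, z) \<in> union G" by auto
  then obtain j where j: "1 \<le> j" "j \<le> h" "y \<in> X (j - 1)"
    using union_edge[OF G] by metis
  then have "j - 1 = h" using y by (intro layer_unique) auto
  then show False using j by simp
qed

text \<open>Neighbourhoods of \<open>u\<close> and \<open>v\<close> both have \<open>D\<close>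
  elements, so the subset asked for in the upward condition has to be all out-neighbours of
  \<open>u\<close>, and an injection into the row of \<open>v\<close> is already a perfect
  matching.\<close>

definition has_up_matching :: "('v \<times> 'v) set \<Rightarrow> ('v \<times> 'v) set \<Rightarrow> 'v \<Rightarrow> 'v \<Rightarrow> bool" where
  "has_up_matching E F u v \<longleftrightarrow> (\<exists>f. inj_on f (E `` {u}) \<and> (\<forall>a\<in>E `` {u}. f a \<in> F `` {a} \<inter> F `` {v}))"

definition has_down_matching :: "('v \<times> 'v) set \<Rightarrow> ('v \<times> 'v) set \<Rightarrow> 'v \<Rightarrow> 'v \<Rightarrow> bool" where
  "has_down_matching E F u v \<longleftrightarrow>
     (\<exists>f. inj_on f (F\<inverse> `` {v}) \<and> (\<forall>a\<in>F\<inverse> `` {v}. f a \<in> E\<inverse> `` {a} \<inter> E\<inverse> `` {u}))"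

lemma graph_familyD: "graph_family G \<Longrightarrow> 1 \<le> i \<Longrightarrow> i \<le> h \<Longrightarrow> G i \<in> layer_graphs i"
  by (simp add: graph_family_def)

lemma perfect_matching_up:
  assumes G: "graph_family G" and i: "1 \<le> i" "i < h" and uv: "(u, v) \<in> G i"
    and m: "has_up_matching (G i) (G (i + 1)) u v"
  shows "\<exists>M. perfect_matching (union G) (union G `` {u}) (union G `` {v}) M"
proof -
  have Gi: "G i \<in> layer_graphs i" and Gi': "G (i + 1) \<in> layer_graphs (i + 1)"
    using graph_familyD[OF G, of i] graph_familyD[OF G, of "i + 1"] i by auto
  have sub: "G i \<subseteq> X (i - 1) \<times> X i" and sub': "G (i + 1) \<subseteq> X i \<times> X (i + 1)"
    using layer_graphsD(1)[OF Gi] layer_graphsD(1)[OF Gi'] by simp_all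
  have u: "u \<in> X (i - 1)" and v: "v \<in> X i" using uv sub by auto
  have "i - 1 < h" "i - 1 + 1 = i" using i by auto
  then have Eu: "union G `` {u} = G i `` {u}" using union_out[OF G u] by metis
  have Ev: "union G `` {v} = G (i + 1) `` {v}" by (rule union_out[OF G v i(2)])
  obtain f where f: "inj_on f (G i `` {u})" "\<forall>a\<in>G i `` {u}. f a \<in> G (i + 1) `` {a} \<inter> G (i + 1) `` {v}"
    using m unfolding has_up_matching_def by (elim exE conjE)
  note f1 = IntD1[OF bspec[OF f(2)]] and f2 = IntD2[OF bspec[OF f(2)]]
  have rows: "G i `` {u} \<subseteq> X i" "G (i + 1) `` {v} \<subseteq> X (i + 1)"
    using sub sub' by auto
  have disj: "G i `` {u} \<inter> G (i + 1) `` {v} = {}"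
    by (rule layer_disjoint[OF rows]) (use i in auto)
  have img: "f ` (G i `` {u}) = G (i + 1) `` {v}"
  proof (rule card_subset_eq)
    show "finite (G (i + 1) `` {v})"
      by (rule finite_subset[OF rows(2) finite_layer]) (use i in simp)
    show "f ` (G i `` {u}) \<subseteq> G (i + 1) `` {v}" by (rule image_subsetI) (rule f2)
    have "card (G (i + 1) `` {v}) = D" "card (G i `` {u}) = D"
      using layer_graphsD(2)[OF Gi'] layer_graphsD(2)[OF Gi] u v by simp_all
    then show "card (f ` (G i `` {u})) = card (G (i + 1) `` {v})" using card_image[OF f(1)] by simp
  qed
  have "perfect_matching (union G) (G i `` {u}) (G (i + 1) `` {v}) ((\<lambda>a. (a, f a)) ` (G i `` {u}))"
  proof (rule perfect_matching_graph[OF f(1) img disj])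
    fix a assume "a \<in> G i `` {u}"
    then have "(a, f a) \<in> G (i + 1)" using f1 by simp
    then show "(a, f a) \<in> union G" using i by (intro UN_I[of "i + 1"]) auto
  qed
  then show ?thesis unfolding Eu Ev by (rule exI)
qed

lemma perfect_matching_down:
  assumes G: "graph_family G" and i: "1 \<le> i" "i < h" and uv: "(u, v) \<in> G (i + 1)"
    and m: "has_down_matching (G i) (G (i + 1)) u v"
  shows "\<exists>M. perfect_matching (union G) ((union G)\<inverse> `` {v}) ((union G)\<inverse> `` {u}) M"
proof -
  have Gi: "G i \<in> layer_graphs i" and Gi': "G (i + 1) \<in> layer_graphs (i + 1)"
    using graph_familyD[OF G, of i] graph_familyD[OF G, of "i + 1"] i by auto
  have sub: "G i \<subseteq> X (i - 1) \<times> X i" and sub': "G (i + 1) \<subseteq> X i \<times> X (i + 1)"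
    using layer_graphsD(1)[OF Gi] layer_graphsD(1)[OF Gi'] by simp_all
  have u: "u \<in> X i" and v: "v \<in> X (i + 1)" using uv sub' by auto
  have Eu: "(union G)\<inverse> `` {u} = (G i)\<inverse> `` {u}" by (rule union_in[OF G u]) (use i in auto)
  have Ev: "(union G)\<inverse> `` {v} = (G (i + 1))\<inverse> `` {v}" by (rule union_in[OF G v]) (use i in auto)
  obtain f where f: "inj_on f ((G (i + 1))\<inverse> `` {v})"
      "\<forall>a\<in>(G (i + 1))\<inverse> `` {v}. f a \<in> (G i)\<inverse> `` {a} \<inter> (G i)\<inverse> `` {u}"
    using m unfolding has_down_matching_def by (elim exE conjE)
  note f1 = IntD1[OF bspec[OF f(2)]] and f2 = IntD2[OF bspec[OF f(2)]]
  have columns: "(G (i + 1))\<inverse> `` {v} \<subseteq> X i" "(G i)\<inverse> `` {u} \<subseteq> X (i - 1)"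
    using sub sub' by auto
  have disj: "(G (i + 1))\<inverse> `` {v} \<inter> (G i)\<inverse> `` {u} = {}"
    by (rule layer_disjoint[OF columns]) (use i in auto)
  have img: "f ` ((G (i + 1))\<inverse> `` {v}) = (G i)\<inverse> `` {u}"
  proof (rule card_subset_eq)
    show "finite ((G i)\<inverse> `` {u})"
      by (rule finite_subset[OF columns(2) finite_layer]) (use i in simp)
    show "f ` ((G (i + 1))\<inverse> `` {v}) \<subseteq> (G i)\<inverse> `` {u}" by (rule image_subsetI) (rule f2)
    have "card ((G (i + 1))\<inverse> `` {v}) = d" "card ((G i)\<inverse> `` {u}) = d"
      using layer_graphsD(3)[OF Gi'] layer_graphsD(3)[OF Gi] u v by simp_all
    then show "card (f ` ((G (i + 1))\<inverse> `` {v})) = card ((G i)\<inverse> `` {u})" using card_image[OF f(1)] by simp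
  qed
  have "perfect_matching ((union G)\<inverse>) ((G (i + 1))\<inverse> `` {v}) ((G i)\<inverse> `` {u})
      ((\<lambda>a. (a, f a)) ` ((G (i + 1))\<inverse> `` {v}))"
  proof (rule perfect_matching_graph[OF f(1) img disj])
    fix a assume "a \<in> (G (i + 1))\<inverse> `` {v}"
    then have "f a \<in> (G i)\<inverse> `` {a}" by (rule f1)
    then have "(f a, a) \<in> G i" by simp
    then have "(f a, a) \<in> union G" using i by (intro UN_I[of i]) auto
    then show "(a, f a) \<in> (union G)\<inverse>" by simp
  qed
  from perfect_matching_converse[OF this] show ?thesis unfolding Eu Ev by (rule exI)
qed

lemma commutative_unionI:
  assumes G: "graph_family G"
    and up: "\<And>i u v. i \<in> {1..<h} \<Longrightarrow> (u, v) \<in> G i \<Longrightarrow> has_up_matching (G i) (G (i + 1)) u v"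
    and down: "\<And>i u v. i \<in> {1..<h} \<Longrightarrow> (u, v) \<in> G (i + 1) \<Longrightarrow> has_down_matching (G i) (G (i + 1)) u v"
  shows "commutative_digraph h X (union G)"
  unfolding commutative_digraph_def layered_digraph_def
proof (intro conjI ballI allI impI)
  let ?E = "union G"
  show "disjoint_family_on X {..h}" using adm by (simp add: admissible_def)
  show "?E \<subseteq> (\<Union>i\<le>h. X i) \<times> (\<Union>i\<le>h. X i)"
  proof (rule subrelI)
    fix y z assume "(y, z) \<in> ?E"
    then obtain i where "1 \<le> i" "i \<le> h" "y \<in> X (i - 1)" "z \<in> X i" using union_edge[OF G] by metis
    then show "(y, z) \<in> (\<Union>i\<le>h. X i) \<times> (\<Union>i\<le>h. X i)"
      by (intro SigmaI UN_I[of "i - 1"] UN_I[of i]) auto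
  qed
  fix i j assume ij: "i \<le> h" "j \<le> h" "j \<noteq> i + 1"
  show "?E \<inter> X i \<times> X j = {}"
  proof (rule ccontr)
    assume "?E \<inter> X i \<times> X j \<noteq> {}"
    then obtain y z where yz: "(y, z) \<in> ?E" "y \<in> X i" "z \<in> X j" by auto
    then obtain l where l: "1 \<le> l" "l \<le> h" "y \<in> X (l - 1)" "z \<in> X l" using union_edge[OF G] by metis
    have "l - 1 = i" by (rule layer_unique[OF _ ij(1) l(3) yz(2)]) (use l in simp)
    moreover have "l = j" by (rule layer_unique[OF l(2) ij(2) l(4) yz(3)])
    ultimately show False using l ij by simp
  qed
next
  let ?E = "union G"
  fix i e assume i: "i \<in> {1..h}" and e: "e \<in> ?E \<inter> X (i - 1) \<times> X i"
  obtain u v where uv: "e = (u, v)" "v \<in> X i" using e by auto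
  have "e \<in> G i" using union_between[OF G, of i] i e by simp
  then have uv': "(u, v) \<in> G i" using uv by simp
  have "\<exists>S\<subseteq>?E `` {u}. \<exists>M. perfect_matching ?E S (?E `` {v}) M"
  proof (cases "i = h")
    case True
    \<comment> \<open>In the last layer there is nothing to match, and the empty subset
      serves.\<close>
    then have "?E `` {v} = {}" using union_last[OF G] uv by simp
    moreover have "perfect_matching ?E {} {} {}" by (simp add: perfect_matching_def)
    ultimately show ?thesis by (metis empty_subsetI)
  next
    case False
    then have "\<exists>M. perfect_matching ?E (?E `` {u}) (?E `` {v}) M"
      using i up[OF _ uv'] by (intro perfect_matching_up[OF G _ _ uv']) auto
    then show ?thesis by (metis subset_refl)
  qed
  then show "case e of (u, v) \<Rightarrow> \<exists>S\<subseteq>?E `` {u}. \<exists>M. perfect_matching ?E S (?E `` {v}) M"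
    unfolding uv(1) prod.case .
next
  let ?E = "union G"
  fix i e assume i: "i \<in> {1..<h}" and e: "e \<in> ?E \<inter> X i \<times> X (i + 1)"
  obtain u v where uv: "e = (u, v)" using e by auto
  have "e \<in> G (i + 1)" using union_between[OF G, of "i + 1"] i e by simp
  then have uv': "(u, v) \<in> G (i + 1)" using uv by simp
  have "\<exists>M. perfect_matching ?E (?E\<inverse> `` {v}) (?E\<inverse> `` {u}) M"
    by (rule perfect_matching_down[OF G _ _ uv' down[OF i uv']]) (use i in auto)
  then have "\<exists>S\<subseteq>?E\<inverse> `` {v}. \<exists>M. perfect_matching ?E S (?E\<inverse> `` {u}) M" by (metis subset_refl)
  then show "case e of (u, v) \<Rightarrow> \<exists>S\<subseteq>?E\<inverse> `` {v}. \<exists>M. perfect_matching ?E S (?E\<inverse> `` {u}) M"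
    unfolding uv prod.case .
qed

text \<open>By equality of the degrees a matching for the edge \<open>(u, v)\<close> has to cover
  all out-neighbours of \<open>u\<close>, in particular \<open>x\<close>; its partner would be a
  common out-neighbour of \<open>v\<close> and \<open>x\<close>.\<close>

lemma not_commutative_unionI:
  assumes G: "graph_family G" and h: "2 \<le> h"
    and edges: "(u, v) \<in> G (h - 1)" "(u, x) \<in> G (h - 1)" and disj: "G h `` {v} \<inter> G h `` {x} = {}"
  shows "\<not> commutative_digraph h X (union G)"
proof
  let ?E = "union G"
  assume comm: "commutative_digraph h X ?E"
  have Gi: "G i \<in> layer_graphs i" if "1 \<le> i" "i \<le> h" for i
    using G that by (simp add: graph_family_def)
  have h1: "h - 1 \<in> {1..h}" using h by auto
  have in_X: "u \<in> X (h - 2)" "v \<in> X (h - 1)" "x \<in> X (h - 1)"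
    using layer_graphsD(1)[OF Gi, of "h - 1"] edges h1 by (auto simp: numeral_2_eq_2)
  have Eu: "?E `` {u} = G (h - 1) `` {u}" 
  proof -
    have "h - 2 < h" "h - 2 + 1 = h - 1" using h by auto
    then show ?thesis using union_out[OF G in_X(1)] by metis
  qed
  have Ev: "?E `` {v} = G h `` {v}" and Ex: "?E `` {x} = G h `` {x}"
    using union_out[OF G in_X(2)] union_out[OF G in_X(3)] h by auto
  have "(u, v) \<in> ?E \<inter> X (h - 1 - 1) \<times> X (h - 1)"
    using edges h1 in_X by (auto simp: numeral_2_eq_2)
  then obtain S M where S: "S \<subseteq> ?E `` {u}" and M: "perfect_matching ?E S (?E `` {v}) M"
    using comm h1 unfolding commutative_digraph_def by blast
  have "card (?E `` {v}) = D" "card (?E `` {u}) = D"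
    unfolding Eu Ev using layer_graphsD(2)[OF Gi, of h v] layer_graphsD(2)[OF Gi, of "h - 1" u] in_X h
    by (auto simp: numeral_2_eq_2)
  moreover have "finite (?E `` {u})"
    unfolding Eu using finite_layer_graph[OF _ Gi, of "h - 1"] h by auto
  ultimately have "S = ?E `` {u}"
    using S M by (intro card_subset_eq) (auto simp: perfect_matching_def)
  then have "x \<in> S" unfolding Eu using edges by auto
  then have "x \<in> Field M" using M by (auto simp: perfect_matching_def)
  then obtain b where b: "(x, b) \<in> M \<or> (b, x) \<in> M" by (auto simp: Field_def)
  have sub: "S \<subseteq> X (h - 1)" "?E `` {v} \<subseteq> X h"
  proof -
    have "G (h - 1) \<subseteq> X (h - 1 - 1) \<times> X (h - 1)" "G h \<subseteq> X (h - 1) \<times> X h"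
      by (intro layer_graphsD Gi; use h in simp)+
    then show "S \<subseteq> X (h - 1)" "?E `` {v} \<subseteq> X h" using S unfolding Eu Ev by auto
  qed
  have x_notin: "x \<notin> ?E `` {v}"
    using sub in_X layer_unique[of "h - 1" h x] h by auto
  have ME: "M \<subseteq> ?E \<inter> (S \<times> ?E `` {v} \<union> ?E `` {v} \<times> S)" using M by (simp add: perfect_matching_def)
  from b show False
  proof
    assume "(x, b) \<in> M"
    then have "(x, b) \<in> ?E" "b \<in> ?E `` {v}" using ME x_notin by auto
    then have "b \<in> ?E `` {x}" by auto
    then show False using \<open>b \<in> ?E `` {v}\<close> disj unfolding Ev Ex by blast
  next
    \<comment> \<open>The reversed orientation permitted by \<open>perfect_matching\<close> would
      need an edge leaving the last layer.\<close>
    assume "(b, x) \<in> M"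
    then have "(b, x) \<in> ?E" "b \<in> ?E `` {v}" using ME x_notin by auto
    then have "b \<in> X h" using sub by auto
    then show False using union_last[OF G] \<open>(b, x) \<in> ?E\<close> by blast
  qed
qed

end

lemma card_ex_le:
  fixes c :: real
  assumes "finite K" "finite \<F>" and "\<And>p. p \<in> K \<Longrightarrow> card {g\<in>\<F>. Q p g} \<le> c * card \<F>"
  shows "card {g\<in>\<F>. \<exists>p\<in>K. Q p g} \<le> real (card K) * c * card \<F>"
proof -
  have "{g\<in>\<F>. \<exists>p\<in>K. Q p g} = (\<Union>p\<in>K. {g\<in>\<F>. Q p g})" by auto
  then have "card {g\<in>\<F>. \<exists>p\<in>K. Q p g} \<le> (\<Sum>p\<in>K. card {g\<in>\<F>. Q p g})"
    using card_UN_le[OF assms(1)] by metis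
  then have "real (card {g\<in>\<F>. \<exists>p\<in>K. Q p g}) \<le> real (\<Sum>p\<in>K. card {g\<in>\<F>. Q p g})"
    by (rule of_nat_mono)
  also have "\<dots> = (\<Sum>p\<in>K. real (card {g\<in>\<F>. Q p g}))" by simp
  also have "\<dots> \<le> (\<Sum>p\<in>K. c * card \<F>)" by (rule sum_mono) (rule assms(3))
  finally show ?thesis by simp
qed

text \<open>A bound below \<open>1\<close> is what matters: it gives
  \<open>(2 / 5) powr ln x \<ge> x powr (- 24 / 25)\<close>, so that the number of pairs, of order
  \<open>x\<close>, outweighs the small success probability. The chain rests on
  \<open>13 / 5 \<le> exp 1\<close>.\<close>

lemma ln_five_halves_le: "ln (5 / 2 :: real) \<le> 24 / 25"
proof -
  have "(13 / 5 :: real) \<le> (1 + 1 / 20) ^ 20" by (simp add: power_def)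
  also have "\<dots> \<le> exp (1 / 20) ^ 20"
    by (intro power_mono exp_ge_add_one_self) auto
  also have "\<dots> = exp 1" by (simp add: exp_of_nat_mult[symmetric])
  finally have e: "(13 / 5 :: real) \<le> exp 1" .
  have "(5 / 2 :: real) ^ 25 \<le> (13 / 5) ^ 24" by (simp add: power_def)
  also have "\<dots> \<le> exp 1 ^ 24" using e by (intro power_mono) auto
  finally have "ln ((5 / 2 :: real) ^ 25) \<le> ln (exp 1 ^ 24)"
    by (subst ln_le_cancel_iff) auto
  then show ?thesis by (simp add: ln_realpow)
qed

section \<open>The dense case: probability of a missing matching\<close>

context layered_setup
begin

abbreviation "graph_pmf \<equiv> Pi_pmf {1..h} {} (\<lambda>i. pmf_of_set (layer_graphs i))"

lemma prob_random_layered_digraph: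
  "measure_pmf.prob (random_layered_digraph k d h X) {E. P E} = measure_pmf.prob graph_pmf {G. P (union G)}"
  by (simp add: random_layered_digraph_def vimage_def)

lemma set_pmf_layer: "1 \<le> i \<Longrightarrow> i \<le> h \<Longrightarrow> set_pmf (pmf_of_set (layer_graphs i)) = layer_graphs i"
  using layer_graphs_finite by (simp add: set_pmf_of_set)

lemma graph_family_support: "G \<in> set_pmf graph_pmf \<Longrightarrow> graph_family G"
  unfolding graph_family_def
proof (intro ballI)
  fix i assume G: "G \<in> set_pmf graph_pmf" and i: "i \<in> {1..h}"
  then have "G i \<in> set_pmf (pmf_of_set (layer_graphs i))"
    by (auto simp: set_Pi_pmf PiE_dflt_def)
  then show "G i \<in> layer_graphs i" using set_pmf_layer[of i] i by simp
qed

lemma prob_graph_pmf_slice: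
  assumes j: "1 \<le> j" "j \<le> h" and c: "0 \<le> c"
    and le: "\<And>f. (\<And>i. 1 \<le> i \<Longrightarrow> i \<le> h \<Longrightarrow> i \<noteq> j \<Longrightarrow> f i \<in> layer_graphs i) \<Longrightarrow>
      measure_pmf.prob (pmf_of_set (layer_graphs j)) {e. P (f(j := e))} \<le> c"
  shows "measure_pmf.prob graph_pmf {G. P G} \<le> c"
proof (rule prob_Pi_pmf_le)
  fix f assume f: "\<And>i. i \<in> {1..h} \<Longrightarrow> i \<noteq> j \<Longrightarrow> f i \<in> set_pmf (pmf_of_set (layer_graphs i))"
  show "measure_pmf.prob (pmf_of_set (layer_graphs j)) {e. P (f(j := e))} \<le> c"
  proof (rule le)
    fix i assume "1 \<le> i" "i \<le> h" "i \<noteq> j"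
    then show "f i \<in> layer_graphs i" using f[of i] set_pmf_layer[of i] by simp
  qed
qed (use j c in auto)

text \<open>The bound of \<open>card_no_matching_le\<close> times \<open>card (X i) * D\<close>,
  which dominates the number of edges entering layer \<open>i\<close> and equals the number leaving
  it, so one quantity serves both conditions.\<close>

definition matching_error :: "nat \<Rightarrow> real" where
  "matching_error i = real (card (X i)) * real D *
     (real D ^ 2 * exp (- (real (D + 1) * real (d - 1) / (2 * (real (card (X i)) - 1)))))"

lemma matching_error_nonneg: "0 \<le> matching_error i"
  by (simp add: matching_error_def)

text \<open>All graphs but \<open>G (i + 1)\<close> are revealed. The edges \<open>(u, v)\<close>
  and the sets to be matched then come from the fixed graph \<open>G i\<close>, while the rows they
  are matched into are random.\<close>

lemma prob_no_up_matching:
  assumes i: "1 \<le> i" "i < h"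
  shows "measure_pmf.prob graph_pmf {G. \<exists>(u, v)\<in>G i. \<not> has_up_matching (G i) (G (i + 1)) u v} \<le> matching_error i"
proof (rule prob_graph_pmf_slice[where j = "i + 1"])
  fix f assume f: "\<And>l. 1 \<le> l \<Longrightarrow> l \<le> h \<Longrightarrow> l \<noteq> i + 1 \<Longrightarrow> f l \<in> layer_graphs l"
  let ?F = "biregular_rows (X i) (X (i + 1)) D d"
  define Q where "Q p g \<longleftrightarrow> \<not> (\<exists>t. inj_on t (f i `` {fst p}) \<and>
    (\<forall>a\<in>f i `` {fst p}. t a \<in> g a \<inter> g (snd p)))" for p :: "'v \<times> 'v" and g :: "'v \<Rightarrow> 'v set"
  let ?c = "real D ^ 2 * exp (- (real (D + 1) * real (d - 1) / (2 * (real (card (X i)) - 1))))"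
  have fi: "f i \<in> layer_graphs i" using f i by simp
  have sub: "f i \<subseteq> X (i - 1) \<times> X i" by (rule layer_graphsD(1)[OF fi])
  have i1: "1 \<le> i + 1" "i + 1 \<le> h" using i by auto
  have fin: "finite (X i)" "finite (X (i + 1))" using finite_layer i by auto
  have finf: "finite (f i)" by (rule finite_layer_graph[OF _ fi]) (use i in simp)
  have "real (card {g\<in>?F. \<exists>p\<in>f i. Q p g}) \<le> real (card (f i)) * ?c * card ?F"
  proof (rule card_ex_le[OF finf finite_biregular_rows[OF fin]])
    fix p assume p: "p \<in> f i"
    then obtain u v where uv: "p = (u, v)" "u \<in> X (i - 1)" "v \<in> X i" using sub by auto
    have "real (card {g\<in>?F. \<not> (\<exists>t. inj_on t (f i `` {u}) \<and> (\<forall>a\<in>f i `` {u}. t a \<in> g a \<inter> g v))}) \<le> ?c * card ?F"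
    proof (rule card_no_matching_le[OF fin])
      show "f i `` {u} \<subseteq> X i" using sub by auto
      show "card (f i `` {u}) = D" by (rule layer_graphsD(2)[OF fi uv(2)])
      show "v \<in> f i `` {u}" using p uv by simp
      show "2 \<le> card (X i)" using d_bounds layer_ge[of i] i by simp
    qed
    then show "real (card {g\<in>?F. Q p g}) \<le> ?c * card ?F" by (simp add: uv(1) Q_def)
  qed
  also have "\<dots> \<le> matching_error i * card ?F"
  proof -
    have "card (f i) \<le> card (X i) * D"
      using card_layer_graph[OF i(1) _ fi] i d_le_D by simp
    then have "real (card (f i)) \<le> real (card (X i)) * real D"
      by (metis of_nat_le_iff of_nat_mult)
    then show ?thesis unfolding matching_error_def by (intro mult_right_mono) auto
  qed
  finally have count: "real (card {g\<in>?F. \<exists>p\<in>f i. Q p g}) \<le> matching_error i * card ?F" .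
  have "measure_pmf.prob (pmf_of_set (layer_graphs (i + 1)))
      {e. \<exists>(u, v)\<in>f i. \<not> has_up_matching (f i) e u v} \<le> matching_error i"
  proof (rule prob_pmf_of_set_le_bij[OF _ _ _ _ count])
    show "bij_betw (\<lambda>E. \<lambda>y\<in>X i. E `` {y}) (layer_graphs (i + 1)) ?F"
      and "finite ?F" and "?F \<noteq> {}"
      using rows[OF i1] by simp_all
    fix e assume "\<exists>(u, v)\<in>f i. \<not> has_up_matching (f i) e u v"
    then obtain u v where uv: "(u, v) \<in> f i" "\<not> has_up_matching (f i) e u v" by auto
    have "v \<in> X i" "f i `` {u} \<subseteq> X i" using uv sub by auto
    then have "(\<forall>a\<in>f i `` {u}. t a \<in> (\<lambda>y\<in>X i. e `` {y}) a \<inter> (\<lambda>y\<in>X i. e `` {y}) v) \<longleftrightarrow>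
        (\<forall>a\<in>f i `` {u}. t a \<in> e `` {a} \<inter> e `` {v})" for t
      by (intro ball_cong) (auto simp: subset_iff)
    then have "Q (u, v) (\<lambda>y\<in>X i. e `` {y})"
      using uv(2) unfolding has_up_matching_def Q_def by simp
    then show "\<exists>p\<in>f i. Q p (\<lambda>y\<in>X i. e `` {y})" using uv(1) by (rule bexI)
  qed
  then show "measure_pmf.prob (pmf_of_set (layer_graphs (i + 1)))
      {e. \<exists>(u, v)\<in>(f(i + 1 := e)) i. \<not> has_up_matching ((f(i + 1 := e)) i) ((f(i + 1 := e)) (i + 1)) u v} \<le> matching_error i"
    by simp
qed (use i matching_error_nonneg in auto)

text \<open>Here \<open>G i\<close> is the random graph, read by columns, and
  \<open>G (i + 1)\<close> is fixed.\<close>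

lemma prob_no_down_matching:
  assumes i: "1 \<le> i" "i < h"
  shows "measure_pmf.prob graph_pmf {G. \<exists>(u, v)\<in>G (i + 1). \<not> has_down_matching (G i) (G (i + 1)) u v} \<le> matching_error i"
proof (rule prob_graph_pmf_slice[where j = i])
  fix f assume f: "\<And>l. 1 \<le> l \<Longrightarrow> l \<le> h \<Longrightarrow> l \<noteq> i \<Longrightarrow> f l \<in> layer_graphs l"
  let ?F = "biregular_rows (X i) (X (i - 1)) d D"
  let ?H = "f (i + 1)"
  define Q where "Q p g \<longleftrightarrow> \<not> (\<exists>t. inj_on t (?H\<inverse> `` {snd p}) \<and>
    (\<forall>a\<in>?H\<inverse> `` {snd p}. t a \<in> g a \<inter> g (fst p)))" for p :: "'v \<times> 'v" and g :: "'v \<Rightarrow> 'v set"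
  let ?c = "real d ^ 2 * exp (- (real (d + 1) * real (D - 1) / (2 * (real (card (X i)) - 1))))"
  have fi: "?H \<in> layer_graphs (i + 1)" using f[of "i + 1"] i by simp
  have sub: "?H \<subseteq> X i \<times> X (i + 1)" using layer_graphsD(1)[OF fi] by simp
  have i0: "i \<le> h" "i + 1 \<le> h" using i by auto
  have fin: "finite (X i)" "finite (X (i - 1))" using finite_layer i by auto
  have finf: "finite ?H" by (rule finite_layer_graph[OF i0(2) fi])
  have n2: "2 \<le> card (X i)" using d_bounds layer_ge[of i] i by simp
  have "real (card {g\<in>?F. \<exists>p\<in>?H. Q p g}) \<le> real (card ?H) * ?c * card ?F"
  proof (rule card_ex_le[OF finf finite_biregular_rows[OF fin]])
    fix p assume p: "p \<in> ?H"
    then obtain u v where uv: "p = (u, v)" "u \<in> X i" "v \<in> X (i + 1)" using sub by auto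
    have "real (card {g\<in>?F. \<not> (\<exists>t. inj_on t (?H\<inverse> `` {v}) \<and> (\<forall>a\<in>?H\<inverse> `` {v}. t a \<in> g a \<inter> g u))}) \<le> ?c * card ?F"
    proof (rule card_no_matching_le[OF fin])
      show "?H\<inverse> `` {v} \<subseteq> X i" using sub by auto
      show "card (?H\<inverse> `` {v}) = d" by (rule layer_graphsD(3)[OF fi uv(3)])
      show "u \<in> ?H\<inverse> `` {v}" using p uv by simp
      show "2 \<le> card (X i)" by (rule n2)
    qed
    then show "real (card {g\<in>?F. Q p g}) \<le> ?c * card ?F" by (simp add: uv(1) Q_def)
  qed
  also have "card ?H = card (X i) * D"
    using card_layer_graph[OF _ i0(2) fi] edge_count[OF _ i0(2)] by simp
  also have "real (card (X i) * D) * ?c * card ?F \<le> matching_error i * card ?F"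
  proof -
    \<comment> \<open>The difference of the two sides is \<open>2 * (D - d)\<close>, so
      \<open>k \<ge> 1\<close> makes the downward exponent the better one.\<close>
    have "(real D + 1) * (real d - 1) \<le> (real d + 1) * (real D - 1)"
      using d_le_D by (simp add: algebra_simps)
    then have "real (D + 1) * real (d - 1) / (2 * (real (card (X i)) - 1)) \<le>
        real (d + 1) * real (D - 1) / (2 * (real (card (X i)) - 1))"
      using n2 d_bounds d_le_D by (intro divide_right_mono) (auto simp: of_nat_diff add.commute)
    then have "?c \<le> real D ^ 2 * exp (- (real (D + 1) * real (d - 1) / (2 * (real (card (X i)) - 1))))"
      using d_le_D by (intro mult_mono power_mono) auto
    then have "real (card (X i)) * real D * ?c \<le> matching_error i"
      unfolding matching_error_def by (rule mult_left_mono) simp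
    then show ?thesis unfolding of_nat_mult by (rule mult_right_mono) simp
  qed
  finally have count: "real (card {g\<in>?F. \<exists>p\<in>?H. Q p g}) \<le> matching_error i * card ?F" .
  have "measure_pmf.prob (pmf_of_set (layer_graphs i))
      {e. \<exists>(u, v)\<in>?H. \<not> has_down_matching e ?H u v} \<le> matching_error i"
  proof (rule prob_pmf_of_set_le_bij[OF _ _ _ _ count])
    show "bij_betw (\<lambda>E. \<lambda>z\<in>X i. E\<inverse> `` {z}) (layer_graphs i) ?F" and "finite ?F" and "?F \<noteq> {}"
      using columns[OF i(1) i0(1)] by simp_all
    fix e assume "\<exists>(u, v)\<in>?H. \<not> has_down_matching e ?H u v"
    then obtain u v where uv: "(u, v) \<in> ?H" "\<not> has_down_matching e ?H u v" by auto
    have "u \<in> X i" "?H\<inverse> `` {v} \<subseteq> X i" using uv sub by auto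
    then have "(\<forall>a\<in>?H\<inverse> `` {v}. t a \<in> (\<lambda>y\<in>X i. e\<inverse> `` {y}) a \<inter> (\<lambda>y\<in>X i. e\<inverse> `` {y}) u) \<longleftrightarrow>
        (\<forall>a\<in>?H\<inverse> `` {v}. t a \<in> e\<inverse> `` {a} \<inter> e\<inverse> `` {u})" for t
      by (intro ball_cong) (auto simp: subset_iff)
    then have "Q (u, v) (\<lambda>y\<in>X i. e\<inverse> `` {y})"
      using uv(2) unfolding has_down_matching_def Q_def by simp
    then show "\<exists>p\<in>?H. Q p (\<lambda>y\<in>X i. e\<inverse> `` {y})" using uv(1) by (rule bexI)
  qed
  then show "measure_pmf.prob (pmf_of_set (layer_graphs i))
      {e. \<exists>(u, v)\<in>(f(i := e)) (i + 1). \<not> has_down_matching ((f(i := e)) i) ((f(i := e)) (i + 1)) u v} \<le> matching_error i"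
    by simp
qed (use i matching_error_nonneg in auto)

lemma prob_not_commutative_le:
  assumes \<beta>: "\<And>i. 1 \<le> i \<Longrightarrow> i < h \<Longrightarrow> matching_error i \<le> \<beta>" "0 \<le> \<beta>"
  shows "measure_pmf.prob (random_layered_digraph k d h X) {E. \<not> commutative_digraph h X E} \<le> 2 * real h * \<beta>"
proof -
  let ?U = "\<lambda>i. {G. \<exists>(u, v)\<in>G i. \<not> has_up_matching (G i) (G (i + 1)) u v}"
  let ?L = "\<lambda>i. {G. \<exists>(u, v)\<in>G (i + 1). \<not> has_down_matching (G i) (G (i + 1)) u v}"
  have "measure_pmf.prob graph_pmf {G. \<not> commutative_digraph h X (union G)} \<le>
      measure_pmf.prob graph_pmf (\<Union>i\<in>{1..<h}. ?U i \<union> ?L i)"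
  proof (rule measure_pmf.finite_measure_mono_AE)
    show "AE G in graph_pmf. G \<in> {G. \<not> commutative_digraph h X (union G)} \<longrightarrow> G \<in> (\<Union>i\<in>{1..<h}. ?U i \<union> ?L i)"
      unfolding AE_measure_pmf_iff
    proof (intro ballI impI, rule ccontr)
      fix G assume G: "G \<in> set_pmf graph_pmf" "G \<in> {G. \<not> commutative_digraph h X (union G)}"
        and n: "G \<notin> (\<Union>i\<in>{1..<h}. ?U i \<union> ?L i)"
      have "commutative_digraph h X (union G)"
        by (rule commutative_unionI[OF graph_family_support[OF G(1)]]) (use n in \<open>fastforce+\<close>)
      then show False using G(2) by simp
    qed
  qed simp
  also have "\<dots> \<le> (\<Sum>i\<in>{1..<h}. measure_pmf.prob graph_pmf (?U i \<union> ?L i))"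
    by (rule measure_pmf.finite_measure_subadditive_finite) auto
  also have "\<dots> \<le> (\<Sum>i\<in>{1..<h}. 2 * \<beta>)"
  proof (rule sum_mono)
    fix i assume i: "i \<in> {1..<h}"
    have "measure_pmf.prob graph_pmf (?U i \<union> ?L i) \<le>
        measure_pmf.prob graph_pmf (?U i) + measure_pmf.prob graph_pmf (?L i)"
      by (rule measure_Un_le) auto
    then show "measure_pmf.prob graph_pmf (?U i \<union> ?L i) \<le> 2 * \<beta>"
      using prob_no_up_matching[of i] prob_no_down_matching[of i] \<beta>(1)[of i] i by auto
  qed
  also have "\<dots> \<le> 2 * real h * \<beta>"
    using \<beta>(2) by (simp add: mult_right_mono)
  finally show ?thesis unfolding prob_random_layered_digraph .
qed

text \<open>The threshold gives \<open>D * d \<ge> 9 * n * ln M\<close> for the layer size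
  \<open>n\<close>. Replacing \<open>d\<close> by \<open>d - 1\<close> costs at most a factor
  \<open>17 / 18\<close> for \<open>d \<ge> 18\<close>, hence an exponent of at least
  \<open>17 / 4 * ln M\<close>, against the prefactor \<open>n * D ^ 3 \<le> M ^ 4\<close>.\<close>

lemma matching_error_le:
  assumes i: "1 \<le> i" "i < h" and d: "18 \<le> d"
    and dense: "9 * (\<kappa> ^ (h - 2) * real m * ln (real h * \<kappa> ^ (h + 1) * real m)) \<le> real d ^ 2"
  shows "matching_error i \<le> (real h * \<kappa> ^ (h + 1) * real m) powr (- 1 / 4)"
proof -
  define M where "M = real h * \<kappa> ^ (h + 1) * real m"
  let ?n = "real (card (X i))"
  have m: "1 \<le> real m" using d_bounds by simp
  have \<kappa>p: "1 \<le> \<kappa> ^ j" for j using \<kappa> by simp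
  have big: "\<kappa> ^ (h + 1) * real m \<le> M"
  proof -
    have "1 * (\<kappa> ^ (h + 1) * real m) \<le> real h * (\<kappa> ^ (h + 1) * real m)"
      using i m \<kappa>p[of "h + 1"] by (intro mult_right_mono) auto
    then show ?thesis by (simp add: M_def mult.assoc)
  qed
  have pow_le: "\<kappa> ^ j * real m \<le> M" if "j \<le> h + 1" for j
  proof -
    have "\<kappa> ^ j * real m \<le> \<kappa> ^ (h + 1) * real m"
      using \<kappa> that by (intro mult_right_mono power_increasing) auto
    then show ?thesis using big by simp
  qed
  have M1: "1 \<le> M"
    using pow_le[of 0] m by simp
  have n: "?n = \<kappa> ^ i * real m" using card_layer[of i] i by simp
  have nM: "?n \<le> M" unfolding n by (rule pow_le) (use i in simp)
  have DM: "real D \<le> M" using D_le pow_le[of 1] i by simp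
  have n2: "2 \<le> ?n" using d_bounds layer_ge[of i] i by simp
  \<comment> \<open>Matchings start in layers up to \<open>h - 1\<close>. The largest is the
    critical one, and its extra factor \<kappa> is absorbed by
    \<open>D = \<kappa> * d\<close>.\<close>
  have kk: "\<kappa> ^ i \<le> \<kappa> * \<kappa> ^ (h - 2)"
  proof -
    have "\<kappa> ^ i \<le> \<kappa> ^ (h - 1)" using \<kappa> i by (intro power_increasing) auto
    also have "h - 1 = Suc (h - 2)" using i by simp
    finally show ?thesis by simp
  qed
  have lnM: "0 \<le> ln M" using M1 by simp
  have mu: "9 * ln M * ?n \<le> real D * real d"
  proof -
    have "9 * ln M * ?n = (9 * ln M * real m) * \<kappa> ^ i" by (simp add: n)
    also have "\<dots> \<le> (9 * ln M * real m) * (\<kappa> * \<kappa> ^ (h - 2))"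
      using lnM kk by (intro mult_left_mono) auto
    also have "\<dots> = \<kappa> * (9 * (\<kappa> ^ (h - 2) * real m * ln M))" by simp
    also have "\<dots> \<le> \<kappa> * real d ^ 2"
      using dense \<kappa> unfolding M_def by (intro mult_left_mono) auto
    also have "\<dots> = real D * real d" by (simp add: D_real power2_eq_square)
    finally show ?thesis .
  qed
  have "17 / 4 * ln M \<le> real (D + 1) * real (d - 1) / (2 * (?n - 1))"
  proof -
    have "17 / 4 * ln M * (2 * (?n - 1)) \<le> 17 / 2 * ln M * ?n"
      using lnM by (simp add: algebra_simps)
    also have "\<dots> = 17 / 18 * (9 * ln M * ?n)" by simp
    also have "\<dots> \<le> 17 / 18 * (real D * real d)"
      using mu by (intro mult_left_mono) auto
    also have "\<dots> = real D * (17 / 18 * real d)" by simp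
    also have "\<dots> \<le> real (D + 1) * real (d - 1)"
      using d by (intro mult_mono) (auto simp: of_nat_diff)
    finally show ?thesis using n2 by (simp add: pos_le_divide_eq)
  qed
  then have "exp (- (real (D + 1) * real (d - 1) / (2 * (?n - 1)))) \<le> M powr (- 17 / 4)"
    using M1 by (simp add: powr_def)
  then have "matching_error i \<le> M * M * (M ^ 2 * M powr (- 17 / 4))"
    unfolding matching_error_def using nM DM M1 n2
    by (intro mult_mono power_mono) auto
  also have "\<dots> = M powr 4 * M powr (- 17 / 4)"
    using M1 by (simp add: powr_realpow[of M 4, simplified] power4_eq_xxxx power2_eq_square)
  also have "\<dots> = M powr (- 1 / 4)"
    by (simp add: powr_add[symmetric])
  finally show ?thesis unfolding M_def .
qed

end

section \<open>The sparse case: all pairs failing to be disjoint\<close>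

definition sparse_error :: "real \<Rightarrow> real" where
  "sparse_error x = 2 * (2 * exp (- (ln x / 15)) + 3 * (ln x * sqrt (ln x / x)) + 600 * (ln x)\<^sup>2 / x) +
     exp (- (x powr (- 24 / 25) * (x / 4 - 1) / 2))"

lemma sparse_error_tendsto: "(sparse_error \<longlongrightarrow> 0) at_top"
  unfolding sparse_error_def by real_asymp

text \<open>Only the last graph supplies randomness: the pairs with a common in-neighbour exist for
  every choice of \<open>G (h - 1)\<close>. The last two layers have at least
  \<open>x = \<kappa> * m\<close> vertices, so the bound of \<open>card_all_meet_le\<close> is
  controlled by a function of \<open>x\<close> alone.\<close>

lemma (in layered_setup) prob_commutative_le:
  assumes h: "2 \<le> h" and m: "4 \<le> m"
    and sparse: "real d ^ 2 \<le> 1 / 3 * \<kappa> ^ (h - 2) * real m * ln (\<kappa> * real m)"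
  shows "measure_pmf.prob (random_layered_digraph k d h X) {E. commutative_digraph h X E} \<le> sparse_error (\<kappa> * real m)"
proof -
  define x l where "x = \<kappa> * real m" and "l = ln x"
  let ?Y = "X (h - 1)" and ?Z = "X h" and ?V = "X (h - 1 - 1)"
  let ?n = "real (card ?Y)"
  let ?F = "biregular_rows ?Y ?Z D d"
  have hh: "1 \<le> h" "h - 1 \<le> h" "1 \<le> h - 1" "h - 1 - 1 \<le> h" using h by auto
  have fin: "finite ?Y" "finite ?Z" "finite ?V" using finite_layer hh by auto
  have "1 * 4 \<le> x" unfolding x_def using \<kappa> m by (intro mult_mono) auto
  then have x4: "4 \<le> x" by simp
  have l0: "0 \<le> l" using x4 by (simp add: l_def)
  have n: "?n = \<kappa> ^ (h - 1) * real m" using card_layer[OF hh(2)] .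
  have hs: "h - 1 = Suc (h - 2)" "h = Suc (h - 1)" using h by auto
  have n2: "?n = \<kappa> * (\<kappa> ^ (h - 2) * real m)" using n hs(1) by simp
  have nx: "x \<le> ?n"
  proof -
    have "\<kappa> * (1 * real m) \<le> \<kappa> * (\<kappa> ^ (h - 2) * real m)"
      using \<kappa> by (intro mult_left_mono mult_right_mono) auto
    then show ?thesis by (simp only: x_def n2 mult_1)
  qed
  have Zn: "real (card ?Z) = \<kappa> * ?n"
  proof -
    have "\<kappa> ^ h = \<kappa> * \<kappa> ^ (h - 1)" by (subst hs(2)) simp
    then show ?thesis using card_layer[of h] n by simp
  qed
  have nZ: "?n \<le> real (card ?Z)"
    unfolding Zn using \<kappa> mult_right_mono[of 1 \<kappa> ?n] by simp
  have Zx: "x \<le> real (card ?Z)" using nx nZ by simp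
  have Y0: "0 < ?n" using nx x4 by simp
  have dY: "d \<le> card ?Y" using d_bounds layer_ge[OF hh(2)] by simp
  \<comment> \<open>The \<open>1 / 3\<close> of the threshold becomes the mean \<open>l / 3\<close>
    demanded by \<open>card_unlikely_disjoint_le\<close>.\<close>
  have d2: "\<kappa> * real d ^ 2 \<le> l / 3 * ?n"
  proof -
    have "\<kappa> * real d ^ 2 \<le> \<kappa> * (1 / 3 * \<kappa> ^ (h - 2) * real m * l)"
      using sparse \<kappa> unfolding l_def x_def by (intro mult_left_mono) auto
    also have "\<dots> = l / 3 * (\<kappa> * (\<kappa> ^ (h - 2) * real m))" by simp
    finally show ?thesis unfolding n2 .
  qed
  have mean: "real D * real d / ?n \<le> l / 3"
    using d2 Y0 by (simp add: D_real power2_eq_square pos_divide_le_eq)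
  have ratio: "real d / ?n \<le> sqrt (l / x)"
  proof (rule real_le_rsqrt)
    have "1 * real d ^ 2 \<le> \<kappa> * real d ^ 2" using \<kappa> by (intro mult_right_mono) auto
    also note d2
    also have "l / 3 * ?n \<le> l * ?n" using l0 by (intro mult_right_mono) auto
    finally have "(real d / ?n) ^ 2 \<le> l / ?n"
      using Y0 by (simp add: power_divide divide_simps power2_eq_square)
    also have "\<dots> \<le> l / x" using nx x4 l0 by (intro divide_left_mono) auto
    finally show "(real d / ?n) ^ 2 \<le> l / x" .
  qed
  define q where "q = (2 / 5 :: real) powr l"
  \<comment> \<open>A quarter is what the greedy choice can provide, and the \<open>2 * T\<close>
    vertices of the pairs leave room for \<open>T\<close> distinct spare vertices.\<close>
  define T where "T = card ?Y div 4"
  define \<delta> where "\<delta> = 2 * exp (- (l / 15)) + 3 * (l * (real d / ?n)) + 600 * l\<^sup>2 / real (card ?Z)"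
  have q01: "0 \<le> q" "q \<le> 1"
    using l0 powr_mono'[of 0 l "2 / 5 :: real"] by (simp_all add: q_def)
  have T: "x / 4 - 1 \<le> real T" "0 < T" "4 * T \<le> card ?Y"
  proof -
    have "card ?Y < 4 * T + 4" unfolding T_def by linarith
    then have "?n < 4 * real T + 4" by linarith
    then show "x / 4 - 1 \<le> real T" using nx by simp
    have "4 \<le> card ?Y" using nx x4 by linarith
    then show "0 < T" by (simp add: T_def div_greater_zero_iff)
    show "4 * T \<le> card ?Y" unfolding T_def by simp
  qed
  have qx: "x powr (- 24 / 25) \<le> q"
  proof -
    have "ln (2 / 5 :: real) = - ln (5 / 2)" by (simp add: ln_div)
    then have "- 24 / 25 \<le> ln (2 / 5 :: real)" using ln_five_halves_le by simp
    then have "l * (- 24 / 25) \<le> l * ln (2 / 5)" using l0 by (rule mult_left_mono)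
    then show ?thesis using x4 by (simp add: q_def powr_def l_def mult.commute)
  qed
  have bound: "2 * \<delta> + exp (- (q * real T / 2)) \<le> sparse_error x"
  proof -
    have combine: "2 * (2 * c + 3 * a + b) + e \<le> 2 * (2 * c + 3 * a' + b') + e'"
      if "a \<le> a'" "b \<le> b'" "e \<le> e'" for a a' b b' c e e' :: real
      by (intro add_mono mult_left_mono order_refl that) auto
    have "l * (real d / ?n) \<le> l * sqrt (l / x)" using ratio l0 by (rule mult_left_mono)
    moreover have "600 * l\<^sup>2 / real (card ?Z) \<le> 600 * l\<^sup>2 / x"
      using Zx x4 by (intro divide_left_mono) auto
    moreover have "x powr (- 24 / 25) * (x / 4 - 1) \<le> q * real T"
      using qx T x4 q01 by (intro mult_mono) auto
    then have "exp (- (q * real T / 2)) \<le> exp (- (x powr (- 24 / 25) * (x / 4 - 1) / 2))" by simp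
    ultimately show ?thesis unfolding sparse_error_def \<delta>_def l_def by (rule combine)
  qed
  have "measure_pmf.prob graph_pmf {G. commutative_digraph h X (union G)} \<le> 2 * \<delta> + exp (- (q * real T / 2))"
  proof (rule prob_graph_pmf_slice[where j = h])
    fix f assume f: "\<And>i. 1 \<le> i \<Longrightarrow> i \<le> h \<Longrightarrow> i \<noteq> h \<Longrightarrow> f i \<in> layer_graphs i"
    let ?E = "f (h - 1)"
    have E: "?E \<in> layer_graphs (h - 1)" using f[of "h - 1"] hh by auto
    have sub: "?E \<subseteq> ?V \<times> ?Y" by (rule layer_graphsD(1)[OF E])
    have "card ?V \<le> card ?Y"
    proof -
      have "\<kappa> ^ (h - 1 - 1) * real m \<le> \<kappa> ^ (h - 1) * real m"
        using \<kappa> by (intro mult_right_mono power_increasing) auto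
      then show ?thesis using card_layer[OF hh(4)] n by simp
    qed
    moreover have "2 \<le> card {u\<in>?V. (u, y) \<in> ?E}" if "y \<in> ?Y" for y
    proof -
      have "{u\<in>?V. (u, y) \<in> ?E} = ?E\<inverse> `` {y}" using sub by auto
      then show ?thesis using layer_graphsD(3)[OF E that] d_bounds by simp
    qed
    ultimately have "\<exists>v w. inj_on v {..<T} \<and> inj_on w {..<T} \<and> v ` {..<T} \<inter> w ` {..<T} = {} \<and>
        (\<forall>j<T. v j \<in> ?Y \<and> w j \<in> ?Y \<and> (\<exists>u\<in>?V. (u, v j) \<in> ?E \<and> (u, w j) \<in> ?E))"
      using T(3) by (intro exists_disjoint_pairs[OF fin(3,1)])
    then obtain v w where vw: "inj_on v {..<T}" "inj_on w {..<T}" "v ` {..<T} \<inter> w ` {..<T} = {}"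
      "\<forall>j<T. v j \<in> ?Y \<and> w j \<in> ?Y \<and> (\<exists>u\<in>?V. (u, v j) \<in> ?E \<and> (u, w j) \<in> ?E)"
      by (elim exE conjE)
    let ?R = "?Y - (v ` {..<T} \<union> w ` {..<T})"
    have "card (v ` {..<T} \<union> w ` {..<T}) \<le> T + T"
      by (rule order_trans[OF card_Un_le add_mono]) (use card_image_le[of "{..<T}"] in auto)
    moreover have "v ` {..<T} \<union> w ` {..<T} \<subseteq> ?Y" using vw(4) by auto
    then have "card ?R = card ?Y - card (v ` {..<T} \<union> w ` {..<T})"
      by (intro card_Diff_subset) auto
    ultimately have "T \<le> card ?R" using T(3) by linarith
    then obtain A where A: "A \<subseteq> ?R" "card A = T" "finite A"
      by (meson obtain_subset_with_card_n)
    obtain a where a: "bij_betw a {..<T} A"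
      using ex_bij_betw_nat_finite[OF A(3)] A(2) by (auto simp: atLeast0LessThan)
    have a_in: "a j \<in> ?R" if "j < T" for j
      using bij_betwE[OF a] that A(1) by blast
    have apart: "v i \<noteq> a j \<and> v i \<noteq> w j \<and> a i \<noteq> w j" if "i < T" "j < T" for i j
    proof -
      have "v i \<in> v ` {..<T}" "w j \<in> w ` {..<T}" using that by simp_all
      then show ?thesis using vw(3) a_in[OF that(1)] a_in[OF that(2)] by (metis Diff_iff UnCI disjoint_iff)
    qed
    have a_inj: "inj_on a {..<T}" using a by (rule bij_betw_imp_inj_on)
    have count: "real (card {g\<in>?F. \<forall>j<T. g (v j) \<inter> g (w j) \<noteq> {}}) \<le> (2 * \<delta> + exp (- (q * real T / 2))) * card ?F"
    proof (rule card_all_meet_le[OF fin(1,2) T(2), where a = a])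
      fix j assume j: "j < T"
      show vaw: "v j \<in> ?Y \<and> a j \<in> ?Y \<and> w j \<in> ?Y" using vw(4) a_in[OF j] j by auto
      show ne: "v j \<noteq> a j \<and> v j \<noteq> w j \<and> a j \<noteq> w j"
        using apart[OF j j] by metis
      show "real (card {g\<in>?F. \<not> likely_disjoint q (g (v j)) (g (a j)) (g (w j))}) \<le> \<delta> * card ?F"
        unfolding q_def \<delta>_def
      proof (rule card_unlikely_disjoint_le[OF fin(1,2)])
        show "card ?Y * D = card ?Z * d" using edge_count[OF hh(1)] by simp
        show "?Z \<noteq> {}" using Zx x4 by auto
      qed (use vaw ne dY l0 mean in auto)
    next
      fix i j assume ij: "i < T" "j < T" "i \<noteq> j"
      have "v i \<noteq> v j" "a i \<noteq> a j" using vw(1) a_inj ij by (auto simp: inj_on_eq_iff)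
      then show "{v i, a i} \<inter> {v j, a j, w j} = {}"
        using apart[OF ij(1,2)] apart[OF ij(2,1)] by simp
    qed (use q01 in auto)
    show "measure_pmf.prob (pmf_of_set (layer_graphs h)) {e. commutative_digraph h X (union (f(h := e)))} \<le>
        2 * \<delta> + exp (- (q * real T / 2))"
    proof (rule prob_pmf_of_set_le_bij[OF rows[OF hh(1) order_refl] _ count])
      fix e assume e: "e \<in> layer_graphs h" "commutative_digraph h X (union (f(h := e)))"
      let ?G = "f(h := e)"
      have G: "graph_family ?G" using f e by (auto simp: graph_family_def)
      show "\<forall>j<T. (\<lambda>y\<in>?Y. e `` {y}) (v j) \<inter> (\<lambda>y\<in>?Y. e `` {y}) (w j) \<noteq> {}"
      proof (intro allI impI notI)
        fix j assume j: "j < T" "(\<lambda>y\<in>?Y. e `` {y}) (v j) \<inter> (\<lambda>y\<in>?Y. e `` {y}) (w j) = {}"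
        then obtain u where u: "(u, v j) \<in> ?E" "(u, w j) \<in> ?E" "v j \<in> ?Y" "w j \<in> ?Y"
          using vw(4) by blast
        have "\<not> commutative_digraph h X (union ?G)"
          by (rule not_commutative_unionI[OF G h, of u "v j" "w j"]) (use u j hh in auto)
        then show False using e by simp
      qed
    qed
  next
    show "0 \<le> 2 * \<delta> + exp (- (q * real T / 2))"
      unfolding \<delta>_def using l0 by (intro add_nonneg_nonneg) auto
  qed (use h in auto)
  then show ?thesis
    unfolding prob_random_layered_digraph using bound by (simp add: x_def)
qed

lemma powi_diff_two: "2 \<le> h \<Longrightarrow> x powi (int h - 2) = x ^ (h - 2)"
  using power_int_of_nat[of x "h - 2"] by (simp add: of_nat_diff)

lemma admissible_degree:
  assumes k: "1 \<le> k" and adm: "admissible k h m d X"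
  obtains D where "rat_of_nat D = k * rat_of_nat d"
proof -
  have "k * rat_of_nat d \<in> \<int>" using adm by (simp add: admissible_def)
  moreover have "0 \<le> k * rat_of_nat d" using k by simp
  ultimately have "k * rat_of_nat d \<in> \<nat>" by (simp add: Nats_altdef2)
  then show thesis using that by (auto elim: Nats_cases)
qed

theorem theorem5:
  fixes k :: rat and h :: nat
  assumes "k \<ge> 1" and "h \<ge> 1"
  shows "(h \<ge> 2 \<longrightarrow>
      (\<forall>\<epsilon>>0. \<forall>\<^sub>F m in sequentially. \<forall>d. \<forall>X :: nat \<Rightarrow> 'v set.
        admissible k h m d X \<longrightarrow>
        real d \<le> sqrt (1 / 3 * real_of_rat k powi (int h - 2) * real m * ln (real_of_rat k * real m)) \<longrightarrow>
        measure_pmf.prob (random_layered_digraph k d h X) {E. \<not> commutative_digraph h X E} \<ge> 1 - \<epsilon>)) \<and>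
    (\<forall>\<epsilon>>0. \<forall>\<^sub>F m in sequentially. \<forall>d. \<forall>X :: nat \<Rightarrow> 'v set.
        admissible k h m d X \<longrightarrow>
        real d \<ge> 3 * sqrt (real_of_rat k powi (int h - 2) * real m *
                            ln (real h * real_of_rat k ^ (h + 1) * real m)) \<longrightarrow>
        measure_pmf.prob (random_layered_digraph k d h X) {E. commutative_digraph h X E} \<ge> 1 - \<epsilon>)"
proof (intro conjI impI allI)
  let ?k = "real_of_rat k"
  have k1: "1 \<le> ?k" using assms(1) by simp
  fix \<epsilon> :: real assume h: "2 \<le> h" and \<epsilon>: "0 < \<epsilon>"
  \<comment> \<open>The error depends on \<open>m\<close> only, so one threshold for
    \<open>m\<close> serves all \<open>d\<close> and \<open>X\<close> simultaneously.\<close>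
  have "filterlim (\<lambda>m. ?k * real m) at_top sequentially"
    using k1 by (intro filterlim_tendsto_pos_mult_at_top[OF tendsto_const _ filterlim_real_sequentially]) simp
  then have "((\<lambda>m. sparse_error (?k * real m)) \<longlongrightarrow> 0) sequentially"
    by (rule filterlim_compose[OF sparse_error_tendsto])
  then have "\<forall>\<^sub>F m in sequentially. sparse_error (?k * real m) < \<epsilon>"
    using \<epsilon> by (rule order_tendstoD)
  then show "\<forall>\<^sub>F m in sequentially. \<forall>d. \<forall>X :: nat \<Rightarrow> 'v set.
      admissible k h m d X \<longrightarrow>
      real d \<le> sqrt (1 / 3 * ?k powi (int h - 2) * real m * ln (?k * real m)) \<longrightarrow>
      measure_pmf.prob (random_layered_digraph k d h X) {E. \<not> commutative_digraph h X E} \<ge> 1 - \<epsilon>"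
    using eventually_ge_at_top[of 4]
  proof eventually_elim
    fix m :: nat assume err: "sparse_error (?k * real m) < \<epsilon>" and m: "4 \<le> m"
    show "\<forall>d. \<forall>X :: nat \<Rightarrow> 'v set. admissible k h m d X \<longrightarrow>
      real d \<le> sqrt (1 / 3 * ?k powi (int h - 2) * real m * ln (?k * real m)) \<longrightarrow>
      measure_pmf.prob (random_layered_digraph k d h X) {E. \<not> commutative_digraph h X E} \<ge> 1 - \<epsilon>"
    proof (intro allI impI)
      fix d and X :: "nat \<Rightarrow> 'v set"
      let ?a = "1 / 3 * ?k ^ (h - 2) * real m * ln (?k * real m)"
      assume adm: "admissible k h m d X"
        and sparse: "real d \<le> sqrt (1 / 3 * ?k powi (int h - 2) * real m * ln (?k * real m))"
      obtain D where "rat_of_nat D = k * rat_of_nat d"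
        by (rule admissible_degree[OF assms(1) adm])
      then interpret layered_setup k h m d D X
        using adm assms(1) by unfold_locales
      have "1 * 1 \<le> ?k * real m" using k1 m by (intro mult_mono) auto
      then have "0 \<le> ?a" using k1 by simp
      have "real d ^ 2 \<le> sqrt ?a ^ 2"
        using sparse unfolding powi_diff_two[OF h] by (rule power_mono) simp
      also have "\<dots> = ?a" using \<open>0 \<le> ?a\<close> by (rule real_sqrt_pow2)
      finally have "measure_pmf.prob (random_layered_digraph k d h X) {E. commutative_digraph h X E} < \<epsilon>"
        using prob_commutative_le[OF h m] err by linarith
      then show "1 - \<epsilon> \<le> measure_pmf.prob (random_layered_digraph k d h X) {E. \<not> commutative_digraph h X E}"
        using measure_pmf.prob_compl[of "{E. commutative_digraph h X E}" "random_layered_digraph k d h X"]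
        by (simp add: Compl_eq_Diff_UNIV[symmetric] Collect_neg_eq)
    qed
  qed
next
  let ?k = "real_of_rat k"
  have k1: "1 \<le> ?k" using assms(1) by simp
  fix \<epsilon> :: real assume \<epsilon>: "0 < \<epsilon>"
  have "((\<lambda>m. 2 * real h * real m powr (- 1 / 4)) \<longlongrightarrow> 0) sequentially"
    by real_asymp
  then have "\<forall>\<^sub>F m in sequentially. 2 * real h * real m powr (- 1 / 4) < \<epsilon>"
    using \<epsilon> by (rule order_tendstoD)
  then show "\<forall>\<^sub>F m in sequentially. \<forall>d. \<forall>X :: nat \<Rightarrow> 'v set.
      admissible k h m d X \<longrightarrow>
      real d \<ge> 3 * sqrt (?k powi (int h - 2) * real m * ln (real h * ?k ^ (h + 1) * real m)) \<longrightarrow>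
      measure_pmf.prob (random_layered_digraph k d h X) {E. commutative_digraph h X E} \<ge> 1 - \<epsilon>"
    using eventually_ge_at_top[of 36]
  proof eventually_elim
    fix m :: nat assume err: "2 * real h * real m powr (- 1 / 4) < \<epsilon>" and m: "36 \<le> m"
    show "\<forall>d. \<forall>X :: nat \<Rightarrow> 'v set. admissible k h m d X \<longrightarrow>
      real d \<ge> 3 * sqrt (?k powi (int h - 2) * real m * ln (real h * ?k ^ (h + 1) * real m)) \<longrightarrow>
      measure_pmf.prob (random_layered_digraph k d h X) {E. commutative_digraph h X E} \<ge> 1 - \<epsilon>"
    proof (intro allI impI)
      fix d and X :: "nat \<Rightarrow> 'v set"
      let ?M = "real h * ?k ^ (h + 1) * real m"
      assume adm: "admissible k h m d X"
        and dense: "real d \<ge> 3 * sqrt (?k powi (int h - 2) * real m * ln ?M)"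
      obtain D where "rat_of_nat D = k * rat_of_nat d"
        by (rule admissible_degree[OF assms(1) adm])
      then interpret layered_setup k h m d D X
        using adm assms(1) by unfold_locales
      have "1 * 1 * real m \<le> ?M"
        using assms(2) k1 by (intro mult_mono mult_nonneg_nonneg one_le_power) auto
      then have mM: "real m \<le> ?M" by simp
      \<comment> \<open>For \<open>h = 1\<close> no such \<open>i\<close> exists and the estimate is
        vacuous; otherwise \<open>h \<ge> 2\<close> and the integer power in the threshold is an
        ordinary one.\<close>
      have "matching_error i \<le> real m powr (- 1 / 4)" if i: "1 \<le> i" "i < h" for i
      proof -
        let ?a = "?k ^ (h - 2) * real m * ln ?M"
        have h: "2 \<le> h" using i by simp
        have "exp 1 \<le> real m" using exp_le m by linarith
        then have "1 \<le> ln (real m)" using m by (simp add: ln_ge_iff)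
        also have "\<dots> \<le> ln ?M" using mM m by simp
        finally have lnM: "1 \<le> ln ?M" .
        \<comment> \<open>The bound \<open>36\<close> on \<open>m\<close> is chosen so that
          \<open>d ^ 2 \<ge> 9 * 36 = 18 ^ 2\<close>, the size of \<open>d\<close> required by
          \<open>matching_error_le\<close>.\<close>
        have "1 * 36 * 1 \<le> ?a"
          using k1 m lnM by (intro mult_mono one_le_power mult_nonneg_nonneg) auto
        then have a: "36 \<le> ?a" by simp
        have "(3 * sqrt ?a) ^ 2 \<le> real d ^ 2"
          using dense a unfolding powi_diff_two[OF h] by (intro power_mono) auto
        moreover have "(3 * sqrt ?a) ^ 2 = 9 * ?a"
          using a by (simp add: power_mult_distrib)
        ultimately have d2: "9 * ?a \<le> real d ^ 2" by simp
        then have "18 ^ 2 \<le> real d ^ 2" using a by simp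
        then have "18 \<le> d" using power2_le_imp_le[of 18 "real d"] by simp
        from matching_error_le[OF i this d2] have "matching_error i \<le> ?M powr (- 1 / 4)" .
        also have "\<dots> \<le> real m powr (- 1 / 4)"
          using mM m by (intro powr_mono2') auto
        finally show ?thesis .
      qed
      then have "measure_pmf.prob (random_layered_digraph k d h X) {E. \<not> commutative_digraph h X E} \<le>
          2 * real h * real m powr (- 1 / 4)"
        by (rule prob_not_commutative_le) auto
      then have "measure_pmf.prob (random_layered_digraph k d h X) {E. \<not> commutative_digraph h X E} < \<epsilon>"
        using err by linarith
      then show "1 - \<epsilon> \<le> measure_pmf.prob (random_layered_digraph k d h X) {E. commutative_digraph h X E}"
        using measure_pmf.prob_compl[of "{E. \<not> commutative_digraph h X E}" "random_layered_digraph k d h X"]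
        by (simp add: Compl_eq_Diff_UNIV[symmetric] Collect_neg_eq)
    qed
  qed
qed

end
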